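(* Let $\boldsymbol{M}$ be a weight sequence satisfying $\operatorname{(sm)}$ and $(p!)_p\subset\boldsymbol{M}$, and let $\boldsymbol{A}$ be a sequence satisfying $\operatorname{(nq)}$ and such that $\widehat{\boldsymbol{A}}$ is a weight sequence. Then the following statements are equivalent: (i) $\displaystyle\sum_{p=0}^\infty \frac{1}{m_p^{1/2}}=\infty$. (ii) $\mathcal{B}\colon\mathcal{A}_{\{\boldsymbol{M}_{+1}\}}(\mathbb{H})\to\Lambda_{\{\boldsymbol{M}_{+1}\}}$ is injective. (iii) $\mathcal{M}\colon C_{\{\boldsymbol{M}\}}(0,\infty)\to\Lambda_{\{\boldsymbol{M}_{+1}\}}$ is injective. (iv) $\mathcal{M}\colon\mathcal{S}_{\{\boldsymbol{M}\}}(0,\infty)\to\Lambda_{\{\boldsymbol{M}_{+1}\}}$ is injective. (v) $\mathcal{M}\colon\mathcal{S}^{\{\widehat{\boldsymbol{A}}\}}_{\{\boldsymbol{M}\}}(0,\infty)\to\Lambda_{\{\boldsymbol{M}_{+1}\}}$ is injective.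
   Context: All sequences are sequences of positive real numbers indexed by $\mathbb{N}_0=\{0,1,2,\dots\}$; for a sequence $\boldsymbol{M}=(M_p)_p$ (with $M_0=1$) the quotients are $m_p=M_{p+1}/M_p$. $\boldsymbol{M}$ is a weight sequence if $M_p^2\le M_{p-1}M_{p+1}$ for $p\ge1$ and $m_p\to\infty$. $\operatorname{(sm)}$: there are $C_0>0$, $H>1$ with $\log(m_{p+1}/m_p)\le C_0H^{p+1}$ for all $p\in\mathbb{N}_0$. $\operatorname{(nq)}$: $\sum_{p\ge0}1/((p+1)a_p)<\infty$ (for $\boldsymbol{A}$ with quotients $a_p$). $\widehat{\boldsymbol{A}}=(p!A_p)_p$, $\boldsymbol{M}_{+1}=(M_{p+1})_p$. $(p!)_p\subset\boldsymbol{M}$ means $p!\le Ch^pM_p$ for all $p$ and some $C,h>0$. $\mathbb{H}$ is the open upper half-plane. For a sequence $\boldsymbol{N}$ and $h>0$, $\mathcal{A}_{\boldsymbol{N},h}(\mathbb{H})$ is the space of holomorphic $f$ on $\mathbb{H}$ with $\sup_{p\in\mathbb{N}_0}\sup_{z\in\mathbb{H}}|f^{(p)}(z)|/(h^pN_p)<\infty$, and $\mathcal{A}_{\{\boldsymbol{N}\}}(\mathbb{H})=\bigcup_{h>0}\mathcal{A}_{\boldsymbol{N},h}(\mathbb{H})$; each such $f$ and all its derivatives extend continuously to $\overline{\mathbb{H}}$, and $f^{(p)}(0)$ denotes the value of this extension at $0$. $\Lambda_{\{\boldsymbol{N}\}}$ is the space of complex sequences $(c_p)_p$ with $\sup_p|c_p|/(h^pN_p)<\infty$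 for some $h>0$. The Borel map is $\mathcal{B}(f)=(f^{(p)}(0))_p$. $C_{\{\boldsymbol{M}\}}(0,\infty)$ is the space of continuous $\varphi$ on $(0,\infty)$ with $\sup_{p}\sup_{x>0}x^p|\varphi(x)|/(h^pM_p)<\infty$ for some $h>0$. $\mathcal{S}_{\{\boldsymbol{M}\}}(0,\infty)$ is the space of $\varphi\in C^\infty(\mathbb{R})$ with support in $[0,\infty)$ for which there is $h>0$ with $\sup_p\sup_{x\in\mathbb{R}}|x^p\varphi^{(q)}(x)|/(h^pM_p)<\infty$ for every $q\in\mathbb{N}_0$. $\mathcal{S}^{\{\widehat{\boldsymbol{A}}\}}_{\{\boldsymbol{M}\}}(0,\infty)$ is the space of $\varphi\in C^\infty(\mathbb{R})$ with support in $[0,\infty)$ for which there is $h>0$ with $\sup_{p,q}\sup_{x}|x^p\varphi^{(q)}(x)|/(h^{p+q}M_pq!A_q)<\infty$. The moment map is $\mathcal{M}(\varphi)=(\mu_p(\varphi))_p$, $\mu_p(\varphi)=\int_0^\infty x^p\varphi(x)\,dx$ (defined on these spaces, viewing elements of the last two as functions on $(0,\infty)$). *)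

theory Defs
  imports "HOL-Complex_Analysis.Complex_Analysis"
begin

definition quot :: "(nat \<Rightarrow> real) \<Rightarrow> nat \<Rightarrow> real" where
  "quot M p = M (Suc p) / M p"

definition weight_seq :: "(nat \<Rightarrow> real) \<Rightarrow> bool" where
  "weight_seq M \<longleftrightarrow> (\<forall>p. M p > 0) \<and> M 0 = 1 \<and>
     (\<forall>p\<ge>1. (M p)^2 \<le> M (p - 1) * M (p + 1)) \<and>
     filterlim (quot M) at_top sequentially"

definition cond_sm :: "(nat \<Rightarrow> real) \<Rightarrow> bool" where
  "cond_sm M \<longleftrightarrow> (\<exists>C0 H. C0 > 0 \<and> H > 1 \<and>
     (\<forall>p. ln (quot M (Suc p) / quot M p) \<le> C0 * H ^ (p + 1)))"

definition cond_nq :: "(nat \<Rightarrow> real) \<Rightarrow> bool" where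
  "cond_nq A \<longleftrightarrow> summable (\<lambda>p. 1 / ((real p + 1) * quot A p))"

definition hat_seq :: "(nat \<Rightarrow> real) \<Rightarrow> nat \<Rightarrow> real" where
  "hat_seq A p = fact p * A p"

definition shift1 :: "(nat \<Rightarrow> real) \<Rightarrow> nat \<Rightarrow> real" where
  "shift1 M p = M (Suc p)"

definition fact_incl :: "(nat \<Rightarrow> real) \<Rightarrow> bool" where
  "fact_incl M \<longleftrightarrow> (\<exists>C h. C > 0 \<and> h > 0 \<and> (\<forall>p. fact p \<le> C * h ^ p * M p))"

definition upper_half :: "complex set" where
  "upper_half = {z. Im z > 0}"

definition ultrahol_H :: "(nat \<Rightarrow> real) \<Rightarrow> (complex \<Rightarrow> complex) set" where
  "ultrahol_H N = {f. f holomorphic_on upper_half \<and>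
     (\<exists>h K. h > 0 \<and> (\<forall>p. \<forall>z\<in>upper_half. norm ((deriv ^^ p) f z) \<le> K * h ^ p * N p))}"

text \<open>Value at 0 of the continuous extension of the p-th derivative to the closed half-plane.\<close>
definition borel_coeff :: "(complex \<Rightarrow> complex) \<Rightarrow> nat \<Rightarrow> complex" where
  "borel_coeff f p = Lim (at 0 within upper_half) ((deriv ^^ p) f)"

definition vderiv :: "(real \<Rightarrow> complex) \<Rightarrow> real \<Rightarrow> complex" where
  "vderiv f = (\<lambda>x. vector_derivative f (at x))"

definition smooth_R :: "(real \<Rightarrow> complex) \<Rightarrow> bool" where
  "smooth_R f \<longleftrightarrow> (\<forall>q x. ((vderiv ^^ q) f) differentiable (at x))"

definition C_M :: "(nat \<Rightarrow> real) \<Rightarrow> (real \<Rightarrow> complex) set" where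
  "C_M M = {\<phi>. continuous_on {0<..} \<phi> \<and>
     (\<exists>h K. h > 0 \<and> (\<forall>p. \<forall>x>0. x ^ p * norm (\<phi> x) \<le> K * h ^ p * M p))}"

definition S_M :: "(nat \<Rightarrow> real) \<Rightarrow> (real \<Rightarrow> complex) set" where
  "S_M M = {\<phi>. smooth_R \<phi> \<and> (\<forall>x<0. \<phi> x = 0) \<and>
     (\<exists>h. h > 0 \<and> (\<forall>q. \<exists>K. \<forall>p x. \<bar>x\<bar> ^ p * norm ((vderiv ^^ q) \<phi> x) \<le> K * h ^ p * M p))}"

definition S_AM :: "(nat \<Rightarrow> real) \<Rightarrow> (nat \<Rightarrow> real) \<Rightarrow> (real \<Rightarrow> complex) set" where
  "S_AM A M = {\<phi>. smooth_R \<phi> \<and> (\<forall>x<0. \<phi> x = 0) \<and>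
     (\<exists>h K. h > 0 \<and> (\<forall>p q x. \<bar>x\<bar> ^ p * norm ((vderiv ^^ q) \<phi> x)
          \<le> K * h ^ (p + q) * M p * fact q * A q))}"

definition moment :: "(real \<Rightarrow> complex) \<Rightarrow> nat \<Rightarrow> complex" where
  "moment \<phi> p = (LINT x:{0<..}|lborel. (x ^ p) *\<^sub>R \<phi> x)"

end

theory Submission
  imports Defs "HOL-Probability.Probability" "HOL-Real_Asymp.Real_Asymp"
begin

text \<open>
  The implications run in the cycle (i), (ii), (iii), (iv), (v), (i).

  (i) to (ii): a difference of two functions with equal Borel images, rotated to the right half-plane,
  is a function \<open>g\<close> all of whose derivatives vanish at 0. Its Laplace transform, taken along rotating
  rays, extends to the slit plane, and integration by parts bounds it by \<open>h^p M(p+1) |s|^(-p)\<close>.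
  In \<open>w = sqrt s\<close> one gets \<open>G\<close> on the right half-plane with \<open>|G(w)| \<le> K h^p M(p+1) |w|^(-2p-1) / Re w\<close>.
  After multiplying \<open>G\<close> by finitely many factors \<open>1 + w/a + w^2/a^2\<close> with \<open>a = sqrt (h m(j+1))\<close>, which
  have modulus at most \<open>max 1 (t^2/a^2)\<close> at \<open>w = \<i>t\<close>, the product is still bounded, uniformly in the
  number of factors; at a positive \<open>x\<close> the factors exceed \<open>1 + x/a\<close>, so divergence of \<open>\<Sum> 1/a\<close> forces
  \<open>G = 0\<close>, hence \<open>g = 0\<close>.

  (ii) to (iii): \<open>f(z) = \<integral> exp(\<i>zx) \<phi>(x) dx\<close> has Borel image \<open>\<i>^p \<mu>_p(\<phi>)\<close>; (sm) is what keeps the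
  absolute moments of \<open>\<phi>\<close> below \<open>K h^p M(p+1)\<close>.

  (v) to (i), by contraposition: if \<open>\<Sum> 1/sqrt m\<close> converges, let \<open>Y = 1 + \<Sum> c_j U_j\<close> with independent uniform
  \<open>U_j\<close> and \<open>c_(2j) = c_(2j+1)\<close> proportional to \<open>1/sqrt m_j\<close>. Then \<open>\<phi>(x) = E sin(Y sqrt x)\<close> is a nonzero
  element of \<open>C_M\<close>, and its moments vanish by Abel summation. Averaging the translates of \<open>\<phi>\<close> by a second such
  random series, with coefficients proportional to \<open>1/((j+1) a_j)\<close>, which are summable by (nq), keeps the
  moments zero and makes \<open>\<phi>\<close> ultradifferentiable: each differentiation
  replaces one uniform average by a difference quotient.
\<close>

section \<open>Laplace transforms of bounded functions\<close>

lemma exp_decay_integrable: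
  assumes "a > 0"
  shows "set_integrable lborel {0<..} (\<lambda>r::real. exp (-(a * r)))"
    and "(LINT r:{0<..}|lborel. exp (-(a * r))) = 1 / a"
proof -
  have hi: "((\<lambda>r::real. exp (-a * r)) has_integral exp (-a * 0) / a) {0<..}"
    using has_integral_exp_minus_to_infinity[OF assms, of 0]
      has_integral_interior[of "{0::real..}" "\<lambda>r::real. exp (-a * r)"] by simp
  then have "(\<lambda>r::real. exp (-a * r)) absolutely_integrable_on {0<..}"
    by (intro nonnegative_absolutely_integrable_1) (auto simp: integrable_on_def)
  then show I: "set_integrable lborel {0<..} (\<lambda>r::real. exp (-(a * r)))"
    unfolding set_integrable_def
    by (subst (asm) integrable_completion) auto
  have "(LINT r:{0<..}|lborel. exp (-(a * r))) = integral {0<..} (\<lambda>r. exp (-(a*r)))"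
    using set_borel_integral_eq_integral(2)[OF I] by simp
  with hi show "(LINT r:{0<..}|lborel. exp (-(a * r))) = 1 / a"
    by (simp add: integral_unique)
qed

lemma
  fixes f :: "'i \<Rightarrow> 'b \<Rightarrow> 'c::{banach, second_countable_topology}"
  assumes "\<And>i. set_integrable M A (f i)"
  shows set_integrable_sum: "set_integrable M A (\<lambda>x. \<Sum>i\<in>I. f i x)"
    and set_integral_sum: "(LINT x:A|M. \<Sum>i\<in>I. f i x) = (\<Sum>i\<in>I. LINT x:A|M. f i x)"
  using assms unfolding set_integrable_def set_lebesgue_integral_def by (simp_all add: scaleR_sum_right)

definition laplace :: "(real \<Rightarrow> complex) \<Rightarrow> complex \<Rightarrow> complex" where
  "laplace g s = (LINT r:{0<..}|lborel. exp (-(s * of_real r)) * g r)"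

text \<open>A single term of the exponential series of \<open>a * r\<close> is at most the whole
  sum, because all terms are nonnegative.\<close>

lemma power_le_fact_exp:
  fixes a r :: real
  assumes "a > 0" "r \<ge> 0"
  shows "r ^ k \<le> fact k / a ^ k * exp (a * r)"
proof -
  have "(a * r) ^ k / fact k \<le> exp (a * r)"
    using sum_le_suminf[of "\<lambda>n. (a * r) ^ n /\<^sub>R fact n" "{k}"] exp_converges[of "a * r"] assms
    by (auto simp: sums_iff divide_inverse mult.commute)
  then show ?thesis using assms by (simp add: power_mult_distrib field_simps)
qed

text \<open>Half of the decay rate \<open>Re s\<close> absorbs the power \<open>r ^ k\<close>; the
  other half keeps the majorant integrable.\<close>

lemma laplace_integrable_power:
  assumes g: "continuous_on {0<..} g" "\<And>r. r > 0 \<Longrightarrow> norm (g r) \<le> B" and s: "Re s > 0"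
  shows "set_integrable lborel {0<..} (\<lambda>r. exp (-(s * of_real r)) * (of_real (r ^ k) * g r))"
proof -
  define a where "a = Re s / 2"
  have a: "a > 0" using s by (simp add: a_def)
  have B: "B \<ge> 0" using g(2)[of 1] norm_ge_zero[of "g 1"] by linarith
  define C where "C = fact k / a ^ k * B"
  have C: "C \<ge> 0" using a B by (simp add: C_def)
  have I: "set_integrable lborel {0<..} (\<lambda>r::real. C * exp (-(a * r)))"
    using exp_decay_integrable(1)[OF a] by (rule set_integrable_mult_right)
  show ?thesis
  proof (rule set_integrable_bound[OF I])
    show "set_borel_measurable lborel {0<..} (\<lambda>r. exp (-(s * of_real r)) * (of_real (r ^ k) * g r))"
      unfolding set_borel_measurable_def measurable_lborel2
      by (intro borel_measurable_continuous_on_indicator) (auto intro!: continuous_intros g(1))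
    show "AE r in lborel. r \<in> {0<..} \<longrightarrow> norm (exp (-(s * of_real r)) * (of_real (r ^ k) * g r))
           \<le> norm (C * exp (-(a * r)))"
    proof (intro AE_I2 impI)
      fix r :: real assume r: "r \<in> {0<..}"
      have rk: "r ^ k \<le> fact k / a ^ k * exp (a * r)"
        using power_le_fact_exp a r by simp
      have "norm (exp (-(s * of_real r)) * (of_real (r ^ k) * g r)) = exp (- (2 * a * r)) * (r ^ k * norm (g r))"
        using r by (simp add: norm_mult a_def norm_power)
      also have "\<dots> \<le> exp (- (2 * a * r)) * ((fact k / a ^ k * exp (a * r)) * B)"
        using r g(2)[of r] B a rk by (intro mult_left_mono mult_mono) auto
      also have "exp (- (2 * a * r)) = exp (-(a*r)) * exp (-(a*r))"
        by (simp flip: exp_add)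
      also have "exp (-(a*r)) * exp (-(a*r)) * ((fact k / a ^ k * exp (a * r)) * B) = C * exp (-(a*r))"
        by (simp add: C_def exp_minus)
      finally show "norm (exp (-(s * of_real r)) * (of_real (r ^ k) * g r)) \<le> norm (C * exp (-(a * r)))"
        using C by simp
    qed
  qed
qed

lemma laplace_integrable:
  assumes g: "continuous_on {0<..} g" "\<And>r. r > 0 \<Longrightarrow> norm (g r) \<le> B" and s: "Re s > 0"
  shows "set_integrable lborel {0<..} (\<lambda>r. exp (-(s * of_real r)) * g r)"
  using laplace_integrable_power[OF assms, of 0] by simp

lemma norm_laplace_le:
  assumes g: "continuous_on {0<..} g" "\<And>r. r > 0 \<Longrightarrow> norm (g r) \<le> B" and s: "Re s > 0"
  shows "norm (laplace g s) \<le> B / Re s"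
proof -
  have "norm (laplace g s) \<le> (LINT r:{0<..}|lborel. norm (exp (-(s * of_real r)) * g r))"
    unfolding laplace_def by (rule set_integral_norm_bound[OF laplace_integrable[OF assms]])
  also have "\<dots> \<le> (LINT r:{0<..}|lborel. B * exp (-(Re s * r)))"
  proof (rule set_integral_mono)
    show "set_integrable lborel {0<..} (\<lambda>r. norm (exp (-(s * of_real r)) * g r))"
      using laplace_integrable[OF assms] by (rule set_integrable_norm)
    show "set_integrable lborel {0<..} (\<lambda>r::real. B * exp (-(Re s * r)))"
      using exp_decay_integrable(1)[OF s] by (rule set_integrable_mult_right)
    fix r :: real assume "r \<in> {0<..}"
    then show "norm (exp (-(s * of_real r)) * g r) \<le> B * exp (-(Re s * r))"
      using g(2)[of r] by (simp add: norm_mult mult.commute)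
  qed
  also have "\<dots> = B / Re s"
    using exp_decay_integrable(2)[OF s] by simp
  finally show ?thesis .
qed

text \<open>Differentiation under the integral with an explicit rate: the integrand of the error is
  a first-order Taylor remainder of \<open>exp\<close>, so the error of the difference quotient is
  at most \<open>norm h * C\<close>, where \<open>C\<close> is a weighted second absolute moment of
  \<open>g\<close>.\<close>

lemma laplace_has_field_derivative:
  assumes g: "continuous_on {0<..} g" "\<And>r. r > 0 \<Longrightarrow> norm (g r) \<le> B" and s: "Re s > 0"
  shows "(laplace g has_field_derivative laplace (\<lambda>r. - (of_real r * g r)) s) (at s)"
proof -
  \<comment> \<open>For \<open>norm h < \<sigma>\<close> the remainder grows by at most
    \<open>exp (\<sigma> * r)\<close>, so the single weight \<open>exp (-(\<sigma> * r))\<close>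
    dominates it for all such \<open>h\<close>.\<close>
  define \<sigma> where "\<sigma> = Re s / 2"
  have \<sigma>: "\<sigma> > 0" using s by (simp add: \<sigma>_def)
  define C where "C = (LINT r:{0<..}|lborel. norm (exp (-(of_real \<sigma> * of_real r)) * (of_real (r ^ 2) * g r)))"
  have "Re (of_real \<sigma>) > 0" using \<sigma> by simp
  note I2 = set_integrable_norm[OF laplace_integrable_power[OF g this, of 2]]
  have bound: "norm ((laplace g (s + h) - laplace g s) / h - laplace (\<lambda>r. - (of_real r * g r)) s) \<le> norm h * C"
    if h: "h \<noteq> 0" "norm h < \<sigma>" for h
  proof -
    have Re_h: "\<bar>Re h\<bar> < \<sigma>" using h abs_Re_le_cmod[of h] by linarith
    then have Rs: "Re (s + h) > 0" by (simp add: \<sigma>_def abs_if split: if_splits)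
    note Ia = laplace_integrable[OF g Rs] 
    note Ib = laplace_integrable[OF g s]
    have Ic: "set_integrable lborel {0<..} (\<lambda>r. exp (-(s * of_real r)) * - (of_real r * g r))"
      using laplace_integrable_power[OF g s, of 1] by (simp add: set_integrable_def)
    have Id: "set_integrable lborel {0<..} (\<lambda>r. h * (exp (-(s * of_real r)) * - (of_real r * g r)))"
      by (rule set_integrable_mult_right) (rule Ic)
    have "(LINT r:{0<..}|lborel. exp (-((s+h) * of_real r)) * g r - exp (-(s * of_real r)) * g r - h * (exp (-(s * of_real r)) * - (of_real r * g r)))
      = (LINT r:{0<..}|lborel. exp (-((s+h) * of_real r)) * g r - exp (-(s * of_real r)) * g r) - (LINT r:{0<..}|lborel. h * (exp (-(s * of_real r)) * - (of_real r * g r)))"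
      by (rule set_integral_diff(2)[OF set_integral_diff(1)[OF Ia Ib] Id])
    also have "(LINT r:{0<..}|lborel. exp (-((s+h) * of_real r)) * g r - exp (-(s * of_real r)) * g r) = laplace g (s + h) - laplace g s"
      unfolding laplace_def by (rule set_integral_diff(2)[OF Ia Ib])
    also have "(LINT r:{0<..}|lborel. h * (exp (-(s * of_real r)) * - (of_real r * g r))) = h * laplace (\<lambda>r. - (of_real r * g r)) s"
      unfolding laplace_def by (rule set_integral_mult_right)
    finally have "(LINT r:{0<..}|lborel. exp (-((s+h) * of_real r)) * g r - exp (-(s * of_real r)) * g r - h * (exp (-(s * of_real r)) * - (of_real r * g r))) =
       laplace g (s + h) - laplace g s - h * laplace (\<lambda>r. - (of_real r * g r)) s" .
    with set_integral_norm_bound[OF set_integral_diff(1)[OF set_integral_diff(1)[OF Ia Ib] Id]]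
    have "norm (laplace g (s + h) - laplace g s - h * laplace (\<lambda>r. - (of_real r * g r)) s) 
       \<le> (LINT r:{0<..}|lborel. norm (exp (-((s+h) * of_real r)) * g r - exp (-(s * of_real r)) * g r - h * (exp (-(s * of_real r)) * - (of_real r * g r))))"
      by simp
    also have "\<dots> \<le> (LINT r:{0<..}|lborel. (norm h)^2 * norm (exp (-(of_real \<sigma> * of_real r)) * (of_real (r ^ 2) * g r)))"
    proof (rule set_integral_mono)
      show "set_integrable lborel {0<..} (\<lambda>r. norm (exp (-((s+h) * of_real r)) * g r - exp (-(s * of_real r)) * g r - h * (exp (-(s * of_real r)) * - (of_real r * g r))))"
        by (rule set_integrable_norm[OF set_integral_diff(1)[OF set_integral_diff(1)[OF Ia Ib] Id]])
      show "set_integrable lborel {0<..} (\<lambda>r. (norm h)^2 * norm (exp (-(of_real \<sigma> * of_real r)) * (of_real (r ^ 2) * g r)))"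
        by (rule set_integrable_mult_right[OF I2])
      fix r :: real assume r: "r \<in> {0<..}"
      define z where "z = - (h * of_real r)"
      let ?D = "exp (-((s+h) * of_real r)) * g r - exp (-(s * of_real r)) * g r - h * (exp (-(s * of_real r)) * - (of_real r * g r))"
      have "?D = exp (-(s * of_real r)) * g r * (exp z - (\<Sum>k\<le>1. z ^ k / fact k))"
      proof -
        have "-((s+h) * of_real r) = -(s * of_real r) + z" by (simp add: z_def ring_distribs)
        then have "exp (-((s+h) * of_real r)) = exp (-(s * of_real r)) * exp z" by (simp only: exp_add)
        then show ?thesis by (simp add: z_def ring_distribs)
      qed
      then have "norm ?D = norm (exp (-(s * of_real r))) * norm (g r) * norm (exp z - (\<Sum>k\<le>1. z ^ k / fact k))"
        by (simp only: norm_mult)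
      also have "\<dots> \<le> exp (-(Re s * r)) * norm (g r) * (exp \<bar>Re z\<bar> * norm z ^ Suc 1 / fact 1)"
        by (intro mult_mono Taylor_exp) auto
      also have "\<dots> = exp (-(Re s * r) + \<bar>Re h\<bar> * r) * ((norm h)^2 * (r^2 * norm (g r)))"
        unfolding exp_add using r by (simp add: z_def norm_mult abs_mult power2_eq_square)
      also have "\<dots> \<le> exp (-(\<sigma> * r)) * ((norm h)^2 * (r^2 * norm (g r)))"
      proof (intro mult_right_mono)
        have "\<bar>Re h\<bar> * r \<le> \<sigma> * r" using Re_h r by (intro mult_right_mono) auto
        then show "exp (-(Re s * r) + \<bar>Re h\<bar> * r) \<le> exp (-(\<sigma> * r))"
          by (simp add: \<sigma>_def)
      qed auto
      also have "\<dots> = (norm h)^2 * norm (exp (-(of_real \<sigma> * of_real r)) * (of_real (r ^ 2) * g r))"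
        by (simp add: norm_mult norm_power)
      finally show "norm (exp (-((s+h) * of_real r)) * g r - exp (-(s * of_real r)) * g r - h * (exp (-(s * of_real r)) * - (of_real r * g r)))
        \<le> (norm h)^2 * norm (exp (-(of_real \<sigma> * of_real r)) * (of_real (r ^ 2) * g r))" .
    qed
    also have "\<dots> = (norm h)^2 * C" by (simp add: C_def)
    finally have *: "norm (laplace g (s + h) - laplace g s - h * laplace (\<lambda>r. - (of_real r * g r)) s) \<le> (norm h)^2 * C" .
    have "(laplace g (s + h) - laplace g s) / h - laplace (\<lambda>r. - (of_real r * g r)) s
       = (laplace g (s + h) - laplace g s - h * laplace (\<lambda>r. - (of_real r * g r)) s) / h"
      using h by (simp add: field_simps)
    also have "norm \<dots> \<le> (norm h)^2 * C / norm h"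
      unfolding norm_divide using * by (intro divide_right_mono) auto
    also have "\<dots> = norm h * C" using h by (simp add: power2_eq_square)
    finally show ?thesis .
  qed
  have "((\<lambda>h. (laplace g (s + h) - laplace g s) / h - laplace (\<lambda>r. - (of_real r * g r)) s) \<longlongrightarrow> 0) (at 0)"
  proof (rule Lim_null_comparison)
    show "\<forall>\<^sub>F h in at 0. norm ((laplace g (s + h) - laplace g s) / h - laplace (\<lambda>r. - (of_real r * g r)) s) \<le> norm h * C"
      using bound \<sigma> by (auto simp: eventually_at intro!: exI[of _ \<sigma>])
    show "((\<lambda>h. norm h * C) \<longlongrightarrow> 0) (at (0::complex))"
      by (rule tendsto_eq_intros | simp)+
  qed
  then show ?thesis
    unfolding DERIV_def by (rule LIM_zero_cancel)
qed

lemma holomorphic_laplace: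
  assumes g: "continuous_on {0<..} g" "\<And>r. r > 0 \<Longrightarrow> norm (g r) \<le> B"
  shows "laplace g holomorphic_on {s. Re s > 0}"
  using laplace_has_field_derivative[OF g]
  by (subst holomorphic_on_open) (auto simp: open_halfspace_Re_gt)

text \<open>Lerch's theorem. Vanishing at the positive integers makes \<open>exp (-r) * g r\<close>
  orthogonal to every polynomial in \<open>exp (-r)\<close>, hence by Weierstrass to a bump around
  \<open>exp (-r0)\<close>. This is impossible where a rotated \<open>g\<close> has positive real
  part.\<close>

lemma laplace_eq_0_imp:
  assumes g: "continuous_on {0<..} g" "\<And>r. r > 0 \<Longrightarrow> norm (g r) \<le> B"
  assumes zero: "\<And>x. x > 0 \<Longrightarrow> laplace g (of_real x) = 0" and r0: "r0 > 0"
  shows "g r0 = 0"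
proof (rule ccontr)
  assume nz: "g r0 \<noteq> 0"
  have B: "B \<ge> 0" using g(2)[of 1] norm_ge_zero[of "g 1"] by linarith
  have poly: "(LINT r:{0<..}|lborel. of_real (exp (-r) * p (exp (-r))) * g r) = 0"
    and polyI: "set_integrable lborel {0<..} (\<lambda>r. of_real (exp (-r) * p (exp (-r))) * g r)"
    if p: "real_polynomial_function p" for p
  proof -
    obtain a n where pa: "p = (\<lambda>x. \<Sum>i\<le>n. a i * x ^ i)"
      using p real_polynomial_function_iff_sum by auto
    have eq: "of_real (exp (-r) * p (exp (-r))) * g r = (\<Sum>i\<le>n. of_real (a i) * (exp (-(of_real (real (Suc i)) * of_real r)) * g r))" for r
    proof -
      have "exp (-(of_real (real (Suc i)) * of_real r)) = complex_of_real (exp (-r) * exp (-r) ^ i)" for i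
      proof -
        have "exp (-(of_real (real (Suc i)) * of_real r)) = complex_of_real (exp (of_nat (Suc i) * (-r)))"
          by (simp add: exp_of_real[symmetric] del: of_nat_Suc)
        also have "exp (of_nat (Suc i) * (-r)) = exp (-r) ^ Suc i" by (rule exp_of_nat_mult)
        finally show ?thesis by simp
      qed
      then show ?thesis
        by (simp add: pa sum_distrib_left sum_distrib_right mult_ac)
    qed
    have I: "set_integrable lborel {0<..} (\<lambda>r. exp (-(of_real (real (Suc i)) * of_real r)) * g r)" for i
      by (rule laplace_integrable[OF g]) auto
    show "set_integrable lborel {0<..} (\<lambda>r. of_real (exp (-r) * p (exp (-r))) * g r)"
      unfolding eq by (rule set_integrable_sum[OF set_integrable_mult_right[OF I]])
    have z: "(LINT r:{0<..}|lborel. exp (-(of_real (real (Suc i)) * of_real r)) * g r) = 0" for i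
      using zero[of "real (Suc i)"] by (simp add: laplace_def)
    show "(LINT r:{0<..}|lborel. of_real (exp (-r) * p (exp (-r))) * g r) = 0"
      unfolding eq set_integral_sum[OF set_integrable_mult_right[OF I]] set_integral_mult_right z by simp
  qed
  \<comment> \<open>The rotation turns \<open>g r0\<close> into the positive number
    \<open>norm (g r0) ^ 2\<close>, so real parts can be compared.\<close>
  define c where "c = cnj (g r0)"
  have pos: "Re (c * g r0) > 0"
    using nz by (simp add: c_def complex_norm_square[symmetric] mult.commute flip: of_real_power)
  have "isCont (\<lambda>r. Re (c * g r)) r0"
    using g(1) r0 by (auto intro!: continuous_intros simp: continuous_on_eq_continuous_at)
  then have "((\<lambda>r. Re (c * g r)) \<longlongrightarrow> Re (c * g r0)) (at r0)" by (simp add: isCont_def)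
  from order_tendstoD(1)[OF this, of "Re (c * g r0) / 2"] pos
  have "\<forall>\<^sub>F r in at r0. Re (c * g r0) / 2 < Re (c * g r)" by simp
  then obtain d where d: "d > 0" "\<And>r. r \<noteq> r0 \<Longrightarrow> dist r r0 < d \<Longrightarrow> Re (c * g r0) / 2 < Re (c * g r)"
    by (auto simp: eventually_at)
  have d': "Re (c * g r) > Re (c * g r0) / 2" if "\<bar>r - r0\<bar> < d" for r
    using d(2)[of r] that pos by (cases "r = r0") (auto simp: dist_real_def)
  define e where "e = min (d/2) (r0/2)"
  have e: "e > 0" "e < d" "e < r0" using d(1) r0 by (auto simp: e_def)
  \<comment> \<open>The tent \<open>q\<close> has as radius the smaller gap between
    \<open>exp (-r0)\<close> and the images of \<open>r0 - e\<close> and \<open>r0 + e\<close>; so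
    \<open>q (exp (-r))\<close> vanishes unless \<open>r\<close> is within \<open>e\<close> of
    \<open>r0\<close>.\<close>
  define \<eta> where "\<eta> = min (exp (-(r0 - e)) - exp (-r0)) (exp (-r0) - exp (-(r0 + e)))"
  have \<eta>: "\<eta> > 0" using e by (simp add: \<eta>_def)
  define q where "q = (\<lambda>t::real. max 0 (\<eta> - \<bar>t - exp (-r0)\<bar>))"
  have supp: "q (exp (-r)) = 0" if "\<bar>r - r0\<bar> \<ge> e" for r
  proof (cases "r \<ge> r0")
    case True
    with that have "exp (-r) \<le> exp (-(r0+e))" by simp
    then show ?thesis unfolding q_def \<eta>_def by linarith
  next
    case False
    with that have "exp (-r) \<ge> exp (-(r0-e))" by simp
    then show ?thesis unfolding q_def \<eta>_def by linarith
  qed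
  have qc: "continuous_on S q" for S unfolding q_def by (intro continuous_intros)
  have q01: "0 \<le> q t" "q t \<le> \<eta>" for t using \<eta> by (auto simp: q_def)
  define F where "F = (\<lambda>r. of_real (exp (-r) * q (exp (-r))) * g r)"
  have expI: "set_integrable lborel {0<..} (\<lambda>r::real. exp (-r))"
    using exp_decay_integrable(1)[of 1] by simp
  have FI: "set_integrable lborel {0<..} F"
  proof (rule set_integrable_bound[OF set_integrable_mult_right[OF expI, of "\<eta> * B"]])
    show "set_borel_measurable lborel {0<..} F"
      unfolding set_borel_measurable_def measurable_lborel2 F_def
      by (intro borel_measurable_continuous_on_indicator)
         (auto intro!: continuous_intros g(1) continuous_on_compose2[OF qc[of UNIV]])
    show "AE r in lborel. r \<in> {0<..} \<longrightarrow> norm (F r) \<le> norm (\<eta> * B * exp (-r))"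
    proof (intro AE_I2 impI)
      fix r :: real assume "r \<in> {0<..}"
      then have "exp (-r) * q (exp (-r)) * norm (g r) \<le> exp (-r) * \<eta> * B"
        using g(2)[of r] q01 \<eta> by (intro mult_mono) auto
      then show "norm (F r) \<le> norm (\<eta> * B * exp (-r))"
        using q01 \<eta> B by (simp add: F_def norm_mult abs_mult mult_ac)
    qed
  qed
  have F0: "(LINT r:{0<..}|lborel. F r) = 0"
  proof -
    \<comment> \<open>\<open>exp (-r)\<close> stays in the unit interval, where the approximation is
      uniform; the remaining factor \<open>exp (-r)\<close> has integral 1 and makes the total error
      at most \<open>\<epsilon> * B\<close>.\<close>
    have "norm (LINT r:{0<..}|lborel. F r) \<le> \<epsilon> * B" if \<epsilon>: "\<epsilon> > 0" for \<epsilon>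
    proof -
      obtain p where p: "real_polynomial_function p" "\<And>t. t \<in> {0..1} \<Longrightarrow> \<bar>q t - p t\<bar> < \<epsilon>"
        using Stone_Weierstrass_real_polynomial_function[OF compact_Icc qc \<epsilon>, of 0 1] by blast
      let ?P = "\<lambda>r. of_real (exp (-r) * p (exp (-r))) * g r"
      have "norm (LINT r:{0<..}|lborel. F r) \<le> (LINT r:{0<..}|lborel. norm (F r - ?P r))"
        using set_integral_diff(2)[OF FI polyI[OF p(1)]] poly[OF p(1)]
          set_integral_norm_bound[OF set_integral_diff(1)[OF FI polyI[OF p(1)]]] by simp
      also have "\<dots> \<le> (LINT r:{0<..}|lborel. (\<epsilon> * B) * exp (-(1 * r)))"
      proof (rule set_integral_mono)
        show "set_integrable lborel {0<..} (\<lambda>r. norm (F r - ?P r))"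
          by (rule set_integrable_norm[OF set_integral_diff(1)[OF FI polyI[OF p(1)]]])
        show "set_integrable lborel {0<..} (\<lambda>r::real. (\<epsilon> * B) * exp (-(1 * r)))"
          by (intro set_integrable_mult_right exp_decay_integrable) auto
        fix r :: real assume r: "r \<in> {0<..}"
        have "F r - ?P r = of_real (exp (-r) * (q (exp (-r)) - p (exp (-r)))) * g r"
          by (simp add: F_def algebra_simps)
        also have "norm \<dots> = exp (-r) * (\<bar>q (exp (-r)) - p (exp (-r))\<bar> * norm (g r))"
          by (simp add: norm_mult abs_mult flip: of_real_diff)
        also have "\<dots> \<le> exp (-r) * (\<epsilon> * B)"
          using p(2)[of "exp (-r)"] r g(2)[of r] \<epsilon> by (intro mult_left_mono mult_mono) auto
        finally show "norm (F r - ?P r) \<le> (\<epsilon> * B) * exp (-(1 * r))" by (simp add: mult_ac)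
      qed
      also have "\<dots> = \<epsilon> * B" using exp_decay_integrable(2)[of 1] by simp
      finally show ?thesis .
    qed
    then have *: "norm (LINT r:{0<..}|lborel. F r) \<le> \<epsilon> * B" if "\<epsilon> > 0" for \<epsilon> using that by blast
    have "norm (LINT r:{0<..}|lborel. F r) \<le> 0 + e" if "e > 0" for e
    proof -
      have "norm (LINT r:{0<..}|lborel. F r) \<le> e / (B + 1) * B" using B that by (intro *) auto
      also have "\<dots> \<le> e" using B that by (simp add: field_simps)
      finally show ?thesis by simp
    qed
    then have "norm (LINT r:{0<..}|lborel. F r) \<le> 0" by (rule field_le_epsilon)
    then show ?thesis by simp
  qed
  define R where "R = (\<lambda>r. exp (-r) * q (exp (-r)) * Re (c * g r))"
  have cFI: "set_integrable lborel {0<..} (\<lambda>r. c * F r)" by (rule set_integrable_mult_right[OF FI])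
  have RF: "R r = Re (c * F r)" for r by (simp add: R_def F_def algebra_simps)
  have RI: "set_integrable lborel {0<..} R"
    using integrable_Re[OF cFI[unfolded set_integrable_def]] by (simp add: set_integrable_def RF[abs_def])
  have R0: "(LINT r:{0<..}|lborel. R r) = 0"
  proof -
    have "(LINT r:{0<..}|lborel. R r) = (LINT r|lborel. Re (indicator {0<..} r *\<^sub>R (c * F r)))"
      by (simp only: set_lebesgue_integral_def RF scaleR_complex.sel real_scaleR_def)
    also have "\<dots> = Re (LINT r:{0<..}|lborel. c * F r)"
      unfolding set_lebesgue_integral_def by (rule integral_Re[OF cFI[unfolded set_integrable_def]])
    finally show ?thesis using F0 by simp
  qed
  have Rnn: "R r \<ge> 0" for r
  proof (cases "\<bar>r - r0\<bar> \<ge> e")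
    case True then show ?thesis using supp by (simp add: R_def)
  next
    case False then show ?thesis using d'[of r] e pos q01 by (simp add: R_def)
  qed
  have q0: "q (exp (-r0)) = \<eta>" using \<eta> by (simp add: q_def)
  have "isCont (\<lambda>r. exp (-r) * q (exp (-r))) r0"
  proof -
    have "continuous_on UNIV (\<lambda>r. exp (-r) * q (exp (-r)))"
      by (intro continuous_intros continuous_on_compose2[OF qc[of UNIV]]) auto
    then show ?thesis by (simp add: continuous_on_eq_continuous_at)
  qed
  then have "((\<lambda>r. exp (-r) * q (exp (-r))) \<longlongrightarrow> exp (-r0) * \<eta>) (at r0)" by (simp add: isCont_def q0)
  from order_tendstoD(1)[OF this, of "exp (-r0) * \<eta> / 2"] \<eta>
  have "\<forall>\<^sub>F r in at r0. exp (-r0) * \<eta> / 2 < exp (-r) * q (exp (-r))" by simp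
  then obtain d2 where d2: "d2 > 0" "\<And>r. r \<noteq> r0 \<Longrightarrow> dist r r0 < d2 \<Longrightarrow> exp (-r0) * \<eta> / 2 < exp (-r) * q (exp (-r))"
    by (auto simp: eventually_at)
  define m where "m = exp (-r0) * \<eta> / 2 * (Re (c * g r0) / 2)"
  have m: "m > 0" using \<eta> pos by (simp add: m_def)
  define l where "l = min d d2 / 2"
  have l: "l > 0" "l < d" "l < d2" using d(1) d2(1) by (auto simp: l_def)
  \<comment> \<open>\<open>R\<close> is nonnegative with integral 0, yet at least \<open>m\<close>
    on an interval of length \<open>l\<close>.\<close>
  have "(LINT r:{0<..}|lborel. m * indicator {r0<..r0+l} r) \<le> (LINT r:{0<..}|lborel. R r)"
  proof (rule set_integral_mono[OF _ RI])
    show "set_integrable lborel {0<..} (\<lambda>r. m * indicator {r0<..r0+l} r :: real)"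
      unfolding set_integrable_def using r0 l by (intro integrable_mult_indicator integrable_mult_right integrable_real_indicator) auto
    fix r :: real assume "r \<in> {0<..}"
    show "m * indicator {r0<..r0+l} r \<le> R r"
    proof (cases "r \<in> {r0<..r0+l}")
      case True
      have "m \<le> (exp (-r) * q (exp (-r))) * Re (c * g r)"
        unfolding m_def using d'[of r] d2(2)[of r] True l pos \<eta> q01 by (intro mult_mono) (auto simp: dist_real_def)
      then show ?thesis using True by (simp add: R_def)
    qed (use Rnn in auto)
  qed
  moreover have "(LINT r:{0<..}|lborel. m * indicator {r0<..r0+l} r :: real) = m * l"
  proof -
    have "(\<lambda>r. indicator {0<..} r *\<^sub>R (m * indicator {r0<..r0+l} r :: real)) = (\<lambda>r. m * indicator {r0<..r0+l} r)"
      using r0 by (auto simp: indicator_def)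
    then show ?thesis using l by (simp only: set_lebesgue_integral_def) simp
  qed
  ultimately have "m * l \<le> 0" using R0 by linarith
  with m l show False by (simp add: mult_le_0_iff)
qed

section \<open>Uniqueness in the half-plane\<close>

text \<open>With \<open>\<tau> = t^2 / a\<close> the squared modulus is
  \<open>1 - \<tau> + \<tau>^2\<close>, which is at most 1 for \<open>\<tau> \<le> 1\<close> and at
  most \<open>\<tau>^2\<close> beyond. The linear term of the factor is what makes it grow on the
  positive axis without spoiling this bound.\<close>

lemma norm_comparison_factor_imaginary:
  fixes t a :: real
  assumes "a > 0"
  shows "norm (1 + (\<i> * t) / sqrt a + (\<i> * t)^2 / a) \<le> max 1 (t^2 / a)"
proof -
  define \<tau> where "\<tau> = t^2 / a"
  have \<tau>: "\<tau> \<ge> 0" using assms by (simp add: \<tau>_def)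
  have "1 + (\<i> * t) / sqrt a + (\<i> * t)^2 / a = Complex (1 - \<tau>) (t / sqrt a)"
    by (simp add: complex_eq_iff \<tau>_def power_mult_distrib)
  then have "norm (1 + (\<i> * t) / sqrt a + (\<i> * t)^2 / a) ^ 2 = (1 - \<tau>)^2 + \<tau>"
    using assms by (simp add: cmod_power2 power_divide \<tau>_def)
  also have "\<dots> \<le> (max 1 \<tau>)^2"
  proof (cases "\<tau> \<le> 1")
    case True
    then have "\<tau> * \<tau> \<le> 1 * \<tau>" using \<tau> by (intro mult_right_mono) auto
    then show ?thesis using True by (simp add: max_def power2_eq_square algebra_simps)
  next
    case False
    then show ?thesis by (simp add: max_def power2_eq_square algebra_simps)
  qed
  finally have "norm (1 + (\<i> * t) / sqrt a + (\<i> * t)^2 / a) \<le> max 1 \<tau>"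
    by (rule power2_le_imp_le) auto
  then show ?thesis by (simp add: \<tau>_def)
qed

text \<open>Since \<open>n\<close> increases, the indices with \<open>\<tau> / n j \<ge> 1\<close>
  form an initial segment. Its length \<open>k\<close> is the exponent at which the growth bound of
  the next lemma is used, so that the products of the \<open>n j\<close> cancel exactly.\<close>

lemma prod_max_1_eq_prod_initial:
  fixes n :: "nat \<Rightarrow> real"
  assumes n: "\<And>j. n j > 0" "mono n" and \<tau>: "\<tau> \<ge> 0"
  shows "\<exists>k\<le>m. (\<Prod>j<m. max 1 (\<tau> / n j)) = (\<Prod>j<k. \<tau> / n j)"
proof (induction m)
  case (Suc m)
  show ?case
  proof (cases "\<tau> / n m \<ge> 1")
    case True
    have "max 1 (\<tau> / n j) = \<tau> / n j" if "j < Suc m" for j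
    proof -
      have "n j \<le> n m" using that n(2) by (auto simp: mono_def)
      moreover have "\<tau> \<ge> n m" using True n(1)[of m] by (simp add: field_simps)
      ultimately show ?thesis using n(1)[of j] by (simp add: field_simps max_def)
    qed
    then have "(\<Prod>j<Suc m. max 1 (\<tau> / n j)) = (\<Prod>j<Suc m. \<tau> / n j)"
      by (intro prod.cong) auto
    then show ?thesis by blast
  next
    case False
    then have "(\<Prod>j<Suc m. max 1 (\<tau> / n j)) = (\<Prod>j<m. max 1 (\<tau> / n j))"
      by (simp add: max_def)
    then show ?thesis using Suc by (metis le_SucI)
  qed
qed auto

text \<open>The maximum principle on a half-disc is applied to the shifted \<open>G\<close> times
  the first \<open>m\<close> comparison factors. The exponent \<open>p\<close> may vary with the
  boundary point: it is \<open>m\<close> on the arc, and on the imaginary axis the \<open>k\<close>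
  of \<open>prod_max_1_eq_prod_initial\<close>, or 0 at the origin. The resulting bound is
  independent of \<open>m\<close>, so a nonzero value at \<open>x\<close> would bound the partial
  sums of \<open>1 / sqrt (n j)\<close>.\<close>

lemma half_plane_uniqueness:
  fixes G :: "complex \<Rightarrow> complex" and n :: "nat \<Rightarrow> real"
  assumes G: "G holomorphic_on {w. Re w > 0}"
    and n: "\<And>j. n j > 0" "mono n" and div: "\<not> summable (\<lambda>j. 1 / sqrt (n j))"
    and bound: "\<And>p w. Re w > 0 \<Longrightarrow> norm (G w) \<le> K * (\<Prod>j<p. n j) / (norm w ^ (2 * p + 1) * Re w)"
    and x: "x > 0"
  shows "G (of_real x) = 0"
proof (rule ccontr)
  assume nz: "G (of_real x) \<noteq> 0"
  \<comment> \<open>Shifting \<open>G\<close> by \<open>\<delta>\<close> makes it holomorphic across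
    the imaginary axis and turns the singular factor \<open>1 / Re w\<close> into at most
    \<open>1 / \<delta>\<close>. With \<open>\<delta> = x / 2\<close> the shifted function takes at
    \<open>\<delta>\<close> the value of \<open>G\<close> at \<open>x\<close>.\<close>
  define \<delta> where "\<delta> = x / 2"
  have \<delta>: "\<delta> > 0" using x by (simp add: \<delta>_def)
  define E where "E = (\<lambda>j w. 1 + w / of_real (sqrt (n j)) + w^2 / of_real (n j) :: complex)"
  have "norm (G 1) \<le> K" using bound[of 1 0] by simp
  then have K: "K \<ge> 0" by (rule order.trans[OF norm_ge_zero])
  have prod_le: "norm (G (of_real x)) * (\<Prod>j<m. 1 + \<delta> / sqrt (n j)) \<le> K / \<delta>^2" for m
  proof -
    define Q where "Q = (\<lambda>w. G (w + of_real \<delta>) * (\<Prod>j<m. E j w))"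
    \<comment> \<open>The three lower bounds on the radius put \<open>\<delta>\<close> inside the
      disc, pay for the factor \<open>3 ^ m\<close> produced on the arc, and make the quadratic term
      of every comparison factor dominant there.\<close>
    define R where "R = Max (insert (2 * \<delta>) (insert (3 ^ m * \<delta>) ((\<lambda>j. sqrt (n j)) ` {..<m})))"
    have R: "R \<ge> 2 * \<delta>" "R \<ge> 3 ^ m * \<delta>" "\<And>j. j < m \<Longrightarrow> R \<ge> sqrt (n j)"
      unfolding R_def by (rule Max_ge; simp)+
    have R0: "R > 0" using R(1) \<delta> by linarith
    define S where "S = {w. Re w > 0} \<inter> ball 0 R"
    have clS: "closure S \<subseteq> {w. Re w \<ge> 0} \<inter> cball 0 R"
      unfolding S_def by (intro closure_minimal closed_Int closed_halfspace_Re_ge closed_cball) auto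
    have Qhol: "Q holomorphic_on {w. Re w > -\<delta>}"
      unfolding Q_def E_def using n(1)
      by (auto intro!: holomorphic_intros holomorphic_on_compose_gen[OF _ G, unfolded o_def] simp: less_le)
    have Gb: "norm (G (w + of_real \<delta>)) \<le> K * (\<Prod>j<p. n j) / (norm w ^ (2 * p) * max \<delta> (norm w) * \<delta>)"
      if w: "Re w \<ge> 0" "w \<noteq> 0 \<or> p = 0" for p w
    proof -
      have le: "norm w \<le> norm (w + of_real \<delta>)"
      proof -
        have "(Re w)^2 \<le> (Re w + \<delta>)^2" using w \<delta> by (intro power_mono) auto
        then show ?thesis by (simp add: cmod_def)
      qed
      have le2: "\<delta> \<le> norm (w + of_real \<delta>)"
        using complex_Re_le_cmod[of "w + of_real \<delta>"] w by simp
      have "norm (G (w + of_real \<delta>)) \<le> K * (\<Prod>j<p. n j) / (norm (w + of_real \<delta>) ^ (2 * p + 1) * Re (w + of_real \<delta>))"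
        using w \<delta> by (intro bound) auto
      also have "\<dots> \<le> K * (\<Prod>j<p. n j) / (norm w ^ (2 * p) * max \<delta> (norm w) * \<delta>)"
      proof (rule divide_left_mono)
        have "norm w ^ (2 * p) * max \<delta> (norm w) * \<delta> \<le> norm (w + of_real \<delta>) ^ (2*p) * norm (w + of_real \<delta>) * Re (w + of_real \<delta>)"
          using le le2 w \<delta> by (intro mult_mono power_mono) auto
        then show "norm w ^ (2 * p) * max \<delta> (norm w) * \<delta> \<le> norm (w + of_real \<delta>) ^ (2 * p + 1) * Re (w + of_real \<delta>)"
          by (simp add: mult_ac)
        show "0 \<le> K * (\<Prod>j<p. n j)" using K n(1) by (intro mult_nonneg_nonneg prod_nonneg) (auto intro: less_imp_le)
        have "norm (w + of_real \<delta>) > 0" "Re (w + of_real \<delta>) > 0" using le2 \<delta> w by auto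
        moreover have "norm w ^ (2 * p) > 0" using w by auto
        ultimately show "0 < norm (w + of_real \<delta>) ^ (2 * p + 1) * Re (w + of_real \<delta>) * (norm w ^ (2 * p) * max \<delta> (norm w) * \<delta>)"
          using \<delta> by (intro mult_pos_pos) (auto simp: less_max_iff_disj)
      qed
      finally show ?thesis .
    qed
    have "norm (Q (of_real \<delta>)) \<le> K / \<delta>^2"
    proof (rule maximum_modulus_frontier[of Q S])
      show "Q holomorphic_on interior S"
        using \<delta> interior_subset[of S] by (intro holomorphic_on_subset[OF Qhol]) (auto simp: S_def)
      show "continuous_on (closure S) Q"
        using clS \<delta> by (intro continuous_on_subset[OF holomorphic_on_imp_continuous_on[OF Qhol]]) auto
      show "bounded S" by (auto simp: S_def)
      show "of_real \<delta> \<in> S" using \<delta> R(1) by (auto simp: S_def)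
      fix w assume w: "w \<in> frontier S"
      have "open S" by (auto simp: S_def open_halfspace_Re_gt)
      then have "w \<in> closure S" "w \<notin> S" using w by (auto simp: frontier_def interior_open)
      then have w0: "Re w \<ge> 0" and w1: "Re w = 0 \<or> norm w = R" using clS by (auto simp: S_def)
      from w1 consider "norm w = R" | "Re w = 0" by blast
      then show "norm (Q w) \<le> K / \<delta>^2"
      proof cases
        case 1
        have Eb: "norm (E j w) \<le> 3 * (R^2 / n j)" if j: "j < m" for j
        proof -
          define u where "u = R / sqrt (n j)"
          have u: "u \<ge> 1" using R(3)[OF j] n(1)[of j] by (simp add: u_def)
          have u2: "u^2 = R^2 / n j" using n(1)[of j] by (simp add: u_def power_divide)
          have "norm (E j w) \<le> 1 + u + u^2"
            unfolding E_def u2 using n(1)[of j] 1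
            by (intro order.trans[OF norm_triangle_ineq] add_mono) (auto simp: norm_divide norm_power u_def)
          also have "\<dots> \<le> u^2 + u^2 + u^2"
            using u by (intro add_mono) (auto simp: power2_eq_square intro: order.trans[of 1 u] mult_left_mono[of 1 u u, simplified])
          finally show ?thesis using u2 by simp
        qed
        have "norm (Q w) \<le> (K * (\<Prod>j<m. n j) / (norm w ^ (2 * m) * max \<delta> (norm w) * \<delta>)) * (\<Prod>j<m. 3 * (R^2 / n j))"
          unfolding Q_def norm_mult prod_norm[symmetric]
          using Eb Gb[of w m] 1 R0 w0 n(1) K \<delta>
          by (intro mult_mono prod_mono) (auto intro!: prod_nonneg divide_nonneg_nonneg mult_nonneg_nonneg simp: less_imp_le)
        also have "(\<Prod>j<m. 3 * (R^2 / n j)) = 3 ^ m * R ^ (2 * m) / (\<Prod>j<m. n j)"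
          by (simp add: prod.distrib prod_dividef power_mult)
        also have "(K * (\<Prod>j<m. n j) / (norm w ^ (2 * m) * max \<delta> (norm w) * \<delta>)) * (3 ^ m * R ^ (2 * m) / (\<Prod>j<m. n j)) = K * 3 ^ m / (R * \<delta>)"
        proof -
          have "(\<Prod>j<m. n j) \<noteq> 0" using n(1) by (auto simp: less_le)
          moreover have "max \<delta> R = R" using R(1) \<delta> by auto
          ultimately show ?thesis using R0 \<delta> 1 by (simp add: field_simps)
        qed
        also have "\<dots> \<le> K / \<delta>^2"
        proof -
          have "K * (3 ^ m * \<delta>) \<le> K * R" using K R(2) by (intro mult_left_mono) auto
          then show ?thesis using R0 \<delta> by (simp add: field_simps power2_eq_square)
        qed
        finally show ?thesis .
      next
        case 2
        define t where "t = Im w"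
        have wt: "w = \<i> * of_real t" using 2 by (simp add: complex_eq_iff t_def)
        have nw: "norm w ^ 2 = t ^ 2" by (simp add: wt norm_mult)
        obtain k where k: "k \<le> m" "(\<Prod>j<m. max 1 (t^2 / n j)) = (\<Prod>j<k. t^2 / n j)"
          using prod_max_1_eq_prod_initial[OF n, of "t^2" m] by auto
        have prodE: "norm (\<Prod>j<m. E j w) \<le> (\<Prod>j<k. t^2 / n j)"
          unfolding k(2)[symmetric] prod_norm[symmetric]
          using norm_comparison_factor_imaginary[OF n(1), of t]
          by (intro prod_mono) (auto simp: E_def wt)
        \<comment> \<open>At \<open>t = 0\<close> the exponent must be 0 for \<open>Gb\<close> to
          apply. Nothing is lost: for \<open>k > 0\<close> the product of the
          \<open>t^2 / n j\<close> is then 0.\<close>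
        define k' where "k' = (if t = 0 then 0 else k)"
        have kk: "(\<Prod>j<k. t^2 / n j) \<le> (\<Prod>j<k'. t^2 / n j)"
        proof (cases "t = 0 \<and> k > 0")
          case True
          then have "(\<Prod>j<k. t^2 / n j) = 0" by (auto intro!: prod_zero)
          then show ?thesis using True by (simp only: k'_def) simp
        qed (auto simp: k'_def)
        have "norm (Q w) \<le> (K * (\<Prod>j<k'. n j) / (norm w ^ (2 * k') * max \<delta> (norm w) * \<delta>)) * (\<Prod>j<k'. t^2 / n j)"
          unfolding Q_def norm_mult
          using order.trans[OF prodE kk] Gb[of w k'] wt w0 n(1) K \<delta>
          by (intro mult_mono) (auto intro!: prod_nonneg divide_nonneg_nonneg mult_nonneg_nonneg simp: less_imp_le k'_def)
        also have "(\<Prod>j<k'. t^2 / n j) = norm w ^ (2 * k') / (\<Prod>j<k'. n j)"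
          by (simp add: prod_dividef power_mult nw)
        also have "(K * (\<Prod>j<k'. n j) / (norm w ^ (2 * k') * max \<delta> (norm w) * \<delta>)) * (norm w ^ (2 * k') / (\<Prod>j<k'. n j)) = K / (max \<delta> (norm w) * \<delta>)"
        proof -
          have "K * a / (b * max \<delta> (norm w) * \<delta>) * (b / a) = K / (max \<delta> (norm w) * \<delta>)"
            if "a \<noteq> 0" "b \<noteq> 0" for a b :: real
            using that by simp
          moreover have "(\<Prod>j<k'. n j) \<noteq> 0" using n(1) by (auto simp: less_le)
          moreover have "norm w ^ (2 * k') \<noteq> 0" by (auto simp: k'_def wt)
          ultimately show ?thesis by blast
        qed
        also have "\<dots> \<le> K / \<delta>^2"
          using K \<delta> by (intro divide_left_mono) (auto simp: power2_eq_square)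
        finally show ?thesis .
      qed
    qed
    moreover have "norm (Q (of_real \<delta>)) \<ge> norm (G (of_real x)) * (\<Prod>j<m. 1 + \<delta> / sqrt (n j))"
    proof -
      have "(\<Prod>j<m. 1 + \<delta> / sqrt (n j)) \<le> (\<Prod>j<m. norm (E j (of_real \<delta>)))"
      proof (intro prod_mono conjI)
        fix j
        have "E j (of_real \<delta>) = of_real (1 + \<delta> / sqrt (n j) + \<delta>^2 / n j)" by (simp add: E_def)
        then have "norm (E j (of_real \<delta>)) = 1 + \<delta> / sqrt (n j) + \<delta>^2 / n j"
          using \<delta> n(1)[of j] by (simp only: norm_of_real) (simp add: add_nonneg_nonneg)
        then show "1 + \<delta> / sqrt (n j) \<le> norm (E j (of_real \<delta>))" using n(1)[of j] by simp
        show "0 \<le> 1 + \<delta> / sqrt (n j)" using \<delta> n(1)[of j] by simp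
      qed
      moreover have "of_real \<delta> + of_real \<delta> = (of_real x :: complex)" by (simp add: \<delta>_def flip: of_real_add)
      ultimately show ?thesis by (auto simp: Q_def norm_mult prod_norm[symmetric] intro!: mult_left_mono)
    qed
    ultimately show ?thesis by linarith
  qed
  \<comment> \<open>A product of factors \<open>1 + a\<close> with nonnegative \<open>a\<close> is
    at least the sum of the \<open>a\<close>, so the partial sums inherit the bound on the
    products.\<close>
  have "summable (\<lambda>j. 1 / sqrt (n j))"
  proof (rule bounded_imp_summable)
    show "0 \<le> 1 / sqrt (n j)" for j using n(1)[of j] by simp
    fix m
    have "\<delta> * (\<Sum>j\<le>m. 1 / sqrt (n j)) = (\<Sum>j<Suc m. \<delta> / sqrt (n j))"
      by (simp add: sum_distrib_left lessThan_Suc_atMost)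
    also have "\<dots> \<le> (\<Prod>j<Suc m. 1 + \<delta> / sqrt (n j))"
      using \<delta> n(1) by (intro sum_le_prod) (auto simp: less_imp_le)
    also have "\<dots> \<le> K / \<delta>^2 / norm (G (of_real x))"
      using prod_le[of "Suc m"] nz by (metis mult.commute pos_le_divide_eq zero_less_norm_iff)
    finally show "(\<Sum>j\<le>m. 1 / sqrt (n j)) \<le> K / \<delta>^2 / norm (G (of_real x)) / \<delta>"
      using \<delta> by (metis mult.commute pos_le_divide_eq)
  qed
  with div show False by blast
qed

section \<open>Flat functions on the half-plane\<close>

text \<open>The fundamental theorem is applied on \<open>{1 / real n..real n}\<close> along the ray
  through \<open>c\<close>, because the primitive \<open>F\<close> is only known in the open
  half-plane and may have no value at 0. The outer factor \<open>c\<close> is the derivative of the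
  parametrisation of the ray.\<close>

lemma ray_integral_limit:
  assumes g: "continuous_on {0<..} (\<lambda>r. g (c * of_real r))" "\<And>r. r > 0 \<Longrightarrow> norm (g (c * of_real r)) \<le> B"
    and c: "Re c > 0" "Re (s * c) > 0"
    and F: "\<And>z. Re z > 0 \<Longrightarrow> (F has_field_derivative exp (-(s * z)) * g z) (at z)"
  shows "(\<lambda>n. F (c * of_real (real n)) - F (c * of_real (1 / real n))) \<longlonglongrightarrow> c * laplace (\<lambda>r. g (c * of_real r)) (s * c)"
proof -
  let ?f = "\<lambda>r. c * (exp (-(s * c * of_real r)) * g (c * of_real r))"
  have I: "set_integrable lborel {0<..} ?f"
    by (rule set_integrable_mult_right) (rule laplace_integrable[OF g c(2)])
  have conv: "(\<lambda>n. LINT r:{1 / real n..real n}|lborel. ?f r) \<longlonglongrightarrow> (LINT r:(\<Union>n. {1 / real (Suc n)..real (Suc n)})|lborel. ?f r)"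
  proof (subst filterlim_sequentially_Suc[symmetric], rule set_integral_cont_up)
    show "incseq (\<lambda>n. {1 / real (Suc n)..real (Suc n)})"
      by (intro incseq_SucI) (auto simp: field_simps)
    show "set_integrable lborel (\<Union>n. {1 / real (Suc n)..real (Suc n)}) ?f"
      by (rule set_integrable_subset[OF I]) (auto intro: less_le_trans[of 0 "1 / real (Suc n)" for n])
  qed auto
  have un: "(\<Union>n. {1 / real (Suc n)..real (Suc n)}) = {0<..}"
  proof (intro equalityI subsetI)
    fix r :: real assume r: "r \<in> {0<..}"
    obtain n where n: "real n \<ge> max r (1 / r)" using real_arch_simple by blast
    then have "r \<in> {1 / real (Suc n)..real (Suc n)}" using r by (auto simp: field_simps)
    then show "r \<in> (\<Union>n. {1 / real (Suc n)..real (Suc n)})" by blast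
  qed (auto intro: less_le_trans[of 0 "1 / real (Suc n)" for n])
  have ftc: "(LINT r:{1 / real n..real n}|lborel. ?f r) = F (c * of_real (real n)) - F (c * of_real (1 / real n))"
    if n: "n > 0" for n
  proof -
    have le: "1 / real n \<le> real n" using n by (simp add: field_simps) (metis One_nat_def Suc_leI mult_le_mono nat_mult_1 of_nat_1 of_nat_le_iff of_nat_mult)
    have "((\<lambda>r. F (c * of_real r)) has_vector_derivative ?f r) (at r within {1 / real n..real n})" if "r \<in> {1 / real n..real n}" for r
    proof -
      have r: "r > 0" using that n by (auto intro: less_le_trans[of 0 "1 / real n"])
      have "((\<lambda>z. c * z) has_field_derivative c) (at (of_real r))"
        by (auto intro!: derivative_eq_intros)
      from DERIV_chain2[OF F this] r c(1)
      have "((\<lambda>z. F (c * z)) has_field_derivative exp (-(s * (c * of_real r))) * g (c * of_real r) * c) (at (of_real r))"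
        by simp
      from has_vector_derivative_real_field[OF this] show ?thesis
        by (simp add: mult_ac has_vector_derivative_at_within)
    qed
    from fundamental_theorem_of_calculus[OF le this]
    have hi: "(?f has_integral F (c * of_real (real n)) - F (c * of_real (1 / real n))) {1 / real n..real n}" by simp
    have "set_integrable lborel {1 / real n..real n} ?f"
      using n by (intro set_integrable_subset[OF I]) (auto intro: less_le_trans[of 0 "1 / real n"])
    from set_borel_integral_eq_integral(2)[OF this] integral_unique[OF hi] show ?thesis
      by (rule trans)
  qed
  have "(\<lambda>n. F (c * of_real (real n)) - F (c * of_real (1 / real n))) \<longlonglongrightarrow> (LINT r:{0<..}|lborel. ?f r)"
    using conv[unfolded un]
    by (rule Lim_transform_eventually) (rule eventually_mono[OF eventually_gt_at_top[of 0]], rule ftc)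
  then show ?thesis by (simp add: laplace_def)
qed

text \<open>Cauchy's theorem for a sector, in terms of a primitive \<open>F\<close> of the
  integrand: between the points of the two rays with parameter \<open>r\<close>, \<open>F\<close>
  changes by at most a constant times \<open>r * exp (-(m * r))\<close>, which vanishes both as
  \<open>r\<close> tends to 0 and as it tends to infinity.\<close>

lemma laplace_ray_independent:
  assumes g: "g holomorphic_on {z. Re z > 0}" "\<And>z. Re z > 0 \<Longrightarrow> norm (g z) \<le> B"
    and c: "Re c1 > 0" "Re (s * c1) > 0" "Re c2 > 0" "Re (s * c2) > 0"
  shows "c1 * laplace (\<lambda>r. g (c1 * of_real r)) (s * c1) = c2 * laplace (\<lambda>r. g (c2 * of_real r)) (s * c2)"
proof -
  let ?P = "{z. Re z > 0}" and ?f = "\<lambda>z. exp (-(s * z)) * g z"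
  have fhol: "?f holomorphic_on ?P" by (intro holomorphic_intros g)
  obtain F where F': "\<And>z. z \<in> ?P \<Longrightarrow> (F has_field_derivative ?f z) (at z within ?P)"
    using holomorphic_convex_primitive'[OF convex_halfspace_Re_gt open_halfspace_Re_gt fhol] by blast
  have F: "(F has_field_derivative ?f z) (at z)" if "Re z > 0" for z
    using F'[of z] that by (simp add: at_within_open[OF _ open_halfspace_Re_gt])
  have B: "B \<ge> 0" by (rule order.trans[OF norm_ge_zero g(2)[of 1]]) simp
  \<comment> \<open>The condition \<open>Re (s * z) \<ge> m * r\<close> defines a half-plane, so it
    passes from the two ends to the whole connecting segment.\<close>
  define m where "m = min (Re (s * c1)) (Re (s * c2))"
  have m: "m > 0" using c by (simp add: m_def)
  have cont: "continuous_on {0<..} (\<lambda>r. g (c * of_real r))" and bd: "\<And>r. r > 0 \<Longrightarrow> norm (g (c * of_real r)) \<le> B"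
    if "Re c > 0" for c
    using that by (auto intro!: continuous_on_compose2[OF holomorphic_on_imp_continuous_on[OF g(1)]] continuous_intros g(2))
  have diff: "norm (F (c1 * of_real r) - F (c2 * of_real r)) \<le> B * exp (-(m * r)) * (norm (c1 - c2) * r)" if r: "r > 0" for r
  proof -
    let ?S = "closed_segment (c1 * of_real r) (c2 * of_real r)"
    let ?H = "{z. Re z > 0} \<inter> {z. Re (s * z) \<ge> m * r}"
    have "convex ?H"
    proof -
      have "{z. Re (s * z) \<ge> m * r} = {z. inner (cnj s) z \<ge> m * r}" by (auto simp: inner_complex_def)
      then show ?thesis by (auto intro!: convex_Int convex_halfspace_Re_gt convex_halfspace_ge)
    qed
    moreover have "c1 * of_real r \<in> ?H" "c2 * of_real r \<in> ?H"
    proof -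
      have "Re (s * (c * of_real r)) = Re (s * c) * r" for c by (simp add: algebra_simps)
      then show "c1 * of_real r \<in> ?H" "c2 * of_real r \<in> ?H" using c r by (auto simp: m_def)
    qed
    ultimately have SH: "?S \<subseteq> ?H" by (intro closed_segment_subset)
    have "norm (F (c1 * of_real r) - F (c2 * of_real r)) \<le> (B * exp (-(m * r))) * norm (c1 * of_real r - c2 * of_real r)"
    proof (rule field_differentiable_bound[of ?S F ?f])
      fix z assume z: "z \<in> ?S"
      then have zH: "z \<in> ?H" using SH by blast
      then show "(F has_field_derivative ?f z) (at z within ?S)"
        using F[of z] by (auto intro: has_field_derivative_at_within)
      have "exp (- Re (s * z)) * norm (g z) \<le> exp (-(m * r)) * B"
        using zH g(2)[of z] by (intro mult_mono) auto
      then show "norm (?f z) \<le> B * exp (-(m * r))" by (simp add: norm_mult mult.commute)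
    qed auto
    also have "norm (c1 * of_real r - c2 * of_real r) = norm (c1 - c2) * r"
      using r by (simp add: norm_mult flip: left_diff_distrib)
    finally show ?thesis .
  qed
  have "(\<lambda>n. (F (c1 * of_real (real n)) - F (c1 * of_real (1 / real n))) - (F (c2 * of_real (real n)) - F (c2 * of_real (1 / real n)))) \<longlonglongrightarrow> 0"
  proof (rule Lim_null_comparison)
    let ?b = "\<lambda>r. B * exp (-(m * r)) * (norm (c1 - c2) * r)"
    show "\<forall>\<^sub>F n in sequentially. norm ((F (c1 * of_real (real n)) - F (c1 * of_real (1 / real n))) - (F (c2 * of_real (real n)) - F (c2 * of_real (1 / real n)))) \<le> ?b (real n) + ?b (1 / real n)"
      using eventually_gt_at_top[of 0]
    proof eventually_elim
      case (elim n)
      \<comment> \<open>The four boundary terms are regrouped by radius, so that each pair consists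
        of the ends of one connecting segment.\<close>
      have "(F (c1 * of_real (real n)) - F (c1 * of_real (1 / real n))) - (F (c2 * of_real (real n)) - F (c2 * of_real (1 / real n))) =
        (F (c1 * of_real (real n)) - F (c2 * of_real (real n))) - (F (c1 * of_real (1 / real n)) - F (c2 * of_real (1 / real n)))" by simp
      moreover have "norm \<dots> \<le> ?b (real n) + ?b (1 / real n)"
        using elim by (intro order.trans[OF norm_triangle_ineq4] add_mono diff) auto
      ultimately show ?case by (simp only:)
    qed
    have "(\<lambda>n. ?b (real n) + ?b (1 / real n)) \<longlonglongrightarrow> 0 + B * exp (-(m * 0)) * (norm (c1 - c2) * 0)"
    proof (intro tendsto_add)
      show "(\<lambda>n. ?b (1 / real n)) \<longlonglongrightarrow> B * exp (-(m * 0)) * (norm (c1 - c2) * 0)"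
        by (intro tendsto_intros lim_1_over_n)
      have "(\<lambda>n. real n * exp (-(m * real n))) \<longlonglongrightarrow> 0" using m by real_asymp
      from tendsto_mult_left[OF this, of "B * norm (c1 - c2)"]
      show "(\<lambda>n. ?b (real n)) \<longlonglongrightarrow> 0" by (simp add: mult_ac)
    qed
    then show "(\<lambda>n. ?b (real n) + ?b (1 / real n)) \<longlonglongrightarrow> 0" by simp
  qed
  moreover have "(\<lambda>n. (F (c1 * of_real (real n)) - F (c1 * of_real (1 / real n))) - (F (c2 * of_real (real n)) - F (c2 * of_real (1 / real n))))
     \<longlonglongrightarrow> c1 * laplace (\<lambda>r. g (c1 * of_real r)) (s * c1) - c2 * laplace (\<lambda>r. g (c2 * of_real r)) (s * c2)"
    by (intro tendsto_diff ray_integral_limit[where B=B] cont bd c F) auto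
  ultimately show ?thesis using LIMSEQ_unique by fastforce
qed

text \<open>Integration by parts: \<open>exp (-(s * z)) * g z\<close> is a primitive of
  \<open>exp (-(s * z))\<close> times \<open>deriv g z - s * g z\<close>. Its boundary values
  vanish, at 0 by flatness and at infinity by exponential decay, so the integral of that combination
  is 0.\<close>

lemma laplace_derivative_flat:
  assumes g: "g holomorphic_on {z. Re z > 0}"
    and bd: "\<And>z. Re z > 0 \<Longrightarrow> norm (g z) \<le> B" "\<And>z. Re z > 0 \<Longrightarrow> norm (deriv g z) \<le> B'"
    and flat: "(g \<longlongrightarrow> 0) (at 0 within {z. Re z > 0})"
    and c: "Re c > 0" "Re (s * c) > 0"
  shows "laplace (\<lambda>r. deriv g (c * of_real r)) (s * c) = s * laplace (\<lambda>r. g (c * of_real r)) (s * c)"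
proof -
  let ?P = "{z. Re z > 0}"
  have oP: "open ?P" by (rule open_halfspace_Re_gt)
  have g': "deriv g holomorphic_on ?P" by (rule holomorphic_deriv[OF g oP])
  let ?h = "\<lambda>z. deriv g z - s * g z"
  let ?F = "\<lambda>z. exp (-(s * z)) * g z"
  have cont: "continuous_on {0<..} (\<lambda>r. f (c * of_real r))" if "f holomorphic_on ?P" for f
    using c(1) by (auto intro!: continuous_on_compose2[OF holomorphic_on_imp_continuous_on[OF that]] continuous_intros)
  have hhol: "?h holomorphic_on ?P" by (intro holomorphic_intros g g')
  have lim1: "(\<lambda>n. ?F (c * of_real (real n)) - ?F (c * of_real (1 / real n))) \<longlonglongrightarrow> c * laplace (\<lambda>r. ?h (c * of_real r)) (s * c)"
  proof (rule ray_integral_limit[OF cont[OF hhol] _ c])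
    fix r :: real assume "r > 0"
    then have "Re (c * of_real r) > 0" using c(1) by simp
    then show "norm (?h (c * of_real r)) \<le> B' + norm s * B"
      using bd(1)[of "c * of_real r"] bd(2)[of "c * of_real r"]
      by (intro order.trans[OF norm_triangle_ineq4] add_mono) (auto simp: norm_mult intro!: mult_left_mono)
  next
    fix z assume z: "Re z > 0"
    then have "(g has_field_derivative deriv g z) (at z)"
      using holomorphic_derivI[OF g oP, of z UNIV] by simp
    then show "(?F has_field_derivative exp (- (s * z)) * ?h z) (at z)"
      by (auto intro!: derivative_eq_intros simp: algebra_simps)
  qed
  have lim2: "(\<lambda>n. ?F (c * of_real (real n)) - ?F (c * of_real (1 / real n))) \<longlonglongrightarrow> 0 - 1 * 0"
  proof (intro tendsto_diff tendsto_mult)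
    show "(\<lambda>n. ?F (c * of_real (real n))) \<longlonglongrightarrow> 0"
    proof (rule Lim_null_comparison)
      show "\<forall>\<^sub>F n in sequentially. norm (?F (c * of_real (real n))) \<le> B * exp (-(Re (s * c) * real n))"
        using eventually_gt_at_top[of 0]
      proof eventually_elim
        case (elim n)
        then have "norm (g (c * of_real (real n))) \<le> B" using c(1) by (intro bd) auto
        moreover have "Re (s * (c * of_real (real n))) = Re (s * c) * real n" by (simp add: algebra_simps)
        then have "norm (exp (-(s * (c * of_real (real n))))) = exp (-(Re (s * c) * real n))" by (simp only: norm_exp_eq_Re uminus_complex.sel)
        ultimately show ?case unfolding norm_mult by (metis exp_ge_zero mult.commute mult_left_mono)
      qed
      have "(\<lambda>n. exp (-(Re (s * c) * real n))) \<longlonglongrightarrow> 0" using c(2) by real_asymp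
      from tendsto_mult_left[OF this, of B]
      show "(\<lambda>n. B * exp (-(Re (s * c) * real n))) \<longlonglongrightarrow> 0" by simp
    qed
    have l0: "(\<lambda>n. c * of_real (1 / real n)) \<longlonglongrightarrow> c * of_real 0"
      by (intro tendsto_intros lim_1_over_n)
    then show "(\<lambda>n. g (c * of_real (1 / real n))) \<longlonglongrightarrow> 0"
      using c(1) by (intro filterlim_compose[OF flat])
        (auto simp: filterlim_at eventually_sequentially intro!: exI[of _ 1])
    show "(\<lambda>n. exp (-(s * (c * of_real (1 / real n))))) \<longlonglongrightarrow> 1"
      using tendsto_exp[OF tendsto_minus[OF tendsto_mult_left[OF l0, of s]]] by simp
  qed
  have c0: "c \<noteq> 0" using c by auto
  have "c * laplace (\<lambda>r. ?h (c * of_real r)) (s * c) = 0"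
    using LIMSEQ_unique[OF lim1 lim2] by simp
  then have z: "laplace (\<lambda>r. ?h (c * of_real r)) (s * c) = 0" using c0 by simp
  have I1: "set_integrable lborel {0<..} (\<lambda>r. exp (-(s * c * of_real r)) * g (c * of_real r))"
    using bd c by (intro laplace_integrable[where B=B] cont g) auto
  have I2: "set_integrable lborel {0<..} (\<lambda>r. exp (-(s * c * of_real r)) * deriv g (c * of_real r))"
    using bd c by (intro laplace_integrable[where B=B'] cont g') auto
  have "laplace (\<lambda>r. ?h (c * of_real r)) (s * c) =
     (LINT r:{0<..}|lborel. exp (-(s * c * of_real r)) * deriv g (c * of_real r) - s * (exp (-(s * c * of_real r)) * g (c * of_real r)))"
    unfolding laplace_def by (simp add: algebra_simps)
  also have "\<dots> = laplace (\<lambda>r. deriv g (c * of_real r)) (s * c) - s * laplace (\<lambda>r. g (c * of_real r)) (s * c)"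
    unfolding laplace_def set_integral_mult_right[symmetric]
    by (rule set_integral_diff(2)[OF I2 set_integrable_mult_right[OF I1]])
  finally show ?thesis using z by simp
qed

text \<open>Repeated integration by parts gives \<open>J p c s = s ^ p * J 0 c s\<close>, so all
  derivative bounds become bounds on one function. After the substitution \<open>s = w^2\<close>
  these are the hypotheses of \<open>half_plane_uniqueness\<close>; injectivity of the Laplace
  transform then leads back to \<open>g\<close>.\<close>

lemma quasianalytic_half_plane:
  fixes g :: "complex \<Rightarrow> complex" and n :: "nat \<Rightarrow> real"
  assumes g: "g holomorphic_on {z. Re z > 0}"
    and n: "\<And>j. n j > 0" "mono n" and div: "\<not> summable (\<lambda>j. 1 / sqrt (n j))"
    and bd: "\<And>p z. Re z > 0 \<Longrightarrow> norm ((deriv ^^ p) g z) \<le> K * (\<Prod>j<p. n j)"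
    and flat: "\<And>p. ((deriv ^^ p) g \<longlongrightarrow> 0) (at 0 within {z. Re z > 0})"
    and z: "Re z > 0"
  shows "g z = 0"
proof -
  let ?P = "{z. Re z > 0}"
  have oP: "open ?P" by (rule open_halfspace_Re_gt)
  define J where "J = (\<lambda>p c s. laplace (\<lambda>r. (deriv ^^ p) g (c * of_real r)) (s * c))"
  have hol: "(deriv ^^ p) g holomorphic_on ?P" for p by (rule holomorphic_higher_deriv[OF g oP])
  have cont: "continuous_on {0<..} (\<lambda>r. (deriv ^^ p) g (c * of_real r))" if "Re c > 0" for c p
    using that by (auto intro!: continuous_on_compose2[OF holomorphic_on_imp_continuous_on[OF hol]] continuous_intros)
  have bdr: "norm ((deriv ^^ p) g (c * of_real r)) \<le> K * (\<Prod>j<p. n j)" if "Re c > 0" "r > 0" for c p r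
    using that by (intro bd) auto
  have Jp: "J p c s = s ^ p * J 0 c s" if c: "Re c > 0" "Re (s * c) > 0" for p c s
  proof (induction p)
    case (Suc p)
    have "J (Suc p) c s = s * J p c s"
      using laplace_derivative_flat[OF hol bd _ flat c, of p "K * (\<Prod>j<Suc p. n j)"] bd[of _ "Suc p"]
      by (simp add: J_def)
    then show ?case using Suc by simp
  qed simp
  \<comment> \<open>The ray through \<open>cnj w\<close> suits the parameter \<open>w^2\<close>:
    since \<open>w^2 * cnj w = norm w ^ 2 * w\<close>, the integral converges for every
    \<open>w\<close> in the right half-plane, although \<open>w^2\<close> then fills the whole slit
    plane. The outer \<open>cnj w\<close> makes the value independent of the ray.\<close>
  define G where "G = (\<lambda>w. cnj w * J 0 (cnj w) (w^2))"
  have Re_eq: "w^2 * cnj w = of_real (norm w ^ 2) * w" for w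
  proof -
    have "w^2 * cnj w = (w * cnj w) * w" by (simp add: power2_eq_square)
    then show ?thesis by (simp only: complex_norm_square)
  qed
  have Re_pos: "Re (w^2 * cnj w) > 0" if "Re w > 0" for w
    unfolding Re_eq using that by (auto intro!: mult_pos_pos)
  have "G (of_real x) = 0" if x: "x > 0" for x
  proof (rule half_plane_uniqueness[OF _ n div _ x])
    show "norm (G w) \<le> K * (\<Prod>j<p. n j) / (norm w ^ (2 * p + 1) * Re w)" if w: "Re w > 0" for p w
    proof -
      have w0: "norm w > 0" using w by auto
      have "norm w ^ (2 * p) * norm (J 0 (cnj w) (w^2)) = norm (J p (cnj w) (w^2))"
        using Jp[of "cnj w" "w^2" p] w Re_pos[OF w] by (simp add: norm_mult norm_power power_mult)
      also have "\<dots> \<le> K * (\<Prod>j<p. n j) / Re (w^2 * cnj w)"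
        unfolding J_def using w by (intro norm_laplace_le cont bdr Re_pos) auto
      also have "Re (w^2 * cnj w) = norm w ^ 2 * Re w" unfolding Re_eq by simp
      finally have "norm w ^ (2 * p) * norm (J 0 (cnj w) (w^2)) \<le> K * (\<Prod>j<p. n j) / (norm w ^ 2 * Re w)" .
      then have "norm (J 0 (cnj w) (w^2)) \<le> K * (\<Prod>j<p. n j) / (norm w ^ 2 * Re w) / norm w ^ (2 * p)"
        using w0 by (metis mult.commute pos_le_divide_eq zero_less_power)
      then have "norm w * norm (J 0 (cnj w) (w^2)) \<le> norm w * (K * (\<Prod>j<p. n j) / (norm w ^ 2 * Re w) / norm w ^ (2 * p))"
        using w0 by (intro mult_left_mono) auto
      also have "\<dots> = K * (\<Prod>j<p. n j) / (norm w ^ (2 * p + 1) * Re w)"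
        using w0 by (simp add: power2_eq_square)
      finally show ?thesis by (simp add: G_def norm_mult)
    qed
    show "G holomorphic_on ?P"
    proof (subst holomorphic_on_open[OF oP], intro ballI)
      fix w0 :: complex assume "w0 \<in> ?P"
      then have w0: "Re w0 > 0" by simp
      \<comment> \<open>The formula for \<open>G\<close> contains \<open>cnj w\<close> and is not
        visibly holomorphic. Near \<open>w0\<close> the fixed ray through \<open>cnj w0\<close>
        gives the same value, and there the dependence on \<open>w\<close> is holomorphic.\<close>
      define U where "U = ?P \<inter> {w. Re (w^2 * cnj w0) > 0}"
      have U: "open U" unfolding U_def
        by (intro open_Int oP open_Collect_less continuous_intros)
      have w0U: "w0 \<in> U" using w0 Re_pos[OF w0] by (simp add: U_def)
      let ?h = "\<lambda>w. cnj w0 * laplace (\<lambda>r. g (cnj w0 * of_real r)) (w^2 * cnj w0)"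
      have "laplace (\<lambda>r. g (cnj w0 * of_real r)) holomorphic_on ?P"
        using cont[of "cnj w0" 0] bdr[of "cnj w0" _ 0] w0 by (intro holomorphic_laplace[where B=K]) auto
      then have "?h holomorphic_on U"
        by (intro holomorphic_intros holomorphic_on_compose_gen[of "\<lambda>w. w^2 * cnj w0" _ _ ?P, unfolded o_def])
           (auto simp: U_def)
      moreover have "?h w = G w" if "w \<in> U" for w
        using laplace_ray_independent[OF g, of K "cnj w0" "w^2" "cnj w"] bd[of _ 0] w0 that Re_pos[of w]
        by (simp add: U_def G_def J_def)
      ultimately have "G holomorphic_on U" using holomorphic_cong[of U U ?h G] by blast
      then show "\<exists>f'. (G has_field_derivative f') (at w0)"
        using holomorphic_on_imp_differentiable_at[OF _ U w0U] by (simp add: field_differentiable_def)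
    qed
  qed
  then have Gx: "x > 0 \<Longrightarrow> laplace (\<lambda>r. g (of_real x * of_real r)) (of_real (x^2) * of_real x) = 0" for x :: real
    by (fastforce simp: G_def J_def)
  \<comment> \<open>For real \<open>w = x\<close> the ray through \<open>x\<close> is again the
    positive axis, so the vanishing of \<open>G\<close> is the vanishing of the Laplace transform of
    \<open>g\<close> at \<open>x^2\<close>.\<close>
  have "laplace (\<lambda>r. g (1 * of_real r)) (of_real y * 1) = 0" if y: "y > 0" for y
  proof -
    define x where "x = sqrt y"
    have x: "x > 0" "x^2 = y" using y by (auto simp: x_def)
    have "1 * laplace (\<lambda>r. g (1 * of_real r)) (of_real y * 1) = of_real x * laplace (\<lambda>r. g (of_real x * of_real r)) (of_real y * of_real x)"
      using x y g bd[of _ 0] by (intro laplace_ray_independent[where B=K]) auto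
    then show ?thesis using Gx[of x] x by simp
  qed
  then have g0: "g (of_real r) = 0" if "r > 0" for r
    using laplace_eq_0_imp[of "\<lambda>r. g (of_real r)" K r] cont[of 1 0] bdr[of 1 _ 0] that by simp
  show "g z = 0"
  proof (rule analytic_continuation[OF g oP])
    show "connected ?P" by (intro convex_connected convex_halfspace_Re_gt)
    show "complex_of_real ` {0<..} \<subseteq> ?P" by auto
    show "(1::complex) \<in> ?P" by simp
    show "(1::complex) islimpt complex_of_real ` {0<..}"
    proof (rule islimpt_approachable[THEN iffD2], intro allI impI)
      fix e :: real assume "e > 0"
      then show "\<exists>x'\<in>complex_of_real ` {0<..}. x' \<noteq> 1 \<and> dist x' 1 < e"
        by (intro bexI[of _ "of_real (1 + e / 2)"] imageI) (auto simp: dist_norm norm_divide)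
    qed
    show "g w = 0" if "w \<in> complex_of_real ` {0<..}" for w using that g0 by auto
    show "z \<in> ?P" using z by simp
  qed
qed

section \<open>Injectivity of the Borel map\<close>

lemma weight_seq_pos: "weight_seq M \<Longrightarrow> M p > 0"
  by (simp add: weight_seq_def)

lemma quot_pos: "weight_seq M \<Longrightarrow> quot M p > 0"
  by (simp add: weight_seq_def quot_def)

lemma mono_quot: "weight_seq M \<Longrightarrow> mono (quot M)"
proof (rule incseq_SucI)
  fix p assume M: "weight_seq M"
  then have "M (Suc p) ^ 2 \<le> M p * M (Suc (Suc p))"
    unfolding weight_seq_def by (metis One_nat_def Suc_eq_plus1 diff_Suc_1 le_add2)
  then show "quot M p \<le> quot M (Suc p)"
    using weight_seq_pos[OF M] by (simp add: quot_def field_simps power2_eq_square)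
qed

lemma prod_quot_shift: "weight_seq M \<Longrightarrow> (\<Prod>j<p. h * quot M (j + q)) = h ^ p * M (p + q) / M q"
proof (induction p)
  case 0
  then show ?case using weight_seq_pos[of M q] by simp
next
  case (Suc p)
  then show ?case using weight_seq_pos[OF Suc.prems, of "p + q"] by (simp add: quot_def)
qed

lemma upper_half_props: "open upper_half" "convex upper_half" "at 0 within upper_half \<noteq> bot"
proof -
  show o: "open upper_half" unfolding upper_half_def by (rule open_halfspace_Im_gt)
  show "convex upper_half" unfolding upper_half_def by (rule convex_halfspace_Im_gt)
  have "0 islimpt upper_half"
    unfolding islimpt_approachable
  proof (intro allI impI)
    fix e :: real assume "e > 0"
    then show "\<exists>x'\<in>upper_half. x' \<noteq> 0 \<and> dist x' 0 < e"
      by (intro bexI[of _ "\<i> * of_real (e / 2)"]) (auto simp: upper_half_def norm_mult)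
  qed
  then show "at 0 within upper_half \<noteq> bot" by (simp add: trivial_limit_within)
qed

text \<open>A bound on the next derivative makes each derivative Lipschitz on the convex half-plane,
  so it extends continuously to 0. Hence the \<open>Lim\<close> in \<open>borel_coeff\<close> is a
  genuine limit and not an unspecified value.\<close>

lemma ultrahol_boundary_limit:
  assumes "f \<in> ultrahol_H N"
  shows "((deriv ^^ p) f \<longlongrightarrow> borel_coeff f p) (at 0 within upper_half)"
proof -
  obtain h K where f: "f holomorphic_on upper_half"
    and K: "\<And>p z. z \<in> upper_half \<Longrightarrow> norm ((deriv ^^ p) f z) \<le> K * h ^ p * N p"
    using assms by (auto simp: ultrahol_H_def)
  let ?B = "\<bar>K * h ^ Suc p * N (Suc p)\<bar>"
  have hol: "(deriv ^^ p) f holomorphic_on upper_half"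
    by (rule holomorphic_higher_deriv[OF f upper_half_props(1)])
  have "norm ((deriv ^^ p) f x - (deriv ^^ p) f y) \<le> ?B * norm (x - y)" if "x \<in> upper_half" "y \<in> upper_half" for x y
  proof (rule field_differentiable_bound[OF upper_half_props(2) _ _ that])
    show "((deriv ^^ p) f has_field_derivative (deriv ^^ Suc p) f z) (at z within upper_half)" if "z \<in> upper_half" for z
      using holomorphic_derivI[OF hol upper_half_props(1) that] by simp
    show "norm ((deriv ^^ Suc p) f z) \<le> ?B" if "z \<in> upper_half" for z
      using K[OF that, of "Suc p"] by linarith
  qed
  then have "?B-lipschitz_on upper_half ((deriv ^^ p) f)"
    by (intro lipschitz_onI) (auto simp: dist_norm)
  then have "uniformly_continuous_on upper_half ((deriv ^^ p) f)"
    by (rule lipschitz_on_uniformly_continuous)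
  moreover have "0 \<in> closure upper_half"
    using upper_half_props(3) by (simp add: closure_def trivial_limit_within)
  ultimately obtain l where "((deriv ^^ p) f \<longlongrightarrow> l) (at 0 within upper_half)"
    by (rule uniformly_continuous_on_extension_at_closure)
  then show ?thesis
    unfolding borel_coeff_def using tendsto_Lim[OF upper_half_props(3)] by metis
qed

text \<open>Multiplication by \<i> carries the right half-plane to the upper one, and the difference
  of \<open>f\<close> and \<open>g\<close> becomes flat at 0 because all Borel coefficients
  cancel.\<close>

lemma borel_injective:
  assumes M: "weight_seq M" and div: "\<not> summable (\<lambda>p. 1 / sqrt (quot M p))"
    and f: "f \<in> ultrahol_H (shift1 M)" and g: "g \<in> ultrahol_H (shift1 M)"
    and eq: "borel_coeff f = borel_coeff g" and z: "z \<in> upper_half"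
  shows "f z = g z"
proof -
  obtain h1 K1 where h1: "h1 > 0" and fh: "f holomorphic_on upper_half"
    and K1: "\<And>p z. z \<in> upper_half \<Longrightarrow> norm ((deriv ^^ p) f z) \<le> K1 * h1 ^ p * M (Suc p)"
    using f by (auto simp: ultrahol_H_def shift1_def)
  obtain h2 K2 where h2: "h2 > 0" and gh: "g holomorphic_on upper_half"
    and K2: "\<And>p z. z \<in> upper_half \<Longrightarrow> norm ((deriv ^^ p) g z) \<le> K2 * h2 ^ p * M (Suc p)"
    using g by (auto simp: ultrahol_H_def shift1_def)
  note Mpos = weight_seq_pos[OF M]
  define h where "h = max h1 h2"
  have h: "h > 0" "h1 \<le> h" "h2 \<le> h" using h1 by (auto simp: h_def)
  define d where "d = (\<lambda>z. f z - g z)"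
  define G where "G = (\<lambda>\<zeta>. d (\<i> * \<zeta>))"
  let ?P = "{z. Re z > 0}"
  have dh: "d holomorphic_on upper_half" unfolding d_def by (intro holomorphic_intros fh gh)
  have dd: "(deriv ^^ p) d z = (deriv ^^ p) f z - (deriv ^^ p) g z" if "z \<in> upper_half" for p z
    unfolding d_def by (rule higher_deriv_diff[OF fh gh upper_half_props(1) that])
  have iP: "\<i> * \<zeta> \<in> upper_half" if "\<zeta> \<in> ?P" for \<zeta> using that by (simp add: upper_half_def)
  have Gd: "(deriv ^^ p) G \<zeta> = \<i> ^ p * (deriv ^^ p) d (\<i> * \<zeta>)" if "\<zeta> \<in> ?P" for p \<zeta>
    unfolding G_def by (rule higher_deriv_compose_linear[OF dh open_halfspace_Re_gt upper_half_props(1) that iP])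
  \<comment> \<open>The bounds involve \<open>M (Suc p)\<close>, so the quotients start at index 1
    and their product is \<open>h ^ p * M (Suc p) / M 1\<close>. Omitting the first term does not
    affect divergence.\<close>
  define n where "n = (\<lambda>j. h * quot M (j + 1))"
  have "G (- \<i> * z) = 0"
  proof (rule quasianalytic_half_plane[of G n])
    show "G holomorphic_on ?P"
      unfolding G_def by (intro holomorphic_on_compose_gen[OF _ dh, unfolded o_def] holomorphic_intros) (use iP in auto)
    show "n j > 0" for j using h quot_pos[OF M] by (simp add: n_def)
    show "mono n" using monoD[OF mono_quot[OF M]] h by (auto simp: mono_def n_def)
    show "\<not> summable (\<lambda>j. 1 / sqrt (n j))"
    proof
      assume "summable (\<lambda>j. 1 / sqrt (n j))"
      then have "summable (\<lambda>j. sqrt h * (1 / sqrt (n j)))" by (rule summable_mult)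
      also have "(\<lambda>j. sqrt h * (1 / sqrt (n j))) = (\<lambda>j. 1 / sqrt (quot M (j + 1)))"
        using h by (simp add: n_def real_sqrt_mult)
      finally show False using div summable_iff_shift[of "\<lambda>j. 1 / sqrt (quot M j)" 1] by simp
    qed
    show "norm ((deriv ^^ p) G \<zeta>) \<le> (\<bar>K1\<bar> + \<bar>K2\<bar>) * M 1 * (\<Prod>j<p. n j)" if "Re \<zeta> > 0" for p \<zeta>
    proof -
      have w: "\<i> * \<zeta> \<in> upper_half" using that by (simp add: upper_half_def)
      have "norm ((deriv ^^ p) G \<zeta>) \<le> norm ((deriv ^^ p) f (\<i> * \<zeta>)) + norm ((deriv ^^ p) g (\<i> * \<zeta>))"
        using that by (simp add: Gd dd[OF w] norm_mult norm_power norm_triangle_ineq4)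
      also have "\<dots> \<le> K1 * h1 ^ p * M (Suc p) + K2 * h2 ^ p * M (Suc p)"
        by (intro add_mono K1 K2 w)
      also have "\<dots> \<le> \<bar>K1\<bar> * h ^ p * M (Suc p) + \<bar>K2\<bar> * h ^ p * M (Suc p)"
        using h h1 h2 Mpos[of "Suc p"] by (intro add_mono mult_mono power_mono) auto
      also have "\<dots> = (\<bar>K1\<bar> + \<bar>K2\<bar>) * M 1 * (\<Prod>j<p. n j)"
        unfolding n_def prod_quot_shift[OF M] using Mpos[of 1] by (simp add: field_simps)
      finally show ?thesis .
    qed
    show "((deriv ^^ p) G \<longlongrightarrow> 0) (at 0 within ?P)" for p
    proof -
      have "((\<lambda>z. \<i> ^ p * ((deriv ^^ p) f z - (deriv ^^ p) g z)) \<longlongrightarrow> \<i> ^ p * (borel_coeff f p - borel_coeff g p)) (at 0 within upper_half)"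
        by (intro tendsto_intros ultrahol_boundary_limit[OF f] ultrahol_boundary_limit[OF g])
      moreover have "filterlim (\<lambda>\<zeta>. \<i> * \<zeta>) (at 0 within upper_half) (at 0 within ?P)"
        unfolding filterlim_at
      proof
        have "((\<lambda>\<zeta>. \<i> * \<zeta>) \<longlongrightarrow> \<i> * 0) (at 0 within ?P)" by (intro tendsto_intros)
        then show "((\<lambda>\<zeta>. \<i> * \<zeta>) \<longlongrightarrow> 0) (at 0 within ?P)" by simp
        show "\<forall>\<^sub>F \<zeta> in at 0 within ?P. \<i> * \<zeta> \<in> upper_half \<and> \<i> * \<zeta> \<noteq> 0"
          by (auto simp: eventually_at_filter upper_half_def)
      qed
      ultimately have "((\<lambda>\<zeta>. \<i> ^ p * ((deriv ^^ p) f (\<i> * \<zeta>) - (deriv ^^ p) g (\<i> * \<zeta>))) \<longlongrightarrow> 0) (at 0 within ?P)"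
        using eq by (auto dest: filterlim_compose)
      then show ?thesis
      proof (rule Lim_transform_eventually)
        show "\<forall>\<^sub>F \<zeta> in at 0 within ?P. \<i> ^ p * ((deriv ^^ p) f (\<i> * \<zeta>) - (deriv ^^ p) g (\<i> * \<zeta>)) = (deriv ^^ p) G \<zeta>"
          using Gd dd iP by (auto simp: eventually_at_filter)
      qed
    qed
    show "Re (- \<i> * z) > 0" using z by (simp add: upper_half_def)
  qed
  then show ?thesis by (simp add: G_def d_def)
qed

section \<open>From the Borel map to the moment map\<close>

lemma norm_exp_minus_one_le:
  fixes z :: complex
  assumes "Re z \<le> 0"
  shows "norm (exp z - 1) \<le> norm z"
proof -
  have "norm (exp z - exp 0) \<le> 1 * norm (z - 0)"
  proof (rule field_differentiable_bound[of "{z. Re z \<le> 0}" exp exp])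
    show "convex {z. Re z \<le> 0}" by (rule convex_halfspace_Re_le)
  qed (use assms in \<open>auto intro: DERIV_exp has_field_derivative_at_within\<close>)
  then show ?thesis by simp
qed

text \<open>The decay of \<open>g\<close> keeps each \<open>r ^ p * g r\<close> bounded, so the
  derivative rule for bounded functions can be iterated.\<close>

lemma higher_deriv_laplace:
  assumes g: "continuous_on {0<..} g" "\<And>p r. r > 0 \<Longrightarrow> r ^ p * norm (g r) \<le> B p" and s: "Re s > 0"
  shows "(deriv ^^ p) (laplace g) s = laplace (\<lambda>r. of_real ((- r) ^ p) * g r) s"
  using s
proof (induction p arbitrary: s)
  case (Suc p)
  let ?g = "\<lambda>r. of_real ((- r) ^ p) * g r"
  have "\<forall>\<^sub>F s in nhds s. (deriv ^^ p) (laplace g) s = laplace ?g s"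
    using Suc.IH eventually_nhds_in_open[OF open_halfspace_Re_gt, of s 0] Suc.prems
    by (auto elim: eventually_mono)
  then have "deriv ((deriv ^^ p) (laplace g)) s = deriv (laplace ?g) s"
    by (rule deriv_cong_ev) simp
  also have "\<dots> = laplace (\<lambda>r. - (of_real r * ?g r)) s"
    using g(2)[of _ p] by (intro DERIV_imp_deriv laplace_has_field_derivative[OF _ _ Suc.prems, of _ "B p"])
      (auto intro!: continuous_intros g(1) simp: norm_mult norm_power)
  finally show ?case by (simp add: mult_ac)
qed simp

text \<open>Splitting the integral at \<open>h * quot M p\<close> and \<open>h * quot M (p + 1)\<close>, where the best of the
  bounds with exponents \<open>p\<close>, \<open>p + 1\<close>, \<open>p + 2\<close> changes, produces the logarithm controlled by (sm).\<close>

lemma nn_integral_moment_le: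
  assumes M: "weight_seq M" and h: "h > 0" and K: "K \<ge> 0"
    and bd: "\<And>p x. x > 0 \<Longrightarrow> x ^ p * \<phi> x \<le> K * h ^ p * M p"
  shows "(\<integral>\<^sup>+x. ennreal (x ^ p * \<phi> x) * indicator {0<..} x \<partial>lborel)
    \<le> ennreal (K * h ^ (p + 1) * M (p + 1) * (2 + ln (quot M (p + 1) / quot M p)))"
proof -
  define a where "a = h * quot M p"
  define b where "b = h * quot M (p + 1)"
  have a: "a > 0" using h quot_pos[OF M] by (simp add: a_def)
  have ab: "a \<le> b" using h incseq_SucD[OF mono_quot[OF M], of p] by (simp add: a_def b_def)
  note Mpos = weight_seq_pos[OF M]
  \<comment> \<open>In terms of \<open>D\<close> the three bounds on the integrand are
    \<open>D / a\<close>, \<open>D / x\<close> and \<open>D * b / x^2\<close>. Over their intervals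
    they integrate to \<open>D\<close>, \<open>D * ln (b / a)\<close> and \<open>D\<close>.\<close>
  define D where "D = K * h ^ (p + 1) * M (p + 1)"
  have D: "D \<ge> 0" using K h Mpos[of "p+1"] by (simp add: D_def)
  have Da: "K * h ^ p * M p = D / a"
    using h Mpos[of p] Mpos[of "p+1"] by (simp add: D_def a_def quot_def)
  have Db: "K * h ^ (p + 2) * M (p + 2) = D * b"
    using h Mpos[of "p+1"] by (simp add: D_def b_def quot_def)
  let ?u = "\<lambda>x. ennreal (D / a) * indicator {0..a} x + ennreal (D / x) * indicator {a..b} x
     + ennreal (D * b / x^2) * indicator {b..} x"
  have "(\<integral>\<^sup>+x. ennreal (x ^ p * \<phi> x) * indicator {0<..} x \<partial>lborel) \<le> (\<integral>\<^sup>+x. ?u x \<partial>lborel)"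
  proof (rule nn_integral_mono)
    fix x :: real
    consider "x \<le> 0" | "0 < x" "x \<le> a" | "a < x" "x \<le> b" | "b < x" by linarith
    then show "ennreal (x ^ p * \<phi> x) * indicator {0<..} x \<le> ?u x"
    proof cases
      case 2
      then have "ennreal (x ^ p * \<phi> x) \<le> ennreal (D / a)" using bd[of x p] Da by (intro ennreal_leI) auto
      also have "\<dots> \<le> ?u x" using 2 by (auto intro: add_increasing2)
      finally show ?thesis using 2 by simp
    next
      case 3
      have "x * (x ^ p * \<phi> x) \<le> D" using bd[of x "p+1"] 3 a by (simp add: D_def mult_ac)
      then have "x ^ p * \<phi> x \<le> D / x" using 3 a by (simp add: field_simps)
      then have "ennreal (x ^ p * \<phi> x) \<le> ennreal (D / x)" by (intro ennreal_leI)
      also have "\<dots> \<le> ?u x" using 3 by (auto intro: add_increasing2 add_increasing)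
      finally show ?thesis using 3 a by simp
    next
      case 4
      have "x^2 * (x ^ p * \<phi> x) \<le> D * b" using bd[of x "p+2"] 4 a ab Db by (simp add: power_add mult_ac power2_eq_square)
      then have "x ^ p * \<phi> x \<le> D * b / x^2" using 4 a ab by (simp add: field_simps)
      then have "ennreal (x ^ p * \<phi> x) \<le> ennreal (D * b / x^2)" by (intro ennreal_leI)
      also have "\<dots> \<le> ?u x" using 4 by (auto intro: add_increasing2 add_increasing)
      finally show ?thesis using 4 a ab by simp
    qed auto
  qed
  also have "\<dots> = (\<integral>\<^sup>+x. ennreal (D / a) * indicator {0..a} x \<partial>lborel) + (\<integral>\<^sup>+x. ennreal (D / x) * indicator {a..b} x \<partial>lborel)
     + (\<integral>\<^sup>+x. ennreal (D * b / x^2) * indicator {b..} x \<partial>lborel)"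
    by (subst nn_integral_add; (subst nn_integral_add)?) auto
  also have "(\<integral>\<^sup>+x. ennreal (D / a) * indicator {0..a} x \<partial>lborel) = ennreal D"
    using a D by (simp add: nn_integral_cmult_indicator ennreal_mult[symmetric])
  also have "(\<integral>\<^sup>+x. ennreal (D / x) * indicator {a..b} x \<partial>lborel) = ennreal (D * ln b - D * ln a)"
    using a ab D by (intro nn_integral_FTC_Icc[where F = "\<lambda>x. D * ln x"]) (auto intro!: derivative_eq_intros)
  also have "(\<integral>\<^sup>+x. ennreal (D * b / x^2) * indicator {b..} x \<partial>lborel) = ennreal (0 - (- (D * b / b)))"
  proof (rule nn_integral_FTC_atLeast[where F = "\<lambda>x. - (D * b / x)"])
    show "((\<lambda>x. - (D * b / x)) has_real_derivative D * b / x^2) (at x)" if "b \<le> x" for x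
      using that a ab by (auto intro!: derivative_eq_intros simp: power2_eq_square)
    show "0 \<le> D * b / x^2" for x using D a ab by simp
    show "((\<lambda>x. - (D * b / x)) \<longlongrightarrow> 0) at_top" by real_asymp
  qed auto
  also have "ennreal D + ennreal (D * ln b - D * ln a) + ennreal (0 - (- (D * b / b))) = ennreal (D + (D * ln b - D * ln a) + D)"
  proof -
    have "D * ln a \<le> D * ln b" using D a ab by (intro mult_left_mono) auto
    then show ?thesis using a ab D by (simp flip: ennreal_plus)
  qed
  also have "D + (D * ln b - D * ln a) + D = D * (2 + ln (quot M (p + 1) / quot M p))"
  proof -
    have "ln b - ln a = ln (quot M (p + 1) / quot M p)"
      using a ab h quot_pos[OF M, of p] quot_pos[OF M, of "p + 1"] by (simp add: a_def b_def ln_mult ln_div)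
    then show ?thesis by (simp add: algebra_simps flip: right_diff_distrib)
  qed
  finally show ?thesis by (simp add: D_def)
qed

text \<open>By (sm) the logarithm in \<open>nn_integral_moment_le\<close> grows at most
  geometrically in \<open>p\<close>, so it only enlarges \<open>h\<close> to \<open>h * H\<close>
  and changes the constant.\<close>

lemma C_M_moment_bound:
  assumes M: "weight_seq M" and sm: "cond_sm M" and \<phi>: "\<phi> \<in> C_M M"
  obtains h K where "h > 0" "\<And>p. set_integrable lborel {0<..} (\<lambda>x. of_real (x ^ p) * \<phi> x)"
    "\<And>p. (LINT x:{0<..}|lborel. norm (of_real (x ^ p) * \<phi> x)) \<le> K * h ^ p * M (Suc p)"
proof -
  obtain h K where h: "h > 0" and cont: "continuous_on {0<..} \<phi>"
    and bd: "\<And>p x. x > 0 \<Longrightarrow> x ^ p * norm (\<phi> x) \<le> K * h ^ p * M p"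
    using \<phi> by (auto simp: C_M_def)
  obtain C H where C: "C > 0" "H > 1" and smb: "\<And>p. ln (quot M (Suc p) / quot M p) \<le> C * H ^ (p + 1)"
    using sm by (auto simp: cond_sm_def)
  have "norm (\<phi> 1) \<le> K * M 0" using bd[of 1 0] by simp
  then have K: "K \<ge> 0" using M norm_ge_zero[of "\<phi> 1"] unfolding weight_seq_def by (metis mult.right_neutral order.trans)
  note Mpos = weight_seq_pos[OF M]
  define f where "f = (\<lambda>x. indicator {0<..} x * norm (\<phi> x))"
  have mono1: "quot M p \<le> quot M (p + 1)" for p using incseq_SucD[OF mono_quot[OF M], of p] by simp
  have ln0: "ln (quot M (p + 1) / quot M p) \<ge> 0" for p
    using mono1[of p] quot_pos[OF M, of p] by simp
  have nn: "(\<integral>\<^sup>+x. ennreal (norm (indicator {0<..} x *\<^sub>R (of_real (x ^ p) * \<phi> x))) \<partial>lborel)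
     \<le> ennreal (K * h ^ (p + 1) * M (p + 1) * (2 + ln (quot M (p + 1) / quot M p)))" for p
  proof -
    have "(\<integral>\<^sup>+x. ennreal (norm (indicator {0<..} x *\<^sub>R (of_real (x ^ p) * \<phi> x))) \<partial>lborel)
       = (\<integral>\<^sup>+x. ennreal (x ^ p * f x) * indicator {0<..} x \<partial>lborel)"
      by (intro nn_integral_cong) (auto simp: f_def indicator_def norm_mult norm_power)
    also have "\<dots> \<le> ennreal (K * h ^ (p + 1) * M (p + 1) * (2 + ln (quot M (p + 1) / quot M p)))"
      using bd by (intro nn_integral_moment_le[OF M h K]) (auto simp: f_def)
    finally show ?thesis .
  qed
  have I: "set_integrable lborel {0<..} (\<lambda>x. of_real (x ^ p) * \<phi> x)" for p
    unfolding set_integrable_def integrable_iff_bounded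
  proof
    show "(\<lambda>x. indicator {0<..} x *\<^sub>R (of_real (x ^ p) * \<phi> x)) \<in> borel_measurable lborel"
      unfolding measurable_lborel2
      by (intro borel_measurable_continuous_on_indicator) (auto intro!: continuous_intros cont)
    show "(\<integral>\<^sup>+x. ennreal (norm (indicator {0<..} x *\<^sub>R (of_real (x ^ p) * \<phi> x))) \<partial>lborel) < \<infinity>"
      using nn[of p] by (auto intro: le_less_trans)
  qed
  show ?thesis
  proof (rule that[of "h * H" "K * h * (2 + C * H)"])
    show "h * H > 0" using h C by simp
    show "set_integrable lborel {0<..} (\<lambda>x. of_real (x ^ p) * \<phi> x)" for p by (rule I)
    fix p
    let ?g = "\<lambda>x. indicator {0<..} x *\<^sub>R (of_real (x ^ p) * \<phi> x)"
    have "ennreal (LINT x|lborel. norm (?g x)) = (\<integral>\<^sup>+x. ennreal (norm (?g x)) \<partial>lborel)"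
      by (rule nn_integral_eq_integral[symmetric, OF integrable_norm[OF I[unfolded set_integrable_def]]]) simp
    also note nn[of p]
    finally have "(LINT x|lborel. norm (?g x)) \<le> K * h ^ (p + 1) * M (p + 1) * (2 + ln (quot M (p + 1) / quot M p))"
      using K h Mpos[of "p+1"] ln0[of p] by (subst (asm) ennreal_le_iff) auto
    also have "\<dots> \<le> K * h ^ (p + 1) * M (p + 1) * (2 * H ^ p + C * H ^ (p + 1))"
      using K h Mpos[of "p+1"] smb[of p] C by (intro mult_left_mono add_mono) auto
    also have "\<dots> = K * h * (2 + C * H) * (h * H) ^ p * M (Suc p)"
      by (simp add: algebra_simps power_mult_distrib)
    finally show "(LINT x:{0<..}|lborel. norm (of_real (x ^ p) * \<phi> x)) \<le> K * h * (2 + C * H) * (h * H) ^ p * M (Suc p)"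
      by (simp add: set_lebesgue_integral_def)
  qed
qed

text \<open>On the right half-plane \<open>exp (-(s * r)) - 1\<close> has modulus at most
  \<open>norm s * r\<close>, so the first absolute moment gives convergence at a linear
  rate.\<close>

lemma laplace_tendsto_integral:
  assumes I0: "set_integrable lborel {0<..} g" and I1: "set_integrable lborel {0<..} (\<lambda>r. of_real r * g r)"
  shows "(laplace g \<longlongrightarrow> (LINT r:{0<..}|lborel. g r)) (at 0 within {s. Re s > 0})"
proof (rule LIM_zero_cancel, rule Lim_null_comparison)
  let ?P = "{s. Re s > 0}" and ?I = "LINT r:{0<..}|lborel. g r"
  let ?C = "LINT r:{0<..}|lborel. norm (of_real r * g r)"
  show "\<forall>\<^sub>F s in at 0 within ?P. norm (laplace g s - ?I) \<le> norm s * ?C"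
    unfolding eventually_at_filter
  proof (intro always_eventually allI impI)
    fix s assume "s \<in> ?P"
    then have s: "Re s > 0" by simp
    have Lint: "set_integrable lborel {0<..} (\<lambda>r. exp (-(s * of_real r)) * g r)"
    proof (rule set_integrable_bound[OF I0])
      have "(\<lambda>r::real. exp (-(s * of_real r))) \<in> borel_measurable lborel"
        unfolding measurable_lborel2 by (intro borel_measurable_continuous_onI continuous_intros)
      from borel_measurable_times[OF this borel_measurable_integrable[OF I0[unfolded set_integrable_def]]] show "set_borel_measurable lborel {0<..} (\<lambda>r. exp (-(s * of_real r)) * g r)"
        by (simp add: set_borel_measurable_def)
      show "AE r in lborel. r \<in> {0<..} \<longrightarrow> norm (exp (-(s * of_real r)) * g r) \<le> norm (g r)"
        using s by (auto simp: norm_mult intro!: mult_left_le_one_le)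
    qed
    let ?d = "\<lambda>r. exp (-(s * of_real r)) * g r - g r"
    have Id: "set_integrable lborel {0<..} ?d" by (rule set_integral_diff(1)[OF Lint I0])
    have "laplace g s - ?I = (LINT r:{0<..}|lborel. ?d r)"
      unfolding set_integral_diff(2)[OF Lint I0] laplace_def ..
    then have "norm (laplace g s - ?I) \<le> (LINT r:{0<..}|lborel. norm (?d r))"
      using set_integral_norm_bound[OF Id] by simp
    also have "\<dots> \<le> (LINT r:{0<..}|lborel. norm s * norm (of_real r * g r))"
    proof (rule set_integral_mono[OF set_integrable_norm[OF Id] set_integrable_mult_right[OF set_integrable_norm[OF I1]]])
      fix r :: real assume r: "r \<in> {0<..}"
      have "?d r = (exp (-(s * of_real r)) - 1) * g r" by (simp add: algebra_simps)
      then have "norm (?d r) = norm (exp (-(s * of_real r)) - 1) * norm (g r)"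
        by (simp only: norm_mult)
      also have "\<dots> \<le> norm (-(s * of_real r)) * norm (g r)"
        using r s by (intro mult_right_mono norm_exp_minus_one_le) auto
      also have "\<dots> = norm s * norm (of_real r * g r)"
        by (simp add: norm_mult norm_power mult_ac)
      finally show "norm (?d r) \<le> norm s * norm (of_real r * g r)" .
    qed
    also have "\<dots> = norm s * ?C" by simp
    finally show "norm (laplace g s - ?I) \<le> norm s * ?C" .
  qed
  have "((\<lambda>s. norm s * ?C) \<longlongrightarrow> norm (0::complex) * ?C) (at 0 within ?P)" by (intro tendsto_intros)
  then show "((\<lambda>s. norm s * ?C) \<longlongrightarrow> 0) (at 0 within ?P)" by simp
qed

text \<open>Each derivative multiplies the integrand by \<open>\<i> * r\<close>. The absolute
  moments therefore bound the derivatives uniformly on the half-plane, and the limits at 0 are the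
  moments up to powers of \<i>.\<close>

lemma C_M_transform:
  assumes M: "weight_seq M" and sm: "cond_sm M" and \<phi>: "\<phi> \<in> C_M M"
  shows "(\<lambda>z. laplace \<phi> (- \<i> * z)) \<in> ultrahol_H (shift1 M)"
    and "borel_coeff (\<lambda>z. laplace \<phi> (- \<i> * z)) p = \<i> ^ p * moment \<phi> p"
proof -
  let ?f = "\<lambda>z. laplace \<phi> (- \<i> * z)"
  obtain h0 K0 where cont: "continuous_on {0<..} \<phi>"
    and bd: "\<And>p x. x > 0 \<Longrightarrow> x ^ p * norm (\<phi> x) \<le> K0 * h0 ^ p * M p"
    using \<phi> by (auto simp: C_M_def)
  obtain h K where h: "h > 0" and I: "\<And>p. set_integrable lborel {0<..} (\<lambda>x. of_real (x ^ p) * \<phi> x)"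
    and K: "\<And>p. (LINT x:{0<..}|lborel. norm (of_real (x ^ p) * \<phi> x)) \<le> K * h ^ p * M (Suc p)"
    using C_M_moment_bound[OF M sm \<phi>] by blast
  let ?P = "{z. Re z > 0}"
  have Lhol: "laplace \<phi> holomorphic_on ?P"
    using bd[of _ 0] by (intro holomorphic_laplace[OF cont, where B = "K0 * M 0"]) auto
  have iP: "- \<i> * z \<in> ?P" if "z \<in> upper_half" for z using that by (simp add: upper_half_def)
  have fd: "(deriv ^^ p) ?f z = \<i> ^ p * laplace (\<lambda>r. of_real (r ^ p) * \<phi> r) (- \<i> * z)" if z: "z \<in> upper_half" for p z
  proof -
    have "(deriv ^^ p) ?f z = (- \<i>) ^ p * (deriv ^^ p) (laplace \<phi>) (- \<i> * z)"
      by (rule higher_deriv_compose_linear[OF Lhol upper_half_props(1) open_halfspace_Re_gt z iP])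
    also have "(deriv ^^ p) (laplace \<phi>) (- \<i> * z) = laplace (\<lambda>r. of_real ((- r) ^ p) * \<phi> r) (- \<i> * z)"
      using iP[OF z] by (intro higher_deriv_laplace[OF cont bd]) auto
    also have "\<dots> = (-1) ^ p * laplace (\<lambda>r. of_real (r ^ p) * \<phi> r) (- \<i> * z)"
      unfolding laplace_def set_integral_mult_right[symmetric]
      by (simp add: power_minus[of "of_real _"] mult_ac)
    finally show ?thesis by (simp add: power_mult_distrib[symmetric])
  qed
  have Lint: "set_integrable lborel {0<..} (\<lambda>r. exp (-(s * of_real r)) * (of_real (r ^ p) * \<phi> r))" if "Re s > 0" for s p
    using bd[of _ 0] by (intro laplace_integrable_power[OF cont _ that, where B = "K0 * M 0"]) auto
  have Lb: "norm (laplace (\<lambda>r. of_real (r ^ p) * \<phi> r) s) \<le> K * h ^ p * M (Suc p)" if s: "Re s > 0" for p s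
  proof -
    have "norm (laplace (\<lambda>r. of_real (r ^ p) * \<phi> r) s) \<le> (LINT r:{0<..}|lborel. norm (exp (-(s * of_real r)) * (of_real (r ^ p) * \<phi> r)))"
      unfolding laplace_def by (rule set_integral_norm_bound[OF Lint[OF s]])
    also have "\<dots> \<le> (LINT r:{0<..}|lborel. norm (of_real (r ^ p) * \<phi> r))"
    proof (rule set_integral_mono[OF set_integrable_norm[OF Lint[OF s]] set_integrable_norm[OF I]])
      fix r :: real assume "r \<in> {0<..}"
      then have "norm (exp (-(s * of_real r))) \<le> 1" using s by simp
      then show "norm (exp (-(s * of_real r)) * (of_real (r ^ p) * \<phi> r)) \<le> norm (of_real (r ^ p) * \<phi> r)"
        unfolding norm_mult[of "exp _"] by (rule mult_left_le_one_le[rotated 2]) auto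
    qed
    also note K
    finally show ?thesis .
  qed
  have "?f holomorphic_on upper_half"
    by (intro holomorphic_on_compose_gen[OF _ Lhol, unfolded o_def] holomorphic_intros) (use iP in auto)
  moreover have "norm ((deriv ^^ p) ?f z) \<le> K * h ^ p * shift1 M p" if "z \<in> upper_half" for p z
    using Lb[of "- \<i> * z" p] iP[OF that] unfolding fd[OF that] norm_mult norm_power by (simp add: shift1_def)
  ultimately show mem: "?f \<in> ultrahol_H (shift1 M)"
    unfolding ultrahol_H_def using h by blast
  have lim: "(laplace (\<lambda>r. of_real (r ^ p) * \<phi> r) \<longlongrightarrow> moment \<phi> p) (at 0 within ?P)"
    using laplace_tendsto_integral[OF I[of p]] I[of "Suc p"] by (simp add: moment_def scaleR_conv_of_real mult_ac)
  have "filterlim (\<lambda>z. - \<i> * z) (at 0 within ?P) (at 0 within upper_half)"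
    unfolding filterlim_at
  proof
    have "((\<lambda>z. - \<i> * z) \<longlongrightarrow> - \<i> * 0) (at 0 within upper_half)" by (intro tendsto_intros)
    then show "((\<lambda>z. - \<i> * z) \<longlongrightarrow> 0) (at 0 within upper_half)" by simp
    show "\<forall>\<^sub>F z in at 0 within upper_half. - \<i> * z \<in> ?P \<and> - \<i> * z \<noteq> 0"
      by (auto simp: eventually_at_filter upper_half_def)
  qed
  from tendsto_mult_left[OF filterlim_compose[OF lim this], of "\<i> ^ p"]
  have "((\<lambda>z. \<i> ^ p * laplace (\<lambda>r. of_real (r ^ p) * \<phi> r) (- \<i> * z)) \<longlongrightarrow> \<i> ^ p * moment \<phi> p) (at 0 within upper_half)" .
  then have "((deriv ^^ p) ?f \<longlongrightarrow> \<i> ^ p * moment \<phi> p) (at 0 within upper_half)"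
  proof (rule Lim_transform_eventually)
    show "\<forall>\<^sub>F z in at 0 within upper_half. \<i> ^ p * laplace (\<lambda>r. of_real (r ^ p) * \<phi> r) (- \<i> * z) = (deriv ^^ p) ?f z"
      unfolding eventually_at_filter by (intro always_eventually allI impI fd[symmetric])
  qed
  then show "borel_coeff ?f p = \<i> ^ p * moment \<phi> p"
    using ultrahol_boundary_limit[OF mem, of p] tendsto_unique[OF upper_half_props(3)] by blast
qed

lemma moment_injective_C_M:
  assumes M: "weight_seq M" and sm: "cond_sm M"
    and inj: "\<And>f g z. f \<in> ultrahol_H (shift1 M) \<Longrightarrow> g \<in> ultrahol_H (shift1 M) \<Longrightarrow> borel_coeff f = borel_coeff g \<Longrightarrow> z \<in> upper_half \<Longrightarrow> f z = g z"
    and \<phi>: "\<phi> \<in> C_M M" and \<psi>: "\<psi> \<in> C_M M" and eq: "moment \<phi> = moment \<psi>" and x: "x > 0"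
  shows "\<phi> x = \<psi> x"
proof -
  have "\<exists>K. \<forall>r>0. norm (f r) \<le> K" "continuous_on {0<..} f" if f: "f \<in> C_M M" for f
  proof -
    obtain h K where "\<And>p x. x > 0 \<Longrightarrow> x ^ p * norm (f x) \<le> K * h ^ p * M p"
      using f by (auto simp: C_M_def)
    from this[of _ 0] show "\<exists>K. \<forall>r>0. norm (f r) \<le> K" by (intro exI[of _ "K * M 0"]) simp
    show "continuous_on {0<..} f" using f by (simp add: C_M_def)
  qed
  then obtain K1 K2 where \<phi>': "continuous_on {0<..} \<phi>" "\<And>r. r > 0 \<Longrightarrow> norm (\<phi> r) \<le> K1"
    and \<psi>': "continuous_on {0<..} \<psi>" "\<And>r. r > 0 \<Longrightarrow> norm (\<psi> r) \<le> K2" using \<phi> \<psi> by metis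
  have "(\<lambda>r. \<phi> r - \<psi> r) x = 0"
  proof (rule laplace_eq_0_imp[where B = "K1 + K2"])
    show "continuous_on {0<..} (\<lambda>r. \<phi> r - \<psi> r)" by (intro continuous_intros \<phi>' \<psi>')
    show "norm (\<phi> r - \<psi> r) \<le> K1 + K2" if "r > 0" for r
      using \<phi>'(2)[OF that] \<psi>'(2)[OF that] norm_triangle_ineq4[of "\<phi> r" "\<psi> r"] by linarith
    fix y :: real assume y: "y > 0"
    \<comment> \<open>On the positive imaginary axis the transform is the Laplace transform at a
      real point, which determines the function.\<close>
    have "laplace \<phi> (- \<i> * (\<i> * of_real y)) = laplace \<psi> (- \<i> * (\<i> * of_real y))"
      using y C_M_transform[OF M sm \<phi>] C_M_transform[OF M sm \<psi>] eq
      by (intro inj[of "\<lambda>z. laplace \<phi> (- \<i> * z)" "\<lambda>z. laplace \<psi> (- \<i> * z)"]) (auto simp: upper_half_def)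
    then have e: "laplace \<phi> (of_real y) = laplace \<psi> (of_real y)" by (simp add: mult.assoc[symmetric])
    have "laplace (\<lambda>r. \<phi> r - \<psi> r) (of_real y) = (LINT r:{0<..}|lborel. exp (-(of_real y * of_real r)) * \<phi> r - exp (-(of_real y * of_real r)) * \<psi> r)"
      unfolding laplace_def right_diff_distrib ..
    also have "\<dots> = laplace \<phi> (of_real y) - laplace \<psi> (of_real y)"
      unfolding laplace_def using y
      by (intro set_integral_diff(2) laplace_integrable[OF \<phi>'] laplace_integrable[OF \<psi>']) auto
    finally show "laplace (\<lambda>r. \<phi> r - \<psi> r) (of_real y) = 0" using e by simp
  qed (rule x)
  then show ?thesis by simp
qed

section \<open>Random series of uniform variables\<close>

definition unif01 :: "real measure" where
  "unif01 = restrict_space lborel {0..1}"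

lemma prob_space_unif01: "prob_space unif01"
  by (intro prob_spaceI) (simp add: unif01_def emeasure_restrict_space)

lemma space_unif01 [simp]: "space unif01 = {0..1}"
  by (simp add: unif01_def)

interpretation seq_unif: sequence_space unif01
  unfolding sequence_space_def product_prob_space_def product_sigma_finite_def product_prob_space_axioms_def
  using prob_space_unif01 by (auto intro: prob_space_imp_sigma_finite)

abbreviation "unif_seq \<equiv> PiM (UNIV :: nat set) (\<lambda>_. unif01)"

lemma measurable_ident_unif01: "(\<lambda>x. x) \<in> borel_measurable unif01"
  by (simp add: unif01_def measurable_restrict_space1)

lemma measurable_component_unif_seq: "(\<lambda>\<omega>. \<omega> k) \<in> borel_measurable unif_seq"
  using measurable_comp[OF measurable_component_singleton[of k UNIV "\<lambda>_. unif01"] measurable_ident_unif01]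
  by (simp add: o_def)

text \<open>The law of a tail of the random series: \<open>q\<close> is the number of leading
  coefficients dropped, so that the uniform variables can be split off one at a time.\<close>

definition series_law :: "(nat \<Rightarrow> real) \<Rightarrow> nat \<Rightarrow> real measure" where
  "series_law c q = distr unif_seq borel (\<lambda>\<omega>. \<Sum>k. c (k + q) * \<omega> k)"

lemma measurable_series: "(\<lambda>\<omega>. \<Sum>k. c (k + q) * \<omega> k) \<in> borel_measurable unif_seq"
  for c :: "nat \<Rightarrow> real"
proof -
  note [measurable] = measurable_component_unif_seq
  show ?thesis by measurable
qed

lemma sets_series_law [simp, measurable_cong]: "sets (series_law c q) = sets borel"
  by (simp add: series_law_def)

lemma space_series_law [simp]: "space (series_law c q) = UNIV"
  by (simp add: series_law_def)

lemma prob_space_series_law: "prob_space (series_law c q)"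
  unfolding series_law_def by (rule seq_unif.prob_space_distr) (rule measurable_series)

context
  fixes c :: "nat \<Rightarrow> real"
  assumes c: "\<And>j. c j \<ge> 0" "summable c"
begin

lemma space_unif_seqD: "\<omega> \<in> space unif_seq \<Longrightarrow> 0 \<le> \<omega> k \<and> \<omega> k \<le> 1"
  by (auto simp: space_PiM PiE_iff)

lemma summable_series: "\<omega> \<in> space unif_seq \<Longrightarrow> summable (\<lambda>k. c (k + q) * \<omega> k)"
proof (rule summable_comparison_test')
  show "summable (\<lambda>k. c (k + q))" using c(2) by (simp add: summable_iff_shift)
  fix k assume "\<omega> \<in> space unif_seq"
  then show "norm (c (k + q) * \<omega> k) \<le> c (k + q)"
    using space_unif_seqD[of \<omega> k] c(1)[of "k + q"] by (simp add: abs_mult mult_left_le)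
qed

lemma AE_series_law: "AE s in series_law c q. 0 \<le> s \<and> s \<le> (\<Sum>k. c (k + q))"
  unfolding series_law_def
proof (subst AE_distr_iff[OF measurable_series])
  show "AE \<omega> in unif_seq. 0 \<le> (\<Sum>k. c (k + q) * \<omega> k) \<and> (\<Sum>k. c (k + q) * \<omega> k) \<le> (\<Sum>k. c (k + q))"
  proof (intro AE_I2 conjI)
    fix \<omega> assume \<omega>: "\<omega> \<in> space unif_seq"
    show "0 \<le> (\<Sum>k. c (k + q) * \<omega> k)"
      using summable_series[OF \<omega>] c(1) space_unif_seqD[OF \<omega>] by (intro suminf_nonneg) auto
    show "(\<Sum>k. c (k + q) * \<omega> k) \<le> (\<Sum>k. c (k + q))"
      using summable_series[OF \<omega>] c space_unif_seqD[OF \<omega>]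
      by (intro suminf_le) (auto simp: summable_iff_shift mult_left_le)
  qed
qed measurable

text \<open>An independent uniform sequence is one uniform variable followed by an independent copy
  of the sequence (\<open>PiM_iter\<close>), so the leading term of the series becomes a separate
  average over \<open>{0..1}\<close>. Boundedness of \<open>g\<close> justifies Fubini.\<close>

lemma integral_series_law:
  fixes g :: "real \<Rightarrow> complex"
  assumes [measurable]: "g \<in> borel_measurable borel" and B: "\<And>x. norm (g x) \<le> B"
  shows "(LINT s|(series_law c q). g s) =
         (LINT u:{0..1}|lborel. (LINT s|(series_law c (Suc q)). g (c q * u + s)))"
proof -
  note [measurable] = measurable_ident_unif01 measurable_component_unif_seq measurable_series
  interpret U: prob_space unif01 by (rule prob_space_unif01)
  interpret UU: pair_prob_space unif01 unif_seq ..
  let ?S = "\<lambda>q \<omega>. \<Sum>k. c (k + q) * \<omega> k :: real"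
  have case_nat_meas [measurable]: "(\<lambda>(s, \<omega>). case_nat s \<omega>) \<in> measurable (unif01 \<Otimes>\<^sub>M unif_seq) unif_seq"
    by measurable
  have split: "?S q (case_nat u \<omega>) = c q * u + ?S (Suc q) \<omega>" if "u \<in> {0..1}" "\<omega> \<in> space unif_seq" for u \<omega>
  proof -
    have "case_nat u \<omega> \<in> space unif_seq"
      using that by (auto simp: space_PiM PiE_iff split: nat.splits)
    from suminf_split_head[OF summable_series[OF this, of q]]
    show ?thesis by simp
  qed
  have "(LINT s|(series_law c q). g s) = (LINT \<omega>|unif_seq. g (?S q \<omega>))"
    unfolding series_law_def by (rule integral_distr) measurable
  also have "\<dots> = (LINT \<omega>|(distr (unif01 \<Otimes>\<^sub>M unif_seq) unif_seq (\<lambda>(s, \<omega>). case_nat s \<omega>)). g (?S q \<omega>))"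
    by (simp add: seq_unif.PiM_iter)
  also have "\<dots> = (LINT p|(unif01 \<Otimes>\<^sub>M unif_seq). g (?S q (case p of (s, \<omega>) \<Rightarrow> case_nat s \<omega>)))"
    by (rule integral_distr) measurable
  also have "\<dots> = (LINT p|(unif01 \<Otimes>\<^sub>M unif_seq). g (c q * fst p + ?S (Suc q) (snd p)))"
    by (rule Bochner_Integration.integral_cong) (auto simp: space_pair_measure split)
  also have "\<dots> = (LINT u|unif01. (LINT \<omega>|unif_seq. g (c q * u + ?S (Suc q) \<omega>)))"
  proof -
    have "integrable (unif01 \<Otimes>\<^sub>M unif_seq) (\<lambda>p. g (c q * fst p + ?S (Suc q) (snd p)))"
      by (rule UU.integrable_const_bound[where B = B]) (use B in auto)
    from UU.integral_fst'[OF this] show ?thesis by simp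
  qed
  also have "\<dots> = (LINT u|unif01. (LINT s|(series_law c (Suc q)). g (c q * u + s)))"
    unfolding series_law_def by (subst integral_distr) auto
  also have "\<dots> = (LINT u:{0..1}|lborel. (LINT s|(series_law c (Suc q)). g (c q * u + s)))"
    unfolding unif01_def by (simp add: integral_restrict_space set_lebesgue_integral_def)
  finally show ?thesis .
qed

end

section \<open>Smoothing by random translations\<close>

text \<open>The convolution of \<open>\<psi>\<close> with the law of the tail from index
  \<open>q\<close>.\<close>

definition smoothing :: "(nat \<Rightarrow> real) \<Rightarrow> nat \<Rightarrow> (real \<Rightarrow> complex) \<Rightarrow> real \<Rightarrow> complex" where
  "smoothing c q \<psi> x = (LINT s|series_law c q. \<psi> (x - s))"

lemma measurable_series_law_shift:
  assumes "continuous_on UNIV \<psi>"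
  shows "(\<lambda>s. \<psi> (x - s)) \<in> borel_measurable (series_law c q)"
  unfolding measurable_cong_sets[OF sets_series_law refl]
  by (intro borel_measurable_continuous_onI continuous_on_compose2[OF assms] continuous_intros) auto

text \<open>Iterated backward difference quotients, with step \<open>c j\<close> in round
  \<open>j\<close>. They are what \<open>q\<close> differentiations of the smoothing leave inside
  the average over the remaining variables.\<close>

fun diff_quotients :: "(nat \<Rightarrow> real) \<Rightarrow> (real \<Rightarrow> complex) \<Rightarrow> nat \<Rightarrow> real \<Rightarrow> complex" where
  "diff_quotients c \<psi> 0 = \<psi>"
| "diff_quotients c \<psi> (Suc q) = (\<lambda>x. (diff_quotients c \<psi> q x - diff_quotients c \<psi> q (x - c q)) / of_real (c q))"

lemma continuous_diff_quotients:
  assumes "continuous_on UNIV \<psi>"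
  shows "continuous_on UNIV (diff_quotients c \<psi> q)"
proof (induction q)
  case (Suc q)
  have "continuous_on UNIV (\<lambda>x. (diff_quotients c \<psi> q x - diff_quotients c \<psi> q (x - c q)) * inverse (of_real (c q)))"
    by (intro continuous_intros Suc continuous_on_compose2[OF Suc]) auto
  then show ?case by (simp add: divide_inverse)
qed (use assms in simp)

context
  fixes c :: "nat \<Rightarrow> real"
  assumes c: "\<And>j. c j > 0" "summable c"
begin

text \<open>Each round adds two values of the previous one, divides by \<open>c j\<close> and
  reaches back by \<open>c j\<close>. This accounts both for the factor \<open>2 / c j\<close> and
  for the length of the window.\<close>

lemma norm_diff_quotients_le:
  assumes "\<And>y. x - (\<Sum>j<q. c j) \<le> y \<Longrightarrow> y \<le> x \<Longrightarrow> norm (\<psi> y) \<le> B"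
  shows "norm (diff_quotients c \<psi> q x) \<le> B * (\<Prod>j<q. 2 / c j)"
  using assms
proof (induction q arbitrary: x)
  case 0
  then show ?case by simp
next
  case (Suc q)
  let ?b = "B * (\<Prod>j<q. 2 / c j)"
  have "norm (diff_quotients c \<psi> q x) \<le> ?b"
    using c(1)[of q] by (intro Suc.IH Suc.prems) auto
  moreover have "norm (diff_quotients c \<psi> q (x - c q)) \<le> ?b"
    using c(1)[of q] by (intro Suc.IH Suc.prems) (auto simp: algebra_simps)
  ultimately have "norm (diff_quotients c \<psi> q x - diff_quotients c \<psi> q (x - c q)) \<le> ?b + ?b"
    by (intro order.trans[OF norm_triangle_ineq4] add_mono)
  then show ?case using c(1)[of q] by (simp add: norm_divide field_simps)
qed

lemma continuous_smoothing:
  assumes \<psi>: "continuous_on UNIV \<psi>" "\<And>x. norm (\<psi> x) \<le> B"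
  shows "isCont (smoothing c q \<psi>) x"
proof (rule continuous_at_sequentiallyI)
  fix u :: "nat \<Rightarrow> real" assume u: "u \<longlonglongrightarrow> x"
  interpret prob_space "series_law c q" by (rule prob_space_series_law)
  have [measurable]: "\<psi> \<in> borel_measurable borel" using \<psi>(1) by (rule borel_measurable_continuous_onI)
  show "(\<lambda>n. smoothing c q \<psi> (u n)) \<longlonglongrightarrow> smoothing c q \<psi> x"
    unfolding smoothing_def
  proof (rule integral_dominated_convergence[where w = "\<lambda>_. B"])
    show "AE s in series_law c q. (\<lambda>n. \<psi> (u n - s)) \<longlonglongrightarrow> \<psi> (x - s)"
      using \<psi>(1) by (intro AE_I2 isCont_tendsto_compose[of _ \<psi>] tendsto_intros u) (auto simp: continuous_on_eq_continuous_at)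
    show "AE s in series_law c q. norm (\<psi> (u n - s)) \<le> B" for n using \<psi>(2) by simp
  qed (auto intro: measurable_series_law_shift[OF \<psi>(1)])
qed

lemma integrable_series_law_shift:
  assumes \<psi>: "continuous_on UNIV \<psi>" "\<And>x. norm (\<psi> x) \<le> B"
  shows "integrable (series_law c q) (\<lambda>s. \<psi> (x - s) :: complex)"
proof -
  interpret prob_space "series_law c q" by (rule prob_space_series_law)
  have [measurable]: "\<psi> \<in> borel_measurable borel" using \<psi>(1) by (rule borel_measurable_continuous_onI)
  show ?thesis
    by (rule integrable_const_bound[where B = B]) (auto simp: \<psi>(2) intro: measurable_series_law_shift[OF \<psi>(1)])
qed

lemma norm_smoothing_le:
  assumes \<psi>: "continuous_on UNIV \<psi>" "\<And>x. norm (\<psi> x) \<le> B0"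
    and B: "\<And>y. x - (\<Sum>k. c (k + q)) \<le> y \<Longrightarrow> y \<le> x \<Longrightarrow> norm (\<psi> y) \<le> B"
  shows "norm (smoothing c q \<psi> x) \<le> B"
proof -
  interpret prob_space "series_law c q" by (rule prob_space_series_law)
  have "norm (smoothing c q \<psi> x) \<le> (LINT s|(series_law c q). norm (\<psi> (x - s)))"
    unfolding smoothing_def by (rule integral_norm_bound)
  also have "\<dots> \<le> B"
  proof (rule integral_le_const)
    show "integrable (series_law c q) (\<lambda>s. norm (\<psi> (x - s)))"
      by (intro integrable_norm integrable_series_law_shift[OF \<psi>])
    show "AE s in series_law c q. norm (\<psi> (x - s)) \<le> B"
      using AE_series_law[of c q] c by (auto simp: less_imp_le intro!: B)
  qed
  finally show ?thesis .
qed

text \<open>Splitting off the uniform variable of index \<open>q\<close> writes the smoothing as a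
  mean over \<open>[x - c q, x]\<close> of the continuous function \<open>?\<theta>\<close>, that
  is, as a difference quotient of an antiderivative. Hence continuity of \<open>\<psi>\<close> alone
  yields a derivative.\<close>

lemma smoothing_has_vector_derivative:
  assumes \<psi>: "continuous_on UNIV \<psi>" "\<And>x. norm (\<psi> x) \<le> B"
  shows "(smoothing c q \<psi> has_vector_derivative
           smoothing c (Suc q) (\<lambda>x. (\<psi> x - \<psi> (x - c q)) / of_real (c q)) x) (at x)"
proof -
  let ?\<theta> = "smoothing c (Suc q) \<psi>"
  have [measurable]: "\<psi> \<in> borel_measurable borel" using \<psi>(1) by (rule borel_measurable_continuous_onI)
  obtain \<Theta> where \<Theta>: "\<And>x. (\<Theta> has_vector_derivative ?\<theta> x) (at x)"
    using einterval_antiderivative[of "-\<infinity>" "\<infinity>" ?\<theta>] continuous_smoothing[OF \<psi>] by auto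
  have eq: "smoothing c q \<psi> x = (1 / c q) *\<^sub>R (\<Theta> x - \<Theta> (x - c q))" for x
  proof -
    have "smoothing c q \<psi> x = (LINT u:{0..1}|lborel. ?\<theta> (x - c q * u))"
      unfolding smoothing_def
      by (subst integral_series_law[where B = B]) (use c \<psi> in \<open>auto simp: less_imp_le algebra_simps\<close>)
    also have "\<dots> = integral {0..1} (\<lambda>u. ?\<theta> (x - c q * u))"
    proof (rule set_borel_integral_eq_integral(2), rule borel_integrable_atLeastAtMost')
      have "continuous_on UNIV ?\<theta>"
        using continuous_smoothing[OF \<psi>] by (simp add: continuous_on_eq_continuous_at)
      then show "continuous_on {0..1} (\<lambda>u. ?\<theta> (x - c q * u))"
        by (rule continuous_on_compose2) (auto intro!: continuous_intros)
    qed
    also have "\<dots> = - ((1 / c q) *\<^sub>R \<Theta> (x - c q * 1)) - - ((1 / c q) *\<^sub>R \<Theta> (x - c q * 0))"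
    proof (rule integral_unique, rule fundamental_theorem_of_calculus)
      fix u :: real
      have "((\<lambda>u. x - c q * u) has_real_derivative - c q) (at u)"
        by (auto intro!: derivative_eq_intros)
      then have "((\<lambda>u. x - c q * u) has_vector_derivative - c q) (at u)"
        by (simp add: has_real_derivative_iff_has_vector_derivative)
      from vector_diff_chain_at[OF this \<Theta>]
      have "((\<lambda>u. \<Theta> (x - c q * u)) has_vector_derivative (- c q) *\<^sub>R ?\<theta> (x - c q * u)) (at u)"
        by (simp add: o_def)
      from has_vector_derivative_minus[OF bounded_linear.has_vector_derivative[OF bounded_linear_scaleR_right[of "1 / c q"] this]]
      have "((\<lambda>u. - ((1 / c q) *\<^sub>R \<Theta> (x - c q * u))) has_vector_derivative ?\<theta> (x - c q * u)) (at u)"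
        using c(1)[of q] by simp
      then show "((\<lambda>u. - ((1 / c q) *\<^sub>R \<Theta> (x - c q * u))) has_vector_derivative ?\<theta> (x - c q * u)) (at u within {0..1})"
        by (rule has_vector_derivative_at_within)
    qed simp
    finally show ?thesis by (simp add: scaleR_diff_right)
  qed
  have "((\<lambda>x. x - c q) has_vector_derivative 1) (at x)"
    by (auto intro!: derivative_eq_intros)
  from vector_diff_chain_at[OF this \<Theta>]
  have "((\<lambda>x. \<Theta> (x - c q)) has_vector_derivative ?\<theta> (x - c q)) (at x)"
    by (simp add: o_def)
  from bounded_linear.has_vector_derivative[OF bounded_linear_scaleR_right[of "1 / c q"] has_vector_derivative_diff[OF \<Theta> this]]
  have "(smoothing c q \<psi> has_vector_derivative (1 / c q) *\<^sub>R (?\<theta> x - ?\<theta> (x - c q))) (at x)"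
    unfolding eq[abs_def] .
  moreover have "(1 / c q) *\<^sub>R (?\<theta> x - ?\<theta> (x - c q)) = smoothing c (Suc q) (\<lambda>x. (\<psi> x - \<psi> (x - c q)) / of_real (c q)) x"
  proof -
    have "(1 / c q) *\<^sub>R (?\<theta> x - ?\<theta> (x - c q)) = (LINT s|(series_law c (Suc q)). (\<psi> (x - s) - \<psi> (x - c q - s))) / of_real (c q)"
      unfolding smoothing_def
      by (subst Bochner_Integration.integral_diff) (auto intro!: integrable_series_law_shift[OF \<psi>] simp: scaleR_conv_of_real)
    also have "\<dots> = smoothing c (Suc q) (\<lambda>x. (\<psi> x - \<psi> (x - c q)) / of_real (c q)) x"
      unfolding smoothing_def by (simp add: algebra_simps)
    finally show ?thesis .
  qed
  ultimately show ?thesis by simp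
qed

lemma higher_vderiv_smoothing:
  assumes \<psi>: "continuous_on UNIV \<psi>" "\<And>x. norm (\<psi> x) \<le> B"
  shows "(vderiv ^^ q) (smoothing c 0 \<psi>) = smoothing c q (diff_quotients c \<psi> q)"
    and "(smoothing c q (diff_quotients c \<psi> q) has_vector_derivative
          smoothing c (Suc q) (diff_quotients c \<psi> (Suc q)) x) (at x)"
proof -
  have d: "(smoothing c q (diff_quotients c \<psi> q) has_vector_derivative
          smoothing c (Suc q) (diff_quotients c \<psi> (Suc q)) x) (at x)" for q x
    using smoothing_has_vector_derivative[OF continuous_diff_quotients[OF \<psi>(1)] norm_diff_quotients_le[OF \<psi>(2)]]
    by simp
  show "(vderiv ^^ q) (smoothing c 0 \<psi>) = smoothing c q (diff_quotients c \<psi> q)"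
  proof (induction q)
    case (Suc q)
    have "(vderiv ^^ Suc q) (smoothing c 0 \<psi>) = vderiv (smoothing c q (diff_quotients c \<psi> q))"
      using Suc by simp
    also have "\<dots> = smoothing c (Suc q) (diff_quotients c \<psi> (Suc q))"
      unfolding vderiv_def by (rule ext, rule vector_derivative_at[OF d])
    finally show ?case .
  qed simp
  show "(smoothing c q (diff_quotients c \<psi> q) has_vector_derivative
          smoothing c (Suc q) (diff_quotients c \<psi> (Suc q)) x) (at x)" by (rule d)
qed

lemma smooth_R_smoothing:
  assumes \<psi>: "continuous_on UNIV \<psi>" "\<And>x. norm (\<psi> x) \<le> B"
  shows "smooth_R (smoothing c 0 \<psi>)"
  unfolding smooth_R_def higher_vderiv_smoothing(1)[OF \<psi>]
  using higher_vderiv_smoothing(2)[OF \<psi>] differentiableI_vector by blast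

text \<open>The difference quotients reach back by the sum of the first \<open>q\<close>
  coefficients and the remaining average by the tail. Together this is \<open>suminf c\<close>, so
  the window does not depend on \<open>q\<close>.\<close>

lemma norm_higher_vderiv_smoothing_le:
  assumes \<psi>: "continuous_on UNIV \<psi>" "\<And>x. norm (\<psi> x) \<le> B0"
    and B: "\<And>y. x - suminf c \<le> y \<Longrightarrow> y \<le> x \<Longrightarrow> norm (\<psi> y) \<le> B"
  shows "norm ((vderiv ^^ q) (smoothing c 0 \<psi>) x) \<le> B * (\<Prod>j<q. 2 / c j)"
  unfolding higher_vderiv_smoothing(1)[OF \<psi>]
proof (rule norm_smoothing_le[OF continuous_diff_quotients[OF \<psi>(1)] norm_diff_quotients_le[OF \<psi>(2)]])
  fix y assume y: "x - (\<Sum>k. c (k + q)) \<le> y" "y \<le> x"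
  have "suminf c = (\<Sum>k. c (k + q)) + (\<Sum>j<q. c j)"
    using suminf_split_initial_segment[OF c(2), of q] by simp
  then show "norm (diff_quotients c \<psi> q y) \<le> B * (\<Prod>j<q. 2 / c j)"
    using y by (intro norm_diff_quotients_le B) auto
qed

text \<open>By the binomial theorem a moment of a translate of \<open>\<psi>\<close> is a
  combination of moments of \<open>\<psi>\<close>, hence 0. Fubini passes this to the average over
  translates.\<close>

lemma moment_smoothing_eq_0:
  assumes \<psi>: "continuous_on UNIV \<psi>" "\<And>x. norm (\<psi> x) \<le> B" "\<And>x. x \<le> 0 \<Longrightarrow> \<psi> x = 0"
    and I: "\<And>p. set_integrable lborel {0<..} (\<lambda>x. of_real (x ^ p) * \<psi> x)"
    and zero: "\<And>p. moment \<psi> p = 0"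
  shows "moment (smoothing c 0 \<psi>) p = 0"
proof -
  let ?\<nu> = "series_law c 0"
  interpret \<nu>: prob_space ?\<nu> by (rule prob_space_series_law)
  interpret pair_sigma_finite ?\<nu> "lborel :: real measure" ..
  have [measurable]: "\<psi> \<in> borel_measurable borel" using \<psi>(1) by (rule borel_measurable_continuous_onI)
  \<comment> \<open>Both \<open>\<psi>\<close> and its smoothing vanish on the left, so the moments
    are integrals over the whole line, where translations can be substituted.\<close>
  have ind: "indicator {0<..} x *\<^sub>R (of_real (x ^ k) * \<psi> x) = of_real (x ^ k) * \<psi> x" for k x
    using \<psi>(3)[of x] by (cases "x \<le> 0") auto
  have I': "integrable lborel (\<lambda>x. of_real (x ^ k) * \<psi> x)" for k
    using I[of k] unfolding set_integrable_def ind .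
  have zero': "(LINT x|lborel. of_real (x ^ k) * \<psi> x) = 0" for k
  proof -
    have "(LINT x|lborel. of_real (x ^ k) * \<psi> x) = (LINT x|lborel. indicator {0<..} x *\<^sub>R (of_real (x ^ k) * \<psi> x))"
      unfolding ind ..
    also have "\<dots> = moment \<psi> k" by (simp add: moment_def set_lebesgue_integral_def scaleR_conv_of_real)
    finally show ?thesis using zero by simp
  qed
  have sm0: "smoothing c 0 \<psi> x = 0" if "x \<le> 0" for x
    using norm_smoothing_le[OF \<psi>(1,2), of x 0 0] \<psi>(3) that by auto
  have binom: "of_real ((y + s) ^ p) * \<psi> y = (\<Sum>k\<le>p. of_real (of_nat (p choose k) * s ^ (p - k)) * (of_real (y ^ k) * \<psi> y))" for y s
  proof -
    have "(y + s) ^ p = (\<Sum>k\<le>p. of_nat (p choose k) * y ^ k * s ^ (p - k))" by (rule binomial_ring)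
    then show ?thesis by (simp only: of_real_sum sum_distrib_right of_real_mult) (simp add: mult_ac)
  qed
  have Ish: "integrable lborel (\<lambda>y. of_real ((y + s) ^ p) * \<psi> y)" for s
    unfolding binom by (intro Bochner_Integration.integrable_sum integrable_mult_right I')

  have Ix: "integrable lborel (\<lambda>x. of_real (x ^ p) * \<psi> (x - s))" for s
    using lborel_integrable_real_affine[OF Ish[of s], of 1 "- s"] by (simp add: add.commute)
  have zx: "(LINT x|lborel. of_real (x ^ p) * \<psi> (x - s)) = 0" for s
  proof -
    have "(LINT x|lborel. of_real ((x + s) ^ p) * \<psi> x) = (LINT x|lborel. of_real (x ^ p) * \<psi> (x - s))"
      using lborel_integral_real_affine[of 1 "\<lambda>y. of_real ((y + s) ^ p) * \<psi> y" "- s"] by (simp add: add.commute)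
    moreover have "(LINT x|lborel. of_real ((x + s) ^ p) * \<psi> x) = 0"
      unfolding binom
      by (subst Bochner_Integration.integral_sum, rule integrable_mult_right, rule I')
         (simp only: integral_mult_right_zero zero' mult_zero_right sum.neutral_const)
    ultimately show ?thesis by simp
  qed
  have pair: "integrable (?\<nu> \<Otimes>\<^sub>M lborel) (\<lambda>(s, x). of_real (x ^ p) * \<psi> (x - s))"
  proof (rule Fubini_integrable)
    show "(\<lambda>(s, x). of_real (x ^ p) * \<psi> (x - s)) \<in> borel_measurable (?\<nu> \<Otimes>\<^sub>M lborel)"
      by measurable
    show "AE s in ?\<nu>. integrable lborel (\<lambda>x. case (s, x) of (s, x) \<Rightarrow> of_real (x ^ p) * \<psi> (x - s))"
      using Ix by simp
    let ?C = "suminf c"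
    have C: "?C \<ge> 0" using c by (intro suminf_nonneg) (auto simp: less_imp_le)
    \<comment> \<open>Almost every shift lies between 0 and \<open>suminf c\<close>. As
      \<open>\<psi>\<close> lives on the positive axis, the largest shift has the largest absolute
      moment, which bounds the inner integrals uniformly for Fubini.\<close>
    let ?D = "LINT y|lborel. norm (of_real ((y + ?C) ^ p) * \<psi> y)"
    have "norm (LINT x|lborel. norm (of_real (x ^ p) * \<psi> (x - s))) \<le> ?D" if s: "0 \<le> s" "s \<le> ?C" for s
    proof -
      have "(LINT x|lborel. norm (of_real (x ^ p) * \<psi> (x - s))) = (LINT y|lborel. norm (of_real ((y + s) ^ p) * \<psi> y))"
        using lborel_integral_real_affine[of 1 "\<lambda>y. norm (of_real ((y + s) ^ p) * \<psi> y)" "- s"] by (simp add: add.commute)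
      also have "\<dots> \<le> ?D"
      proof (rule integral_mono[OF integrable_norm[OF Ish] integrable_norm[OF Ish]])
        fix y :: real
        show "norm (of_real ((y + s) ^ p) * \<psi> y) \<le> norm (of_real ((y + ?C) ^ p) * \<psi> y)"
        proof (cases "y \<le> 0")
          case False
          then have "\<bar>y + s\<bar> ^ p \<le> \<bar>y + ?C\<bar> ^ p" using s by (intro power_mono) auto
          then show ?thesis by (simp only: norm_mult norm_of_real power_abs) (simp add: mult_right_mono)
        qed (use \<psi>(3) in simp)
      qed
      finally show ?thesis by simp
    qed
    then have "AE s in ?\<nu>. norm (LINT x|lborel. norm (of_real (x ^ p) * \<psi> (x - s))) \<le> ?D"
      using AE_series_law[of c 0] c by (auto simp: less_imp_le)
    then show "integrable ?\<nu> (\<lambda>s. LINT x|lborel. norm (case (s, x) of (s, x) \<Rightarrow> of_real (x ^ p) * \<psi> (x - s)))"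
      unfolding prod.case by (rule \<nu>.integrable_const_bound) measurable
  qed
  have "moment (smoothing c 0 \<psi>) p = (LINT x|lborel. (LINT s|?\<nu>. of_real (x ^ p) * \<psi> (x - s)))"
    unfolding moment_def set_lebesgue_integral_def
  proof (rule Bochner_Integration.integral_cong)
    fix x :: real
    show "indicator {0<..} x *\<^sub>R (x ^ p *\<^sub>R smoothing c 0 \<psi> x) = (LINT s|?\<nu>. of_real (x ^ p) * \<psi> (x - s))"
      using sm0[of x] by (cases "x \<le> 0") (auto simp: smoothing_def scaleR_conv_of_real)
  qed simp
  also have "\<dots> = (LINT s|?\<nu>. (LINT x|lborel. of_real (x ^ p) * \<psi> (x - s)))"
    using Fubini_integral[OF pair] by simp
  also have "\<dots> = 0" using zx by simp
  finally show ?thesis .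
qed

end

section \<open>A function with vanishing moments\<close>

lemma laplace_1:
  assumes b: "Re b > 0"
  shows "laplace (\<lambda>r. 1) b = 1 / b"
proof -
  let ?F = "\<lambda>z. - exp (-(b * z)) / b"
  have b0: "b \<noteq> 0" using b by auto
  have "(\<lambda>n. ?F (1 * of_real (real n)) - ?F (1 * of_real (1 / real n))) \<longlonglongrightarrow> 1 * laplace (\<lambda>r. 1) (b * 1)"
    using b b0 by (intro ray_integral_limit[where B = 1]) (auto intro!: derivative_eq_intros)
  moreover have "(\<lambda>n. ?F (1 * of_real (real n)) - ?F (1 * of_real (1 / real n))) \<longlonglongrightarrow> - 0 / b - - exp (-(b * (1 * of_real 0))) / b"
  proof (intro tendsto_intros lim_1_over_n b0)
    show "(\<lambda>n. exp (-(b * (1 * of_real (real n))))) \<longlonglongrightarrow> 0"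
    proof (rule tendsto_norm_zero_cancel)
      have "(\<lambda>n. exp (-(Re b * real n))) \<longlonglongrightarrow> 0" using b by real_asymp
      then show "(\<lambda>n. norm (exp (-(b * (1 * of_real (real n)))))) \<longlonglongrightarrow> 0" by simp
    qed
  qed
  ultimately show ?thesis using LIMSEQ_unique by fastforce
qed

text \<open>Each induction step differentiates in \<open>s\<close>. The factor
  \<open>exp (-(a * r))\<close> keeps the powers bounded, as the derivative rule for
  \<open>laplace\<close> requires.\<close>

lemma power_exp_laplace:
  assumes a: "a > 0" and s: "Re s > 0"
  shows "laplace (\<lambda>r. of_real (r ^ n * exp (-(a * r)))) s = fact n / (s + of_real a) ^ Suc n"
  using s
proof (induction n arbitrary: s)
  case 0
  have "Re (s + of_real a) > 0" using 0 a by simp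
  from laplace_1[OF this] have "laplace (\<lambda>r. 1) (s + of_real a) = 1 / (s + of_real a)" .
  moreover have "laplace (\<lambda>r. of_real (r ^ 0 * exp (-(a * r)))) s = laplace (\<lambda>r. 1) (s + of_real a)"
    unfolding laplace_def by (simp add: exp_of_real[symmetric] ring_distribs flip: exp_add)
  ultimately show ?case by simp
next
  case (Suc n)
  let ?g = "\<lambda>r. of_real (r ^ n * exp (-(a * r))) :: complex"
  have bd: "norm (?g r) \<le> fact n / a ^ n" if "r > 0" for r
  proof -
    have "norm (?g r) = r ^ n * exp (-(a * r))" unfolding norm_of_real using that by simp
    also have "\<dots> \<le> (fact n / a ^ n * exp (a * r)) * exp (-(a * r))"
      using that by (intro mult_right_mono power_le_fact_exp a) auto
    also have "\<dots> = fact n / a ^ n" by (simp add: exp_minus)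
    finally show ?thesis .
  qed
  have "(laplace ?g has_field_derivative laplace (\<lambda>r. - (of_real r * ?g r)) s) (at s)"
    by (rule laplace_has_field_derivative[OF _ bd Suc.prems]) (auto intro!: continuous_intros)
  moreover have "(laplace ?g has_field_derivative - (fact (Suc n) / (s + of_real a) ^ Suc (Suc n))) (at s)"
  proof (rule has_field_derivative_transform_within_open)
    show "((\<lambda>s. fact n / (s + of_real a) ^ Suc n) has_field_derivative - (fact (Suc n) / (s + of_real a) ^ Suc (Suc n))) (at s)"
    proof -
      let ?w = "s + of_real a"
      have "Re ?w > 0" using Suc.prems a by simp
      then have w: "?w \<noteq> 0" by (metis less_irrefl zero_complex.sel(1))
      then have "((\<lambda>s. fact n * inverse (s + of_real a) ^ Suc n) has_field_derivative
          fact n * (of_nat (Suc n) * inverse ?w ^ n * (- (inverse ?w * inverse ?w)))) (at s)"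
      proof -
        have "((\<lambda>s. inverse (s + of_real a)) has_field_derivative - (inverse ?w * inverse ?w)) (at s)"
          using w by (auto intro!: derivative_eq_intros)
        from DERIV_cmult[OF DERIV_power[OF this, of "Suc n"], of "fact n"] show ?thesis
          by (simp only: diff_Suc_Suc diff_zero mult_ac)
      qed
      moreover have "fact n * (of_nat (Suc n) * inverse ?w ^ n * (- (inverse ?w * inverse ?w))) = - (fact (Suc n) / ?w ^ Suc (Suc n))"
        by (simp add: divide_inverse power_inverse mult_ac del: of_nat_Suc)
      ultimately show ?thesis by (simp only: divide_inverse power_inverse)
    qed
    show "open {s. Re s > 0}" by (rule open_halfspace_Re_gt)
  qed (use Suc in auto)
  ultimately have "laplace (\<lambda>r. - (of_real r * ?g r)) s = - (fact (Suc n) / (s + of_real a) ^ Suc (Suc n))"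
    by (rule DERIV_unique)
  moreover have "laplace (\<lambda>r. - (of_real r * ?g r)) s = - laplace (\<lambda>r. of_real (r ^ Suc n * exp (-(a * r)))) s"
    unfolding laplace_def by (simp add: set_lebesgue_integral_def mult_ac)
  ultimately show ?case by simp
qed

lemma
  assumes z: "Re z > 0"
  shows integrable_power_exp: "set_integrable lborel {0<..} (\<lambda>r. exp (-(z * of_real r)) * of_real (r ^ n))"
    and integral_power_exp: "(LINT r:{0<..}|lborel. exp (-(z * of_real r)) * of_real (r ^ n)) = fact n / z ^ Suc n"
proof -
  show "set_integrable lborel {0<..} (\<lambda>r. exp (-(z * of_real r)) * of_real (r ^ n))"
    using laplace_integrable_power[of "\<lambda>_. 1" 1 z n] z by simp
  \<comment> \<open>Half of the decay is lent to the power to make it bounded; the transform is then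
    taken at \<open>z - of_real a\<close>, which still has positive real part.\<close>
  define a where "a = Re z / 2"
  have a: "a > 0" "Re (z - of_real a) > 0" using z by (auto simp: a_def)
  have eq: "exp (-((z - of_real a) * of_real r)) * of_real (r ^ n * exp (-(a * r))) = exp (-(z * of_real r)) * of_real (r ^ n)" for r
  proof -
    have "exp (-((z - of_real a) * of_real r)) * exp (of_real (-(a * r))) = exp (-(z * of_real r))"
      by (simp only: exp_add[symmetric]) (simp add: algebra_simps)
    then show ?thesis by (simp only: exp_of_real of_real_mult) (simp add: mult_ac)
  qed
  show "(LINT r:{0<..}|lborel. exp (-(z * of_real r)) * of_real (r ^ n)) = fact n / z ^ Suc n"
    using power_exp_laplace[OF a, of n] unfolding laplace_def eq by simp
qed

lemma rapid_decay_integrable: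
  fixes g :: "real \<Rightarrow> 'a::{banach, second_countable_topology}"
  assumes "continuous_on {0<..} g"
    and B: "\<And>r. r > 0 \<Longrightarrow> norm (g r) \<le> B" "\<And>r. r > 0 \<Longrightarrow> r^2 * norm (g r) \<le> B"
  shows "set_integrable lborel {0<..} g"
proof -
  have "B \<ge> 0" using order.trans[OF norm_ge_zero B(1)[of 1]] by simp
  have bd: "norm (g r) \<le> 4 * B / (1 + r)^2" if r: "r > 0" for r
  proof -
    have "(1 + r)^2 \<le> 2 * (1 + r^2)" using sum_squares_bound[of 1 r] by (simp add: power2_eq_square algebra_simps)
    then have "(1 + r)^2 * norm (g r) \<le> 2 * (1 + r^2) * norm (g r)" by (intro mult_right_mono) auto
    also have "\<dots> \<le> 2 * (B + B)" using B[OF r] by (simp add: algebra_simps)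
    finally show ?thesis using r by (simp add: field_simps)
  qed
  have nn: "(\<integral>\<^sup>+r. ennreal (4 * B / (1 + r)^2) * indicator {0..} r \<partial>lborel) = ennreal (0 - (- (4 * B / (1 + 0))))"
  proof (rule nn_integral_FTC_atLeast[where F = "\<lambda>r. - (4 * B / (1 + r))"])
    show "((\<lambda>r. - (4 * B / (1 + r))) has_real_derivative 4 * B / (1 + r)^2) (at r)" if "0 \<le> r" for r
      using that by (auto intro!: derivative_eq_intros simp: power2_eq_square)
    show "((\<lambda>r. - (4 * B / (1 + r))) \<longlongrightarrow> 0) at_top" by real_asymp
  qed (use \<open>B \<ge> 0\<close> in auto)
  show ?thesis
    unfolding set_integrable_def integrable_iff_bounded
  proof
    show "(\<lambda>x. indicator {0<..} x *\<^sub>R g x) \<in> borel_measurable lborel"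
      unfolding measurable_lborel2 by (intro borel_measurable_continuous_on_indicator assms(1)) auto
    have "(\<integral>\<^sup>+x. ennreal (norm (indicator {0<..} x *\<^sub>R g x)) \<partial>lborel) \<le> (\<integral>\<^sup>+r. ennreal (4 * B / (1 + r)^2) * indicator {0..} r \<partial>lborel)"
      using bd by (intro nn_integral_mono) (auto simp: indicator_def intro!: ennreal_leI)
    also note nn
    finally show "(\<integral>\<^sup>+x. ennreal (norm (indicator {0<..} x *\<^sub>R g x)) \<partial>lborel) < \<infinity>"
      by (auto intro: le_less_trans)
  qed
qed

section \<open>Characteristic functions of the random series\<close>

lemma real_distribution_series_law: "real_distribution (series_law c q)"
  unfolding real_distribution_def real_distribution_axioms_def by (simp add: prob_space_series_law)

lemma norm_char_uniform_le:
  fixes a :: real assumes "a > 0"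
  shows "norm (LINT u:{0..1}|lborel. iexp (a * u)) \<le> 2 / a"
proof -
  have "(LINT u:{0..1}|lborel. iexp (a * u)) = integral {0..1} (\<lambda>u. iexp (a * u))"
    by (intro set_borel_integral_eq_integral(2) borel_integrable_atLeastAtMost') (intro continuous_intros)
  also have "\<dots> = iexp (a * 1) / (\<i> * a) - iexp (a * 0) / (\<i> * a)"
  proof (intro integral_unique fundamental_theorem_of_calculus)
    fix u :: real
    have "((\<lambda>z. exp (\<i> * (of_real a * z)) / (\<i> * a)) has_field_derivative exp (\<i> * (of_real a * of_real u))) (at (of_real u))"
      using assms by (auto intro!: derivative_eq_intros simp: mult_ac)
    from has_vector_derivative_real_field[OF this]
    show "((\<lambda>u. iexp (a * u) / (\<i> * a)) has_vector_derivative iexp (a * u)) (at u within {0..1})"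
      by (simp add: has_vector_derivative_at_within)
  qed simp
  also have "\<dots> = (iexp a - 1) / (\<i> * a)" by (simp add: diff_divide_distrib)
  also have "norm \<dots> \<le> (norm (iexp a) + norm (1::complex)) / a"
    unfolding norm_divide using assms by (intro frac_le norm_triangle_ineq4) (auto simp: norm_mult)
  also have "\<dots> = 2 / a" by simp
  finally show ?thesis .
qed

text \<open>Independence makes the characteristic function a product. The first \<open>n\<close>
  uniform variables contribute at most \<open>2 / (t * c (j + q))\<close> each, and the rest at most
  1.\<close>

lemma norm_char_series_law_le:
  assumes c: "\<And>j. c j > 0" "summable c" and t: "t > 0"
  shows "norm (char (series_law c q) t) \<le> (\<Prod>j<n. 2 / (t * c (j + q)))"
proof (induction n arbitrary: q)
  case 0
  then show ?case using real_distribution.cmod_char_le_1[OF real_distribution_series_law] by simp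
next
  case (Suc n)
  have "char (series_law c q) t = (LINT u:{0..1}|lborel. (LINT s|(series_law c (Suc q)). iexp (t * (c q * u + s))))"
    unfolding char_def
    by (rule integral_series_law[where B = 1]) (use c in \<open>auto simp: less_imp_le\<close>)
  also have "\<dots> = (LINT u:{0..1}|lborel. iexp ((t * c q) * u) * char (series_law c (Suc q)) t)"
    unfolding char_def by (simp add: ring_distribs exp_add mult_ac)
  also have "\<dots> = (LINT u:{0..1}|lborel. iexp ((t * c q) * u)) * char (series_law c (Suc q)) t"
    by (rule set_integral_mult_left)
  also have "norm \<dots> \<le> 2 / (t * c q) * (\<Prod>j<n. 2 / (t * c (j + Suc q)))"
    unfolding norm_mult using c(1)[of q] t Suc.IH[of "Suc q"]
    by (intro mult_mono norm_char_uniform_le) auto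
  also have "\<dots> = (\<Prod>j<Suc n. 2 / (t * c (j + q)))"
    unfolding prod.lessThan_Suc_shift by simp
  finally show ?case .
qed

text \<open>\<open>\<Phi>\<close> is the characteristic function of \<open>1 + S\<close>, with
  \<open>S\<close> distributed by \<open>\<nu>\<close>. The shift by 1 keeps the variable away from
  0, where the kernel \<open>1 / (1 + s) ^ Suc n\<close> would be singular.\<close>

context
  fixes \<nu> :: "real measure" and \<Phi> :: "real \<Rightarrow> complex"
  assumes \<nu>: "real_distribution \<nu>" "AE s in \<nu>. 0 \<le> s"
  defines "\<Phi> \<equiv> \<lambda>t. iexp t * char \<nu> t"
begin

lemma continuous_shifted_char: "continuous_on S \<Phi>"
proof -
  interpret real_distribution \<nu> by (rule \<nu>)
  have "continuous_on S (char \<nu>)" by (intro continuous_at_imp_continuous_on ballI isCont_char)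
  then show ?thesis unfolding \<Phi>_def by (intro continuous_intros)
qed

lemma norm_shifted_char_le_1: "norm (\<Phi> t) \<le> 1"
  using real_distribution.cmod_char_le_1[OF \<nu>(1)] by (simp add: \<Phi>_def norm_mult)

lemma shifted_char_eq: "\<Phi> t = (LINT s|\<nu>. iexp (t * (1 + s)))"
  unfolding \<Phi>_def char_def by (simp add: ring_distribs exp_add)

text \<open>The damping by \<open>\<epsilon>\<close> makes the double integral absolutely
  convergent, so the integral over \<open>t\<close> can be evaluated first, as a Gamma
  integral.\<close>

lemma laplace_shifted_char:
  assumes \<epsilon>: "\<epsilon> > 0"
  shows "laplace (\<lambda>t. of_real (t ^ n) * \<Phi> t) (of_real \<epsilon>) = (LINT s|\<nu>. fact n / (of_real \<epsilon> - \<i> * of_real (1 + s)) ^ Suc n)"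
proof -
  interpret \<nu>: real_distribution \<nu> by (rule \<nu>)
  interpret pair_sigma_finite \<nu> "lborel :: real measure" ..
  let ?f = "\<lambda>s t. indicator {0<..} t *\<^sub>R (exp (-((of_real \<epsilon> - \<i> * of_real (1 + s)) * of_real t)) * of_real (t ^ n))"
  have Re: "Re (of_real \<epsilon> - \<i> * of_real (1 + s)) > 0" for s :: real using \<epsilon> by simp
  have nf: "norm (?f s t) = indicator {0<..} t * (exp (-(\<epsilon> * t)) * \<bar>t\<bar> ^ n)" for s t
    by (simp add: norm_mult norm_power)
  have pair: "integrable (\<nu> \<Otimes>\<^sub>M lborel) (\<lambda>(s, t). ?f s t)"
  proof (rule Fubini_integrable)
    show "(\<lambda>(s, t). ?f s t) \<in> borel_measurable (\<nu> \<Otimes>\<^sub>M lborel)" by measurable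
    show "AE s in \<nu>. integrable lborel (\<lambda>t. case (s, t) of (s, t) \<Rightarrow> ?f s t)"
      using integrable_power_exp[OF Re, of _ n] by (simp add: set_integrable_def)
    show "integrable \<nu> (\<lambda>s. LINT t|lborel. norm (case (s, t) of (s, t) \<Rightarrow> ?f s t))"
      unfolding prod.case nf by simp
  qed
  have "laplace (\<lambda>t. of_real (t ^ n) * \<Phi> t) (of_real \<epsilon>) = (LINT t|lborel. (LINT s|\<nu>. ?f s t))"
    unfolding laplace_def set_lebesgue_integral_def
  proof (rule Bochner_Integration.integral_cong)
    fix t :: real
    have "(LINT s|\<nu>. ?f s t) = (LINT s|\<nu>. (indicator {0<..} t *\<^sub>R (exp (-(of_real \<epsilon> * of_real t)) * of_real (t ^ n))) * iexp (t * (1 + s)))"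
    proof (rule Bochner_Integration.integral_cong)
      fix s :: real
      have "exp (-((of_real \<epsilon> - \<i> * of_real (1 + s)) * of_real t)) = exp (-(of_real \<epsilon> * of_real t)) * iexp (t * (1 + s))"
        unfolding exp_add[symmetric] by (simp add: algebra_simps)
      then show "?f s t = (indicator {0<..} t *\<^sub>R (exp (-(of_real \<epsilon> * of_real t)) * of_real (t ^ n))) * iexp (t * (1 + s))"
        by (simp only:) (simp add: mult_ac)
    qed simp
    also have "\<dots> = (indicator {0<..} t *\<^sub>R (exp (-(of_real \<epsilon> * of_real t)) * of_real (t ^ n))) * \<Phi> t"
      unfolding shifted_char_eq by (rule integral_mult_right_zero)
    finally have E: "(LINT s|\<nu>. ?f s t) = (indicator {0<..} t *\<^sub>R (exp (-(of_real \<epsilon> * of_real t)) * of_real (t ^ n))) * \<Phi> t" .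
    show "indicator {0<..} t *\<^sub>R (exp (- (of_real \<epsilon> * of_real t)) * (of_real (t ^ n) * \<Phi> t)) = (LINT s|\<nu>. ?f s t)"
      unfolding E by (simp only: mult_scaleR_left mult.assoc)
  qed simp
  also have "\<dots> = (LINT s|\<nu>. (LINT t|lborel. ?f s t))"
    using Fubini_integral[OF pair] by simp
  also have "\<dots> = (LINT s|\<nu>. fact n / (of_real \<epsilon> - \<i> * of_real (1 + s)) ^ Suc n)"
    using integral_power_exp[OF Re, of _ n] by (simp only: set_lebesgue_integral_def)
  finally show ?thesis .
qed

text \<open>The Abel-regularised integral equals \<open>\<integral> n! / (\<epsilon> - \<i>(1 + s))^(n + 1) d\<nu>(s)\<close>; for odd \<open>n\<close> its
  limit as \<open>\<epsilon> \<rightarrow> 0\<close> is real.\<close>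

lemma Im_odd_moment_shifted_char:
  assumes decay: "\<And>n t. t > 0 \<Longrightarrow> t ^ n * norm (\<Phi> t) \<le> B n" and n: "odd n"
  shows "set_integrable lborel {0<..} (\<lambda>t. of_real (t ^ n) * \<Phi> t)"
    and "Im (LINT t:{0<..}|lborel. of_real (t ^ n) * \<Phi> t) = 0"
proof -
  interpret \<nu>: real_distribution \<nu> by (rule \<nu>)
  have I: "set_integrable lborel {0<..} (\<lambda>t. of_real (t ^ k) * \<Phi> t)" for k
  proof (rule rapid_decay_integrable)
    show "continuous_on {0<..} (\<lambda>t. of_real (t ^ k) * \<Phi> t)" by (intro continuous_intros continuous_shifted_char)
    fix t :: real assume t: "t > 0"
    show "norm (of_real (t ^ k) * \<Phi> t) \<le> max (B k) (B (k + 2))"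
      using decay[OF t, of k] t by (simp add: norm_mult norm_power)
    show "t^2 * norm (of_real (t ^ k) * \<Phi> t) \<le> max (B k) (B (k + 2))"
      using decay[OF t, of "k + 2"] t by (simp add: norm_mult norm_power power_add mult_ac power2_eq_square)
  qed
  show "set_integrable lborel {0<..} (\<lambda>t. of_real (t ^ n) * \<Phi> t)" by (rule I)
  let ?Z = "LINT t:{0<..}|lborel. of_real (t ^ n) * \<Phi> t"
  let ?e = "\<lambda>k. 1 / real (Suc k)"
  have e: "(\<lambda>k. complex_of_real (?e k)) \<longlonglongrightarrow> of_real 0"
    by (intro tendsto_of_real LIMSEQ_Suc lim_1_over_n)
  have e0: "filterlim (\<lambda>k. complex_of_real (?e k)) (at 0 within {s. Re s > 0}) sequentially"
    unfolding filterlim_at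
  proof
    show "(\<lambda>k. complex_of_real (?e k)) \<longlonglongrightarrow> 0" using e by (simp only: of_real_0)
    show "\<forall>\<^sub>F k in sequentially. complex_of_real (?e k) \<in> {s. Re s > 0} \<and> complex_of_real (?e k) \<noteq> 0"
      by (intro always_eventually allI) (simp only: mem_Collect_eq Re_complex_of_real of_real_eq_0_iff, simp)
  qed
  have L: "(laplace (\<lambda>t. of_real (t ^ n) * \<Phi> t) \<longlongrightarrow> ?Z) (at 0 within {s. Re s > 0})"
    using laplace_tendsto_integral[OF I[of n]] I[of "Suc n"] by (simp add: mult_ac)
  note lim1 = filterlim_compose[OF L e0]
  let ?h = "\<lambda>\<epsilon> s. fact n / (\<epsilon> - \<i> * of_real (1 + s)) ^ Suc n :: complex"
  \<comment> \<open>The imaginary part alone has modulus at least 1, so the constant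
    \<open>fact n\<close> dominates the kernels for all \<open>\<epsilon>\<close>.\<close>
  have ge1: "norm (of_real \<epsilon> - \<i> * of_real (1 + s)) \<ge> 1" if "s \<ge> 0" for \<epsilon> s :: real
    using abs_Im_le_cmod[of "of_real \<epsilon> - \<i> * of_real (1 + s)"] that by simp
  have lim2: "(\<lambda>k. LINT s|\<nu>. ?h (of_real (?e k)) s) \<longlonglongrightarrow> (LINT s|\<nu>. ?h 0 s)"
  proof (rule integral_dominated_convergence[where w = "\<lambda>_. fact n"])
    show "AE s in \<nu>. (\<lambda>k. ?h (of_real (?e k)) s) \<longlonglongrightarrow> ?h 0 s"
      using \<nu>(2)
    proof eventually_elim
      case (elim s)
      have "0 - \<i> * complex_of_real (1 + s) \<noteq> 0" using ge1[OF elim, of 0] by auto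
      then show ?case
        using e unfolding of_real_0
        by (intro tendsto_divide tendsto_const tendsto_power tendsto_diff power_not_zero)
    qed
    show "AE s in \<nu>. norm (?h (of_real (?e k)) s) \<le> fact n" for k
      using \<nu>(2)
    proof eventually_elim
      case (elim s)
      have "1 \<le> norm (of_real (?e k) - \<i> * of_real (1 + s)) ^ Suc n" using ge1[OF elim, of "?e k"] by (intro one_le_power)
      then have "fact n / norm (of_real (?e k) - \<i> * of_real (1 + s)) ^ Suc n \<le> fact n / 1"
        by (intro divide_left_mono) auto
      then show ?case by (simp only: norm_divide norm_power norm_fact div_by_1)
    qed
  qed simp_all
  have lap: "laplace (\<lambda>t. of_real (t ^ n) * \<Phi> t) (of_real (?e k)) = (LINT s|\<nu>. ?h (of_real (?e k)) s)" for k
    by (rule laplace_shifted_char) simp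
  have "?Z = (LINT s|\<nu>. ?h 0 s)"
    by (rule LIMSEQ_unique[OF lim1[unfolded lap] lim2])
  moreover have "?h 0 s = of_real (fact n / ((-1) ^ (Suc n div 2) * (1 + s) ^ Suc n))" for s
  proof -
    \<comment> \<open>An even power of a purely imaginary number is real.\<close>
    have "even (Suc n)" using n by simp
    then have "(0 - \<i> * complex_of_real (1 + s)) ^ Suc n = ((- (\<i> * of_real (1 + s)))^2) ^ (Suc n div 2)"
      by (simp only: power_mult[symmetric] dvd_mult_div_cancel diff_0)
    also have "(- (\<i> * complex_of_real (1 + s)))^2 = of_real (- ((1 + s)^2))" by (simp add: power_mult_distrib)
    also have "complex_of_real (- ((1 + s)^2)) ^ (Suc n div 2) = of_real ((- ((1 + s)^2)) ^ (Suc n div 2))" by (simp only: of_real_power)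
    also have "(- ((1 + s)^2)) ^ (Suc n div 2) = (-1) ^ (Suc n div 2) * (1 + s) ^ Suc n"
      using \<open>even (Suc n)\<close>
      by (simp only: power_minus[of "(1+s)^2"] power_mult[symmetric] dvd_mult_div_cancel)
    finally have "(0 - \<i> * complex_of_real (1 + s)) ^ Suc n = of_real ((-1) ^ (Suc n div 2) * (1 + s) ^ Suc n)" .
    then show ?thesis by (simp only: of_real_divide of_real_fact)
  qed
  ultimately have "?Z = (LINT s|\<nu>. of_real (fact n / ((-1) ^ (Suc n div 2) * (1 + s) ^ Suc n)))" by presburger
  also have "\<dots> = of_real (LINT s|\<nu>. fact n / ((-1) ^ (Suc n div 2) * (1 + s) ^ Suc n))"
    by (rule integral_complex_of_real)
  finally show "Im ?Z = 0" by simp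
qed

end

section \<open>Sine transform in the square root of the variable\<close>

lemma set_integral_subst_square:
  fixes f :: "real \<Rightarrow> 'a::euclidean_space"
  assumes f: "continuous_on {0<..} f" "set_integrable lborel {0<..} f"
    and f2: "set_integrable lborel {0<..} (\<lambda>y. (2 * y) *\<^sub>R f (y^2))"
  shows "(LINT x:{0<..}|lborel. f x) = (LINT y:{0<..}|lborel. (2 * y) *\<^sub>R f (y^2))"
proof -
  have "(LBINT x=0..\<infinity>. f x) = (LBINT y=0..\<infinity>. (2 * y) *\<^sub>R f (y^2))"
  proof (rule interval_integral_substitution_integrable)
    show "isCont f (x^2)" if "0 < ereal x" for x
      using f(1) that by (simp add: continuous_on_eq_continuous_at zero_ereal_def)
    show "((\<lambda>y. y^2) has_real_derivative 2 * x) (at x)" for x :: real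
      by (auto intro!: derivative_eq_intros)
    have "((\<lambda>y::real. y^2) \<longlongrightarrow> 0) (at_right 0)" by (rule tendsto_eq_intros | simp)+
    then show "((ereal \<circ> (\<lambda>y. y^2) \<circ> real_of_ereal) \<longlongrightarrow> 0) (at_right 0)"
      unfolding zero_ereal_def by (simp add: ereal_tendsto_simps)
    have "filterlim (\<lambda>y::real. y^2) at_top at_top" by real_asymp
    then show "((ereal \<circ> (\<lambda>y. y^2) \<circ> real_of_ereal) \<longlongrightarrow> \<infinity>) (at_left \<infinity>)"
      by (simp add: ereal_tendsto_simps)
  qed (use f f2 in \<open>auto simp: zero_ereal_def einterval_def greaterThan_def\<close>)
  then show ?thesis by (simp add: interval_integral_to_infinity_eq zero_ereal_def)
qed

text \<open>The substitution \<open>x = y^2\<close> turns the moment of order \<open>p\<close> of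
  \<open>Im (\<Phi> (sqrt x))\<close> into twice the imaginary part of the moment of order
  \<open>2 * p + 1\<close> of \<open>\<Phi>\<close>, and odd orders are those covered by
  \<open>Im_odd_moment_shifted_char\<close>.\<close>

lemma exists_zero_moment_function:
  assumes M: "weight_seq M" and sum: "summable (\<lambda>p. 1 / sqrt (quot M p))"
  obtains \<phi> where "continuous_on UNIV \<phi>" "\<And>x. norm (\<phi> x) \<le> 1" "\<And>x. x \<le> 0 \<Longrightarrow> \<phi> x = 0"
    "\<phi> 1 \<noteq> 0" "\<phi> \<in> C_M M" "\<And>p. moment \<phi> p = 0"
proof -
  note qpos = quot_pos[OF M]
  let ?a = "\<lambda>p. 1 / sqrt (quot M p)"
  have apos: "?a p > 0" for p using qpos by simp
  have Spos: "suminf ?a > 0" using sum apos by (rule suminf_pos)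
  \<comment> \<open>This normalisation keeps the random series below \<open>1 / 2\<close>, so that
    \<open>1 + s\<close> stays in \<open>{1..3/2}\<close>, where the sine is positive; this later
    gives \<open>\<phi> 1 \<noteq> 0\<close>.\<close>
  define \<kappa> where "\<kappa> = 1 / (4 * suminf ?a)"
  have \<kappa>: "\<kappa> > 0" using Spos by (simp add: \<kappa>_def)
  \<comment> \<open>Every coefficient occurs twice, so two factors of the decay estimate combine to
    \<open>quot M p / t^2\<close> up to the constant \<open>R\<close>, and \<open>2 * p\<close> of
    them to \<open>M p / t ^ (2 * p)\<close> up to \<open>R ^ p\<close>.\<close>
  define c where "c = (\<lambda>j. \<kappa> / sqrt (quot M (j div 2)))"
  have c0: "c j > 0" for j using \<kappa> qpos by (simp add: c_def)
  have csum: "(\<Sum>j<n. c j) \<le> 1 / 2" for n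
  proof -
    have dbl: "(\<Sum>j<2*k. c j) = 2 * \<kappa> * (\<Sum>j<k. ?a j)" for k
      by (induction k) (simp_all add: c_def ring_distribs)
    have "(\<Sum>j<n. c j) \<le> (\<Sum>j<2*n. c j)"
      using c0 by (intro sum_mono2) (auto simp: less_imp_le)
    also have "\<dots> \<le> 2 * \<kappa> * suminf ?a"
      unfolding dbl using \<kappa> apos sum by (intro mult_left_mono sum_le_suminf) (auto simp: less_imp_le)
    also have "\<dots> = 1 / 2" using Spos by (simp add: \<kappa>_def)
    finally show ?thesis .
  qed
  have cs: "summable c"
  proof (rule bounded_imp_summable)
    show "0 \<le> c j" for j using c0[of j] by simp
    show "(\<Sum>j\<le>n. c j) \<le> 1 / 2" for n using csum[of "Suc n"] by (simp only: lessThan_Suc_atMost)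
  qed
  have cle: "suminf c \<le> 1 / 2" by (rule suminf_le_const[OF cs csum])
  let ?\<nu> = "series_law c 0"
  interpret \<nu>: real_distribution ?\<nu> by (rule real_distribution_series_law)
  have AE: "AE s in ?\<nu>. 0 \<le> s \<and> s \<le> 1 / 2"
  proof -
    have "AE s in ?\<nu>. 0 \<le> s \<and> s \<le> (\<Sum>k. c (k + 0))"
      using c0 cs by (intro AE_series_law) (auto simp: less_imp_le)
    then show ?thesis by eventually_elim (use cle in auto)
  qed
  then have AE0: "AE s in ?\<nu>. 0 \<le> s" by (auto elim: eventually_mono)
  define \<Phi> where "\<Phi> = (\<lambda>t. iexp t * char ?\<nu> t)"
  note ctx = real_distribution_series_law[of c 0] AE0
  have contPhi: "continuous_on S \<Phi>" for S
    unfolding \<Phi>_def by (rule continuous_shifted_char[OF ctx])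
  have normPhi: "norm (\<Phi> t) \<le> 1" for t
    unfolding \<Phi>_def by (rule norm_shifted_char_le_1[OF ctx])
  have Phi_eq: "\<Phi> t = (LINT s|?\<nu>. iexp (t * (1 + s)))" for t
    unfolding \<Phi>_def by (rule shifted_char_eq[OF ctx])
  define R where "R = 4 / \<kappa>^2"
  have R: "R > 0" using \<kappa> by (simp add: R_def)
  have prodc: "(\<Prod>j<2*p. 2 / (t * c (j + 0))) = R ^ p * M p / t ^ (2 * p)" if "t > 0" for t p
  proof (induction p)
    case 0
    then show ?case using M by (simp add: weight_seq_def)
  next
    case (Suc p)
    have "(\<Prod>j<2*Suc p. 2 / (t * c (j + 0))) = (\<Prod>j<2*p. 2 / (t * c (j + 0))) * (2 / (t * c (2*p)) * (2 / (t * c (2*p+1))))"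
      by simp
    also have "2 / (t * c (2*p)) * (2 / (t * c (2*p+1))) = R * quot M p / t^2"
      using that \<kappa> qpos[of p] by (simp add: c_def R_def field_simps power2_eq_square)
    also have "(\<Prod>j<2*p. 2 / (t * c (j + 0))) * (R * quot M p / t^2) = R ^ Suc p * M (Suc p) / t ^ (2 * Suc p)"
      unfolding Suc using weight_seq_pos[OF M, of p] that by (simp add: quot_def power2_eq_square mult_ac)
    finally show ?case .
  qed
  have decay: "t ^ (2 * p) * norm (\<Phi> t) \<le> R ^ p * M p" if t: "t > 0" for t p
  proof -
    have "norm (\<Phi> t) \<le> R ^ p * M p / t ^ (2 * p)"
      using norm_char_series_law_le[OF c0 cs t, of 0 "2 * p"] unfolding prodc[OF t] by (simp add: \<Phi>_def norm_mult)
    then show ?thesis using t by (simp add: field_simps)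
  qed
  \<comment> \<open>Odd powers are interpolated between the exponents 0 and
    \<open>2 * n\<close>.\<close>
  have decay': "t ^ n * norm (\<Phi> t) \<le> 1 + R ^ n * M n" if t: "t > 0" for t n
  proof -
    have "t ^ n \<le> 1 + t ^ (2 * n)"
    proof (cases "t \<le> 1")
      case True
      then have "t ^ n \<le> 1" using t by (intro power_le_one) auto
      then show ?thesis using t by (simp add: add_increasing2)
    next
      case False
      then have "t ^ n \<le> t ^ (2 * n)" by (intro power_increasing) auto
      then show ?thesis by simp
    qed
    then have "t ^ n * norm (\<Phi> t) \<le> (1 + t ^ (2 * n)) * norm (\<Phi> t)" by (intro mult_right_mono) auto
    also have "\<dots> = norm (\<Phi> t) + t ^ (2 * n) * norm (\<Phi> t)" by (simp add: algebra_simps)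
    also have "\<dots> \<le> 1 + R ^ n * M n" by (intro add_mono normPhi decay t)
    finally show ?thesis .
  qed
  have odd_moment: "set_integrable lborel {0<..} (\<lambda>t. of_real (t ^ n) * \<Phi> t)"
    "Im (LINT t:{0<..}|lborel. of_real (t ^ n) * \<Phi> t) = 0" if n: "odd n" for n
    using Im_odd_moment_shifted_char[OF ctx _ n, of "\<lambda>n. 1 + R ^ n * M n"] decay' unfolding \<Phi>_def by auto
  \<comment> \<open>Since \<open>\<Phi> 0 = 1\<close> is real, the \<open>max\<close> extends the
    function continuously by 0 to the negative axis.\<close>
  define \<phi> where "\<phi> = (\<lambda>x. complex_of_real (Im (\<Phi> (sqrt (max 0 x)))))"
  have cont: "continuous_on S \<phi>" for S
    unfolding \<phi>_def by (intro continuous_intros continuous_on_compose2[OF contPhi[of UNIV]]) auto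
  have n\<phi>: "norm (\<phi> x) \<le> norm (\<Phi> (sqrt (max 0 x)))" for x
    unfolding \<phi>_def norm_of_real by (rule abs_Im_le_cmod)
  have \<phi>decay: "x ^ p * norm (\<phi> x) \<le> R ^ p * M p" if x: "x > 0" for x p
  proof -
    have "x ^ p * norm (\<phi> x) \<le> x ^ p * norm (\<Phi> (sqrt x))"
      using n\<phi>[of x] x by (intro mult_left_mono) auto
    also have "\<dots> = sqrt x ^ (2 * p) * norm (\<Phi> (sqrt x))" using x by (simp add: power_mult)
    also have "\<dots> \<le> R ^ p * M p" using x by (intro decay) auto
    finally show ?thesis .
  qed
  have "\<forall>p. \<forall>x>0. x ^ p * norm (\<phi> x) \<le> 1 * R ^ p * M p" using \<phi>decay by simp
  then have CM: "\<phi> \<in> C_M M"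
    unfolding C_M_def using cont R by blast
  have mom: "moment \<phi> p = 0" for p
  proof -
    have n: "odd (2 * p + 1)" by simp
    let ?Z = "\<lambda>y. of_real (y ^ (2 * p + 1)) * \<Phi> y"
    have eq: "(2 * y) *\<^sub>R ((y^2) ^ p *\<^sub>R \<phi> (y^2)) = of_real (2 * Im (?Z y))" if "y > 0" for y
      using that by (simp add: \<phi>_def scaleR_conv_of_real power_mult)
    have Zi: "integrable lborel (\<lambda>y. Im (indicator {0<..} y *\<^sub>R ?Z y))"
      using odd_moment(1)[OF n] unfolding set_integrable_def by (rule integrable_Im)
    have ind: "indicator {0<..} y *\<^sub>R ((2 * y) *\<^sub>R ((y^2) ^ p *\<^sub>R \<phi> (y^2))) = complex_of_real (2 * Im (indicator {0<..} y *\<^sub>R ?Z y))" for y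
      using eq[of y] by (cases "y > 0") auto
    have "moment \<phi> p = (LINT y:{0<..}|lborel. (2 * y) *\<^sub>R ((y^2) ^ p *\<^sub>R \<phi> (y^2)))"
      unfolding moment_def
    proof (rule set_integral_subst_square)
      show "continuous_on {0<..} (\<lambda>x. x ^ p *\<^sub>R \<phi> x)" by (intro continuous_intros cont)
      show "set_integrable lborel {0<..} (\<lambda>x. x ^ p *\<^sub>R \<phi> x)"
      proof (rule rapid_decay_integrable)
        show "continuous_on {0<..} (\<lambda>x. x ^ p *\<^sub>R \<phi> x)" by (intro continuous_intros cont)
        fix x :: real assume x: "x > 0"
        show "norm (x ^ p *\<^sub>R \<phi> x) \<le> max (R ^ p * M p) (R ^ (p + 2) * M (p + 2))"
          using \<phi>decay[OF x, of p] x by simp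
        show "x^2 * norm (x ^ p *\<^sub>R \<phi> x) \<le> max (R ^ p * M p) (R ^ (p + 2) * M (p + 2))"
          using \<phi>decay[OF x, of "p + 2"] x by (simp add: power_add power2_eq_square mult_ac)
      qed
      show "set_integrable lborel {0<..} (\<lambda>y. (2 * y) *\<^sub>R ((y^2) ^ p *\<^sub>R \<phi> (y^2)))"
        unfolding set_integrable_def ind using Zi by (intro integrable_of_real integrable_mult_right)
    qed
    also have "\<dots> = of_real (2 * (LINT y|lborel. Im (indicator {0<..} y *\<^sub>R ?Z y)))"
      unfolding set_lebesgue_integral_def ind by (simp only: integral_complex_of_real integral_mult_right_zero)
    also have "(LINT y|lborel. Im (indicator {0<..} y *\<^sub>R ?Z y)) = Im (LINT y:{0<..}|lborel. ?Z y)"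
      using odd_moment(1)[OF n] unfolding set_integrable_def set_lebesgue_integral_def by (rule integral_Im)
    also have "\<dots> = 0" by (rule odd_moment(2)[OF n])
    finally show ?thesis by simp
  qed
  have "\<phi> 1 \<noteq> 0"
  proof -
    have sinpos: "0 < sin t" if "t \<in> {1..3/2}" for t :: real
      using that by (intro sin_gt_zero_02) auto
    obtain t0 where t0: "t0 \<in> {1..3/2::real}" "\<And>t. t \<in> {1..3/2} \<Longrightarrow> sin t0 \<le> sin t"
      using continuous_attains_inf[OF compact_Icc _ continuous_on_sin[OF continuous_on_id], of 1 "3/2::real"] by auto
    have I: "integrable ?\<nu> (\<lambda>s. iexp (1 * (1 + s)))"
      by (rule \<nu>.integrable_const_bound[where B = 1]) auto
    have "Im (\<Phi> 1) = (LINT s|?\<nu>. Im (iexp (1 * (1 + s))))"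
      unfolding Phi_eq using integral_Im[OF I] by simp
    also have "\<dots> \<ge> sin t0"
    proof (rule \<nu>.integral_ge_const)
      show "integrable ?\<nu> (\<lambda>s. Im (iexp (1 * (1 + s))))" using I by (rule integrable_Im)
      show "AE s in ?\<nu>. sin t0 \<le> Im (iexp (1 * (1 + s)))"
        using AE by eventually_elim (use t0 in \<open>auto simp: Im_exp\<close>)
    qed
    finally show ?thesis using sinpos[OF t0(1)] by (simp add: \<phi>_def)
  qed
  moreover have "\<phi> x = 0" if "x \<le> 0" for x
    using that by (simp add: \<phi>_def \<Phi>_def char_def \<nu>.prob_space max_def)
  moreover have "norm (\<phi> x) \<le> 1" for x by (rule order.trans[OF n\<phi> normPhi])
  ultimately show ?thesis using that[of \<phi>] cont CM mom by blast
qed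

section \<open>Ultradifferentiable functions with vanishing moments\<close>

lemma S_M_subset_C_M: "S_M M \<subseteq> C_M M"
proof
  fix \<phi> assume "\<phi> \<in> S_M M"
  then obtain h where h: "h > 0" and smooth: "smooth_R \<phi>"
    and bd: "\<And>q. \<exists>K. \<forall>p x. \<bar>x\<bar> ^ p * norm ((vderiv ^^ q) \<phi> x) \<le> K * h ^ p * M p"
    by (auto simp: S_M_def)
  obtain K where K: "\<And>p x. \<bar>x\<bar> ^ p * norm (\<phi> x) \<le> K * h ^ p * M p"
    using bd[of 0] by auto
  have "\<phi> differentiable (at x)" for x
    using smooth[unfolded smooth_R_def, rule_format, of 0 x] by simp
  then have "continuous_on {0<..} \<phi>"
    by (intro continuous_at_imp_continuous_on ballI differentiable_imp_continuous_within)
  moreover have "\<forall>p. \<forall>x>0. x ^ p * norm (\<phi> x) \<le> K * h ^ p * M p"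
    using K by (metis abs_of_pos)
  ultimately show "\<phi> \<in> C_M M" using h by (auto simp: C_M_def)
qed

lemma S_AM_subset_S_M: "S_AM A M \<subseteq> S_M M"
proof
  fix \<phi> assume "\<phi> \<in> S_AM A M"
  then obtain h K where h: "h > 0" and \<phi>: "smooth_R \<phi>" "\<forall>x<0. \<phi> x = 0"
    and bd: "\<And>p q x. \<bar>x\<bar> ^ p * norm ((vderiv ^^ q) \<phi> x) \<le> K * h ^ (p + q) * M p * fact q * A q"
    by (auto simp: S_AM_def)
  have "\<forall>p x. \<bar>x\<bar> ^ p * norm ((vderiv ^^ q) \<phi> x) \<le> (K * h ^ q * fact q * A q) * h ^ p * M p" for q
    using bd[of _ _ q] by (simp add: power_add mult_ac)
  then show "\<phi> \<in> S_M M" using h \<phi> unfolding S_M_def by blast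
qed

lemma vderiv_funpow_zero: "(vderiv ^^ q) (\<lambda>_. 0) = (\<lambda>_. 0)"
  by (induction q) (simp_all add: vderiv_def)

lemma zero_in_S_AM: "(\<lambda>_. 0) \<in> S_AM A M"
proof -
  have "\<exists>h K. h > 0 \<and> (\<forall>p q x. \<bar>x\<bar> ^ p * norm (0::complex) \<le> K * h ^ (p + q) * M p * fact q * A q)"
    by (rule exI[of _ 1], rule exI[of _ 0]) simp
  then show ?thesis by (simp add: S_AM_def smooth_R_def vderiv_funpow_zero)
qed

text \<open>The quotients increase, so each is at least the first. This lets powers of a fixed
  length be absorbed into \<open>h ^ p * M p\<close>.\<close>

lemma weight_seq_power_le:
  assumes M: "weight_seq M"
  shows "quot M 0 ^ p \<le> M p"
proof -
  have "quot M 0 ^ p = (\<Prod>j<p. quot M 0)" by simp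
  also have "\<dots> \<le> (\<Prod>j<p. 1 * quot M (j + 0))"
    using monoD[OF mono_quot[OF M], of 0] quot_pos[OF M, of 0] by (intro prod_mono) auto
  also have "\<dots> = M p"
    unfolding prod_quot_shift[OF M] using M by (simp add: weight_seq_def)
  finally show ?thesis .
qed

text \<open>The function of \<open>exists_zero_moment_function\<close> is smoothed with coefficients
  proportional to \<open>1 / quot (hat_seq A) j\<close>. The derivative factors
  \<open>2 / c j\<close> then telescope to \<open>hat_seq A q\<close> up to a power, and bounded
  shifts preserve the decay.\<close>

lemma exists_S_AM_zero_moments:
  assumes M: "weight_seq M" and sm: "cond_sm M" and nq: "cond_nq A" and A: "weight_seq (hat_seq A)"
    and sum: "summable (\<lambda>p. 1 / sqrt (quot M p))"
  obtains \<psi> x where "\<psi> \<in> S_AM A M" "moment \<psi> = moment (\<lambda>_. 0)" "x > 0" "\<psi> x \<noteq> 0"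
proof -
  obtain \<phi> where cont: "continuous_on UNIV \<phi>" and bd: "\<And>x. norm (\<phi> x) \<le> 1"
    and supp: "\<And>x. x \<le> 0 \<Longrightarrow> \<phi> x = 0" and nz: "\<phi> 1 \<noteq> 0" and CM: "\<phi> \<in> C_M M" and mom: "\<And>p. moment \<phi> p = 0"
    using exists_zero_moment_function[OF M sum] by blast
  obtain h0 K0 where h0: "h0 > 0" and decay: "\<And>p x. x > 0 \<Longrightarrow> x ^ p * norm (\<phi> x) \<le> K0 * h0 ^ p * M p"
    using CM by (auto simp: C_M_def)
  note Mpos = weight_seq_pos[OF M]
  have M0: "M 0 = 1" using M by (simp add: weight_seq_def)
  have qA: "quot (hat_seq A) j = (real j + 1) * quot A j" for j
  proof -
    have "A j \<noteq> 0" using weight_seq_pos[OF A, of j] by (auto simp: hat_seq_def)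
    then show ?thesis by (simp add: quot_def hat_seq_def field_simps)
  qed
  note qApos = quot_pos[OF A]
  have sumA: "summable (\<lambda>j. 1 / quot (hat_seq A) j)"
    using nq by (simp add: cond_nq_def qA)
  let ?S = "\<Sum>j. 1 / quot (hat_seq A) j"
  have Spos: "?S > 0" using sumA qApos by (intro suminf_pos) auto
  obtain d where d: "d > 0" "\<And>y. dist y 1 < d \<Longrightarrow> dist (\<phi> y) (\<phi> 1) < norm (\<phi> 1) / 2"
    using cont nz unfolding continuous_on_iff by (metis UNIV_I half_gt_zero zero_less_norm_iff)
  define \<kappa> where "\<kappa> = d / (2 * ?S)"
  have \<kappa>: "\<kappa> > 0" using d Spos by (simp add: \<kappa>_def)
  define c where "c = (\<lambda>j. \<kappa> * (1 / quot (hat_seq A) j))"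
  have c0: "c j > 0" for j using \<kappa> qApos by (simp add: c_def)
  have cs: "summable c" unfolding c_def using sumA by (rule summable_mult)
  define C where "C = suminf c"
  have C_eq: "C = d / 2" unfolding C_def c_def using suminf_mult[OF sumA, of \<kappa>] Spos by (simp add: \<kappa>_def)
  then have C: "C > 0" "C < d" using d by auto
  define \<psi> where "\<psi> = smoothing c 0 \<phi>"
  have higher: "norm ((vderiv ^^ q) \<psi> x) \<le> B * (\<Prod>j<q. 2 / c j)"
    if "\<And>y. x - C \<le> y \<Longrightarrow> y \<le> x \<Longrightarrow> norm (\<phi> y) \<le> B" for q x B
    unfolding \<psi>_def by (rule norm_higher_vderiv_smoothing_le[OF c0 cs cont bd]) (use that in \<open>simp add: C_def\<close>)
  have zero: "(vderiv ^^ q) \<psi> x = 0" if "x \<le> 0" for q x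
    using higher[of x 0 q] supp that by simp
  have prodc: "(\<Prod>j<q. 2 / c j) = (2 / \<kappa>) ^ q * hat_seq A q" for q
  proof -
    have "(\<Prod>j<q. 2 / c j) = (\<Prod>j<q. (2 / \<kappa>) * quot (hat_seq A) (j + 0))"
      using \<kappa> by (simp add: c_def)
    also have "\<dots> = (2 / \<kappa>) ^ q * hat_seq A q"
      unfolding prod_quot_shift[OF A] using A by (simp add: weight_seq_def)
    finally show ?thesis .
  qed
  \<comment> \<open>The second entry gives \<open>C ^ p \<le> h1 ^ p * M p\<close>, which covers
    points \<open>x\<close> no larger than a multiple of the total shift \<open>C\<close>.\<close>
  define h1 where "h1 = max h0 (C / quot M 0)"
  have h1: "h1 > 0" "h0 \<le> h1" "C / quot M 0 \<le> h1" using h0 by (auto simp: h1_def)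
  define K where "K = max K0 1"
  have K: "K \<ge> 1" "K0 \<le> K" by (auto simp: K_def)
  have Cp: "C ^ p \<le> h1 ^ p * M p" for p
  proof -
    have q0: "quot M 0 > 0" by (rule quot_pos[OF M])
    then have "C ^ p = (C / quot M 0) ^ p * quot M 0 ^ p" by (simp add: power_divide)
    also have "\<dots> \<le> h1 ^ p * M p"
      using C q0 h1 weight_seq_power_le[OF M, of p] by (intro mult_mono power_mono) auto
    finally show ?thesis .
  qed
  have weighted: "x ^ p * norm (\<phi> y) \<le> 2 * K * (2 * h1) ^ p * M p" if x: "x > 0" and y: "x - C \<le> y" "y \<le> x" for x y p
  proof (cases "y \<le> 0")
    case True
    then show ?thesis using supp[of y] K h1 Mpos[of p] by simp
  next
    case False
    then have y0: "y > 0" by simp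
    \<comment> \<open>Here \<open>x \<le> y + C\<close>: the part with \<open>y ^ p\<close> is
      controlled by the decay of \<open>\<phi>\<close>, the part with \<open>C ^ p\<close> by its
      boundedness.\<close>
    have "x ^ p \<le> (2 * max y C) ^ p" using x y by (intro power_mono) auto
    also have "\<dots> = 2 ^ p * max y C ^ p" by (simp add: power_mult_distrib)
    also have "max y C ^ p \<le> y ^ p + C ^ p" using y0 C by (simp add: max_def)
    finally have "x ^ p * norm (\<phi> y) \<le> 2 ^ p * (y ^ p + C ^ p) * norm (\<phi> y)"
      by (simp add: mult_right_mono)
    also have "\<dots> = 2 ^ p * (y ^ p * norm (\<phi> y) + C ^ p * norm (\<phi> y))" by (simp add: algebra_simps)
    also have "\<dots> \<le> 2 ^ p * (K * (h1 ^ p * M p) + h1 ^ p * M p * 1)"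
    proof (intro mult_left_mono add_mono)
      have "y ^ p * norm (\<phi> y) \<le> K0 * (h0 ^ p * M p)" using decay[OF y0, of p] by (simp add: mult_ac)
      also have "\<dots> \<le> K * (h1 ^ p * M p)"
        using K h0 h1 Mpos[of p] by (intro mult_mono power_mono) auto
      finally show "y ^ p * norm (\<phi> y) \<le> K * (h1 ^ p * M p)" .
      show "C ^ p * norm (\<phi> y) \<le> h1 ^ p * M p * 1"
        using Cp[of p] bd[of y] C h1 Mpos[of p] by (intro mult_mono) auto
    qed auto
    also have "\<dots> \<le> 2 ^ p * (K * (h1 ^ p * M p) + K * (h1 ^ p * M p))"
      using K h1 Mpos[of p] by (intro mult_left_mono add_left_mono) (auto simp: mult.commute)
    also have "\<dots> = 2 * K * (2 * h1) ^ p * M p" by (simp add: power_mult_distrib)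
    finally show ?thesis .
  qed
  define h where "h = max (2 * h1) (2 / \<kappa>)"
  have h: "h > 0" "2 * h1 \<le> h" "2 / \<kappa> \<le> h" using h1 by (auto simp: h_def)
  have main: "\<bar>x\<bar> ^ p * norm ((vderiv ^^ q) \<psi> x) \<le> 2 * K * h ^ (p + q) * M p * fact q * A q" for p q x
  proof (cases "x \<le> 0")
    case True
    have "0 \<le> 2 * K * h ^ (p + q) * M p * hat_seq A q"
      using K h Mpos[of p] weight_seq_pos[OF A, of q] by simp
    then show ?thesis using zero[OF True] by (simp add: hat_seq_def mult_ac)
  next
    case False
    then have x: "x > 0" by simp
    \<comment> \<open>The exponent \<open>p\<close> and the point \<open>x\<close> are fixed, so the
      weighted estimate divided by \<open>x ^ p\<close> is a constant bound for
      \<open>\<phi>\<close> on the window of \<open>higher\<close>.\<close>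
    let ?B = "2 * K * (2 * h1) ^ p * M p / x ^ p"
    have "norm ((vderiv ^^ q) \<psi> x) \<le> ?B * ((2 / \<kappa>) ^ q * hat_seq A q)"
      unfolding prodc[symmetric] using weighted[OF x] x by (intro higher) (simp add: pos_le_divide_eq mult.commute)
    then have "x ^ p * norm ((vderiv ^^ q) \<psi> x) \<le> x ^ p * (?B * ((2 / \<kappa>) ^ q * hat_seq A q))"
      using x by (intro mult_left_mono) auto
    also have "\<dots> = (2 * K * M p * hat_seq A q) * ((2 * h1) ^ p * (2 / \<kappa>) ^ q)"
      using x by simp
    also have "\<dots> \<le> (2 * K * M p * hat_seq A q) * (h ^ p * h ^ q)"
      using h h1 \<kappa> K Mpos[of p] weight_seq_pos[OF A, of q]
      by (intro mult_left_mono mult_mono power_mono) auto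
    finally show ?thesis using x by (simp add: hat_seq_def power_add mult_ac)
  qed
  have "\<psi> \<in> S_AM A M"
    unfolding S_AM_def
  proof (intro CollectI conjI allI impI)
    show "smooth_R \<psi>" unfolding \<psi>_def by (rule smooth_R_smoothing[OF c0 cs cont bd])
    show "\<psi> x = 0" if "x < 0" for x using zero[of x 0] that by simp
    show "\<exists>h K. h > 0 \<and> (\<forall>p q x. \<bar>x\<bar> ^ p * norm ((vderiv ^^ q) \<psi> x) \<le> K * h ^ (p + q) * M p * fact q * A q)"
      using h(1) main by blast
  qed
  moreover have "moment \<psi> = moment (\<lambda>_. 0)"
  proof
    fix p
    obtain h K where I: "\<And>p. set_integrable lborel {0<..} (\<lambda>x. of_real (x ^ p) * \<phi> x)"
      using C_M_moment_bound[OF M sm CM] by metis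
    have "moment \<psi> p = 0" unfolding \<psi>_def by (rule moment_smoothing_eq_0[OF c0 cs cont bd supp I mom])
    then show "moment \<psi> p = moment (\<lambda>_. 0) p" by (simp add: moment_def)
  qed
  moreover have "\<psi> 1 \<noteq> 0"
  proof
    assume "\<psi> 1 = 0"
    have I: "integrable (series_law c 0) (\<lambda>s. \<phi> (1 - s))"
      by (rule integrable_series_law_shift[OF c0 cs cont bd])
    interpret prob_space "series_law c 0" by (rule prob_space_series_law)
    \<comment> \<open>If \<open>\<psi> 1\<close> were 0, this average would be
      \<open>- \<phi> 1\<close>, although its modulus is at most
      \<open>norm (\<phi> 1) / 2\<close>.\<close>
    have "smoothing c 0 (\<lambda>x. \<phi> x - \<phi> 1) 1 = (LINT s|(series_law c 0). \<phi> (1 - s)) - (LINT s|(series_law c 0). \<phi> 1)"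
      unfolding smoothing_def by (rule Bochner_Integration.integral_diff[OF I]) simp
    also have "\<dots> = \<psi> 1 - \<phi> 1" using prob_space by (simp add: \<psi>_def smoothing_def)
    finally have "norm (\<phi> 1) = norm (smoothing c 0 (\<lambda>x. \<phi> x - \<phi> 1) 1)" using \<open>\<psi> 1 = 0\<close> by simp
    also have "\<dots> \<le> norm (\<phi> 1) / 2"
    proof (rule norm_smoothing_le[OF c0 cs])
      show "continuous_on UNIV (\<lambda>x. \<phi> x - \<phi> 1)" by (intro continuous_intros cont)
      show "norm (\<phi> x - \<phi> 1) \<le> 2" for x
        using norm_triangle_ineq4[of "\<phi> x" "\<phi> 1"] bd[of x] bd[of 1] by linarith
      fix y assume "1 - (\<Sum>k. c (k + 0)) \<le> y" "y \<le> 1"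
      then have "dist y 1 < d" using C by (simp add: dist_real_def C_def)
      then show "norm (\<phi> y - \<phi> 1) \<le> norm (\<phi> 1) / 2" using d(2)[of y] by (simp add: dist_norm)
    qed
    finally show False using nz by simp
  qed
  ultimately show ?thesis using that[of \<psi> 1] by simp
qed

theorem theorem3p8:
  fixes M A :: "nat \<Rightarrow> real"
  assumes "weight_seq M" and "cond_sm M" and "fact_incl M"
    and "cond_nq A" and "weight_seq (hat_seq A)"
  defines "i \<equiv> \<not> summable (\<lambda>p. 1 / sqrt (quot M p))"
    and "ii \<equiv> (\<forall>f\<in>ultrahol_H (shift1 M). \<forall>g\<in>ultrahol_H (shift1 M).
                borel_coeff f = borel_coeff g \<longrightarrow> (\<forall>z\<in>upper_half. f z = g z))"
    and "iii \<equiv> (\<forall>\<phi>\<in>C_M M. \<forall>\<psi>\<in>C_M M. moment \<phi> = moment \<psi> \<longrightarrow> (\<forall>x>0. \<phi> x = \<psi> x))"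
    and "iv \<equiv> (\<forall>\<phi>\<in>S_M M. \<forall>\<psi>\<in>S_M M. moment \<phi> = moment \<psi> \<longrightarrow> (\<forall>x>0. \<phi> x = \<psi> x))"
    and "v \<equiv> (\<forall>\<phi>\<in>S_AM A M. \<forall>\<psi>\<in>S_AM A M. moment \<phi> = moment \<psi> \<longrightarrow> (\<forall>x>0. \<phi> x = \<psi> x))"
  shows "(i \<longleftrightarrow> ii) \<and> (i \<longleftrightarrow> iii) \<and> (i \<longleftrightarrow> iv) \<and> (i \<longleftrightarrow> v)"
proof -
  have "i \<Longrightarrow> ii" unfolding i_def ii_def using borel_injective[OF assms(1)] by blast
  moreover have "ii \<Longrightarrow> iii"
    unfolding ii_def iii_def using moment_injective_C_M[OF assms(1,2)] by blast
  moreover have "iii \<Longrightarrow> iv" unfolding iii_def iv_def using S_M_subset_C_M by blast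
  moreover have "iv \<Longrightarrow> v" unfolding iv_def v_def using S_AM_subset_S_M by blast
  \<comment> \<open>If the series converged, \<open>exists_S_AM_zero_moments\<close> would give a
    nonzero function with the same moments as the zero function, which also lies in
    \<open>S_AM A M\<close>.\<close>
  moreover have "v \<Longrightarrow> i"
    unfolding v_def i_def using exists_S_AM_zero_moments[OF assms(1,2,4,5)] zero_in_S_AM by metis
  ultimately show ?thesis by blast
qed

end
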